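(* Let $\pi=(d_1,\ldots,d_n)$ be a graphic sequence with $d_1\ge\cdots\ge d_n>0$. Then $\pi$ has a realization that is $\mathcal{S}_3$-connected if and only if $\sum_{i=1}^n d_i\ge 6n-4$ and $d_n\ge 4$.
   Context: All graphs are finite and have no loops; a simple graph also has no multiple edges. An integer-valued sequence $\pi=(d_1,\ldots,d_n)$ is graphic if there is a nontrivial simple graph with degree sequence $\pi$; any such simple graph is called a realization of $\pi$. For an orientation $D$ of a graph $G$ and $v\in V(G)$, $d^+_D(v)$ (resp. $d^-_D(v)$) is the number of edges with tail (resp. head) at $v$. An orientation is strongly connected if for any two vertices $x,y$ there is a directed path from $x$ to $y$. A $\mathbb{Z}_3$ boundary function of $G$ is a map $\beta:V(G)\to\mathbb{Z}_3$ with $\sum_{v\in V(G)}\beta(v)\equiv 0\pmod 3$. A graph $G$ is $\mathcal{S}_3$-connected if for every $\mathbb{Z}_3$ boundary function $\beta$ of $G$ there is a strongly connected orientation $D$ of $G$ such that $d^+_D(v)-d^-_D(v)\equiv\beta(v)\pmod 3$ for every $v\in V(G)$. *)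

theory Defs
  imports "Graph_Theory.Digraph_Component" "HOL-Number_Theory.Cong"
begin

text \<open>An edge is an abstract object carrying a set of two end vertices, so parallel edges are
  possible; an orientation of a graph is then a digraph on the same vertices whose arcs are
  literally the edges.\<close>

record ('v, 'e) multigraph =
  vertices :: "'v set"
  edges :: "'e set"
  ends :: "'e \<Rightarrow> 'v set"

definition loopless_multigraph :: "('v, 'e) multigraph \<Rightarrow> bool" where
  "loopless_multigraph G \<longleftrightarrow> finite (vertices G) \<and> finite (edges G) \<and>
     (\<forall>e \<in> edges G. ends G e \<subseteq> vertices G \<and> card (ends G e) = 2)"

definition simple_multigraph :: "('v, 'e) multigraph \<Rightarrow> bool" where
  "simple_multigraph G \<longleftrightarrow> loopless_multigraph G \<and> inj_on (ends G) (edges G)"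

definition degree :: "('v, 'e) multigraph \<Rightarrow> 'v \<Rightarrow> nat" where
  "degree G v = card {e \<in> edges G. v \<in> ends G e}"

definition has_degree_sequence :: "('v, 'e) multigraph \<Rightarrow> nat \<Rightarrow> (nat \<Rightarrow> int) \<Rightarrow> bool" where
  "has_degree_sequence G n d \<longleftrightarrow>
     (\<exists>v. bij_betw v {1..n} (vertices G) \<and> (\<forall>i \<in> {1..n}. int (degree G (v i)) = d i))"

text \<open>The sequence is \<open>(d 1, \<dots>, d n)\<close>; values of \<open>d\<close> outside \<open>{1..n}\<close> are irrelevant.
  A graph is nontrivial if it has at least two vertices.\<close>

definition realization :: "('v, 'e) multigraph \<Rightarrow> nat \<Rightarrow> (nat \<Rightarrow> int) \<Rightarrow> bool" where
  "realization G n d \<longleftrightarrow>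
     simple_multigraph G \<and> card (vertices G) \<ge> 2 \<and> has_degree_sequence G n d"

text \<open>Every finite graph is isomorphic to one whose vertices and edges are natural numbers.\<close>

definition graphic :: "nat \<Rightarrow> (nat \<Rightarrow> int) \<Rightarrow> bool" where
  "graphic n d \<longleftrightarrow> (\<exists>G :: (nat, nat) multigraph. realization G n d)"

definition orientation :: "('v, 'e) multigraph \<Rightarrow> ('v, 'e) pre_digraph \<Rightarrow> bool" where
  "orientation G D \<longleftrightarrow> verts D = vertices G \<and> arcs D = edges G \<and>
     (\<forall>e \<in> edges G. {tail D e, head D e} = ends G e)"

text \<open>Elements of \<open>\<int>\<^sub>3\<close> are represented by \<open>0\<close>, \<open>1\<close>, \<open>2\<close>.\<close>

definition Z3_boundary :: "('v, 'e) multigraph \<Rightarrow> ('v \<Rightarrow> int) \<Rightarrow> bool" where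
  "Z3_boundary G \<beta> \<longleftrightarrow>
     (\<forall>v \<in> vertices G. \<beta> v \<in> {0, 1, 2}) \<and> [(\<Sum>v \<in> vertices G. \<beta> v) = 0] (mod 3)"

definition S3_connected :: "('v, 'e) multigraph \<Rightarrow> bool" where
  "S3_connected G \<longleftrightarrow> (\<forall>\<beta>. Z3_boundary G \<beta> \<longrightarrow>
     (\<exists>D. orientation G D \<and> strongly_connected D \<and>
        (\<forall>v \<in> vertices G. [int (out_degree D v) - int (in_degree D v) = \<beta> v] (mod 3))))"

end

theory Submission
  imports Defs "HOL-Library.Multiset"
begin

text \<open>Prescribing a \<open>\<int>\<^sub>3\<close> boundary is the same as prescribing all out-degrees modulo \<open>3\<close>. If all
  out-degrees but one are required to be \<open>0\<close>, they are at least \<open>3\<close> in a strongly connected orientation;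
  hence the two conditions are necessary.

  For sufficiency, write \<open>m\<close> for the number of edges, so that the condition reads \<open>m \<ge> 3 n - 2\<close>. Replacing
  an edge \<open>a b\<close> by a path \<open>a v b\<close> and joining the new vertex \<open>v\<close> to at least two further vertices
  preserves \<open>S\<^sub>3\<close>-connectedness: the path contributes one to the out-degree of \<open>v\<close>, and two free edges
  supply every residue. When \<open>v\<close> has degree \<open>4\<close> this costs exactly three edges per vertex. In the tight case
  \<open>m = 3 n - 2\<close> with minimum degree \<open>5\<close> one instead removes a 4-cycle of vertices of degree \<open>5\<close>, replacing it by four
  edges: if some cycle vertex has prescribed out-degree not congruent to \<open>1\<close>, a second path can be routed
  through it and the others become vertices of degree \<open>4\<close>; if all four residues are \<open>1\<close>, the out-degrees
  \<open>1, 4, 1, 4\<close> along the cycle work. In the tight case with \<open>n \<ge> 8\<close> the only condition on the degrees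
  is \<open>4 \<le> d \<le> n - 1\<close> (such sequences are automatically graphic), so the induction runs on
  degree functions alone, down to finitely many sequences with at most \<open>11\<close> terms. Sequences with more edges
  are reduced by deleting a vertex of minimum degree.\<close>

subsection \<open>Orientations with prescribed out-degrees modulo 3\<close>

text \<open>At a single vertex the bound \<open>3 n - 2\<close> is one edge, necessarily a loop.
  This is why intermediate graphs may have loops and parallel edges, and why every small case grows
  from one loop. To stay tight, a construction must gain three edges per new vertex. Degree 4 does
  so with one subdivided edge. Degree 5 does so only with two, which leaves one free edge, two
  attainable out-degrees and hence a missing residue: this is the obstacle. It cannot be evaded,
  since the average degree in the tight case is just below 6, so degree 4 may be absent; but then at
  least four vertices have degree 5, and inserting four together leaves enough freedom. Two side
  conditions shape the rest. For simplicity of the graph, a subdivided edge must have both ends off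
  the other neighbours of the new vertex. And each reduction must keep the upper bound
  \<open>n - 1\<close> for the smaller \<open>n\<close>; where it cannot, only finitely many
  sequences are left.\<close>

definition outdeg :: "('v \<times> 'v) multiset \<Rightarrow> 'v \<Rightarrow> nat" where
  "outdeg A v = size (filter_mset (\<lambda>p. fst p = v) A)"

definition uedge :: "'v \<times> 'v \<Rightarrow> 'v set" where
  "uedge p = {fst p, snd p}"

text \<open>Walks may use any arc and are not confined to \<open>V\<close>, which makes monotonicity
  in the arcs immediate. When all edges lie inside \<open>V\<close>, confinement changes
  nothing.\<close>

definition strong_on :: "'v set \<Rightarrow> ('v \<times> 'v) multiset \<Rightarrow> bool" where
  "strong_on V A \<longleftrightarrow> (\<forall>x\<in>V. \<forall>y\<in>V. (x, y) \<in> (set_mset A)\<^sup>*)"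

text \<open>A multiset of arcs rather than a direction for each edge, because parallel edges carry
  no names here. A loop counts once as an out-arc, so for edges inside \<open>V\<close> the
  out-degrees always sum to the number of edges.\<close>

definition orientable :: "'v set \<Rightarrow> 'v set multiset \<Rightarrow> ('v \<Rightarrow> int) \<Rightarrow> bool" where
  "orientable V E r \<longleftrightarrow> (\<exists>A. image_mset uedge A = E \<and>
     (\<forall>v\<in>V. [int (outdeg A v) = r v] (mod 3)) \<and> strong_on V A)"

text \<open>Below, \<open>r\<close> prescribes the out-degrees modulo \<open>3\<close>, and a multiset \<open>E\<close> of edges may contain loops, as
  singletons.\<close>

definition S3 :: "'v set \<Rightarrow> 'v set multiset \<Rightarrow> bool" where
  "S3 V E \<longleftrightarrow> (\<forall>r. [(\<Sum>v\<in>V. r v) = int (size E)] (mod 3) \<longrightarrow> orientable V E r)"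

lemma outdeg_add: "outdeg (add_mset (x, y) A) v = outdeg A v + (if v = x then 1 else 0)"
  by (simp add: outdeg_def)

lemma orientable_cong:
  assumes "orientable V E r" "\<And>v. v \<in> V \<Longrightarrow> [r v = r' v] (mod 3)"
  shows "orientable V E r'"
proof -
  obtain A where "image_mset uedge A = E" "\<forall>v\<in>V. [int (outdeg A v) = r v] (mod 3)" "strong_on V A"
    using assms(1) unfolding orientable_def by blast
  then show ?thesis
    unfolding orientable_def using assms(2) cong_trans by (intro exI[of _ A]) blast
qed

lemma strong_on_mono:
  assumes "strong_on V A" "set_mset A \<subseteq> set_mset B"
  shows "strong_on V B"
  using assms rtrancl_mono unfolding strong_on_def by blast

lemma orientable_add_arc:
  assumes "orientable V E r"
  shows "orientable V (add_mset {x, y} E) (\<lambda>v. r v + (if v = x then 1 else 0))"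
proof -
  obtain A where A: "image_mset uedge A = E" "\<forall>v\<in>V. [int (outdeg A v) = r v] (mod 3)"
      "strong_on V A"
    using assms unfolding orientable_def by blast
  have "strong_on V (add_mset (x, y) A)"
    using A(3) by (rule strong_on_mono) auto
  moreover have "\<forall>v\<in>V. [int (outdeg (add_mset (x, y) A) v) = r v + (if v = x then 1 else 0)] (mod 3)"
    using A(2) by (auto simp: outdeg_add intro!: cong_add)
  ultimately show ?thesis
    unfolding orientable_def using A(1) by (intro exI[of _ "add_mset (x, y) A"]) (auto simp: uedge_def)
qed

text \<open>The arc over \<open>{a, b}\<close>, whichever way it points, becomes a detour through
  \<open>v\<close>: its tail keeps its out-degree, \<open>v\<close> gains one, and old walks
  survive. Allowing \<open>v\<close> in \<open>V\<close> is what later routes a second path through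
  the same vertex; otherwise \<open>v\<close> must lie on no edge, so that its previous out-degree
  is 0.\<close>

lemma orientable_subdivide:
  assumes "orientable V (add_mset {a, b} E) r" "a \<in> V" "b \<in> V"
    and fresh: "v \<in> V \<or> v \<notin> \<Union>(set_mset E)"
  shows "orientable (insert v V) (add_mset {a, v} (add_mset {b, v} E))
           (\<lambda>x. (if x \<in> V then r x else 0) + (if x = v then 1 else 0))"
proof -
  obtain A where A: "image_mset uedge A = add_mset {a, b} E"
      "\<forall>v\<in>V. [int (outdeg A v) = r v] (mod 3)" "strong_on V A"
    using assms unfolding orientable_def by blast
  have "\<exists>p B. A = add_mset p B \<and> uedge p = {a, b} \<and> image_mset uedge B = E"
    using A(1) by (metis msed_map_invR)
  then obtain p B where B: "A = add_mset p B" "uedge p = {a, b}" "image_mset uedge B = E"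
    by blast
  obtain s t where st: "p = (s, t)" "{s, t} = {a, b}"
    using B(2) by (metis uedge_def prod.collapse)
  define A' where "A' = add_mset (s, v) (add_mset (v, t) B)"
  have stV: "s \<in> V" "t \<in> V" using st(2) assms(2,3) by (auto simp: doubleton_eq_iff)
  have img: "image_mset uedge A' = add_mset {a, v} (add_mset {b, v} E)"
    using st(2) B(3) by (auto simp: A'_def uedge_def doubleton_eq_iff insert_commute add_mset_commute)
  have new: "outdeg B v = 0" if "v \<notin> V"
  proof -
    have "fst q \<noteq> v" if "q \<in># B" for q
    proof -
      have "uedge q \<in># E" using that B(3) by auto
      then have "v \<notin> uedge q" using fresh \<open>v \<notin> V\<close> by auto
      then show ?thesis by (auto simp: uedge_def)
    qed
    then have "filter_mset (\<lambda>p. fst p = v) B = {#}"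
      by auto
    then show ?thesis by (simp add: outdeg_def)
  qed
  have deg: "[int (outdeg A' x) = (if x \<in> V then r x else 0) + (if x = v then 1 else 0)] (mod 3)"
    if "x \<in> insert v V" for x
  proof (cases "x \<in> V")
    case True
    have "int (outdeg A' x) = int (outdeg A x) + (if x = v then 1 else 0)"
      by (simp add: A'_def B(1) st(1) outdeg_add)
    then show ?thesis using A(2) True by (auto intro!: cong_add)
  next
    case False
    then have "x = v" "v \<notin> V" using that by auto
    then show ?thesis using new stV by (auto simp: A'_def outdeg_add)
  qed
  have "set_mset A \<subseteq> (set_mset A')\<^sup>*"
  proof
    fix q assume "q \<in> set_mset A"
    then have "q = (s, t) \<or> q \<in># B" using B(1) st(1) by auto
    moreover have "(s, t) \<in> (set_mset A')\<^sup>*"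
      by (rule rtrancl_trans[of _ v]) (auto simp: A'_def)
    moreover have "q \<in> (set_mset A')\<^sup>*" if "q \<in># B"
      using that by (auto simp: A'_def)
    ultimately show "q \<in> (set_mset A')\<^sup>*" by blast
  qed
  then have star: "(set_mset A)\<^sup>* \<subseteq> (set_mset A')\<^sup>*"
    by (metis rtrancl_mono rtrancl_idemp)
  have VV: "(x, y) \<in> (set_mset A')\<^sup>*" if "x \<in> V" "y \<in> V" for x y
    using A(3) star that unfolding strong_on_def by blast
  have "(s, v) \<in> (set_mset A')\<^sup>*" "(v, t) \<in> (set_mset A')\<^sup>*"
    by (auto simp: A'_def)
  then have "strong_on (insert v V) A'"
    unfolding strong_on_def using VV stV by (metis insert_iff rtrancl.rtrancl_refl rtrancl_trans)
  then show ?thesis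
    unfolding orientable_def using img deg by blast
qed

lemma sum_shift:
  assumes "finite V" "x \<in> V"
  shows "(\<Sum>v\<in>V. f v + (if v = x then c else 0)) = sum f V + (c :: int)"
  using assms by (simp add: sum.distrib sum.delta)

lemma S3_add_edge:
  assumes "S3 V E" "finite V" "x \<in> V"
  shows "S3 V (add_mset {x, y} E)"
  unfolding S3_def
proof (intro allI impI)
  fix r assume r: "[(\<Sum>v\<in>V. r v) = int (size (add_mset {x, y} E))] (mod 3)"
  define r' where "r' v = r v + (if v = x then -1 else 0)" for v
  have "sum r' V = sum r V - 1"
    unfolding r'_def using assms sum_shift[of V x r "-1"] by simp
  then have "[sum r' V = int (size E)] (mod 3)"
    using cong_diff[OF r cong_refl[of 1]] by simp
  then have "orientable V E r'" using assms(1) by (simp add: S3_def)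
  from orientable_add_arc[OF this, of x y] show "orientable V (add_mset {x, y} E) r"
    by (rule orientable_cong) (simp add: r'_def)
qed

lemma S3_singleton: "S3 {v} {#}"
proof -
  have "orientable {v} {#} r" if "[r v = 0] (mod 3)" for r
    unfolding orientable_def using that
    by (auto simp: outdeg_def strong_on_def cong_sym)
  then show ?thesis by (auto simp: S3_def)
qed

lemma outdeg_empty: "outdeg {#} v = 0"
  by (simp add: outdeg_def)

lemma sum_outdeg_add:
  assumes "finite V"
  shows "(\<Sum>v\<in>V. int (outdeg (add_mset (x, y) A) v)) =
    (\<Sum>v\<in>V. int (outdeg A v)) + (if x \<in> V then 1 else 0)"
proof -
  have "(\<Sum>v\<in>V. int (outdeg (add_mset (x, y) A) v)) =
      (\<Sum>v\<in>V. int (outdeg A v) + (if v = x then 1 else 0))"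
    by (rule sum.cong) (auto simp: outdeg_add)
  then show ?thesis using assms by (simp add: sum.distrib sum.delta)
qed

text \<open>Once the orientation is strong, further edges can be directed at will: \<open>B\<close>
  fixes their directions and merely shifts the prescription.\<close>

lemma orientable_add_arcs:
  assumes "orientable V E r"
  shows "orientable V (image_mset uedge B + E) (\<lambda>v. r v + int (outdeg B v))"
proof (induction B)
  case empty
  then show ?case using assms by (simp add: outdeg_def)
next
  case (add p B)
  obtain x y where p: "p = (x, y)" by fastforce
  show ?case
    using orientable_add_arc[OF add, of x y]
    by (auto simp: p uedge_def outdeg_add add.assoc elim!: orientable_cong)
qed

lemma orientable_subdivide_new:
  assumes "orientable V (add_mset {a, b} E) r" "a \<in> V" "b \<in> V" "v \<notin> V" "\<Union>(set_mset E) \<subseteq> V"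
  shows "orientable (insert v V) (add_mset {a, v} (add_mset {b, v} E)) (r(v := 1))"
  using assms by (intro orientable_cong[OF orientable_subdivide[OF assms(1-3), of v]]) auto

lemma orientable_subdivide_old:
  assumes "orientable V (add_mset {a, b} E) r" "a \<in> V" "b \<in> V" "v \<in> V"
  shows "orientable V (add_mset {a, v} (add_mset {b, v} E)) (r(v := r v + 1))"
  using orientable_subdivide[OF assms(1-3), of v] assms(4) 
  by (auto simp: insert_absorb elim!: orientable_cong)

section \<open>Inserting one vertex of degree four or five\<close>

lemma mod3_cases:
  fixes t :: int
  obtains "[t = 0] (mod 3)" | "[t = 1] (mod 3)" | "[t = 2] (mod 3)"
proof -
  have "t mod 3 = 0 \<or> t mod 3 = 1 \<or> t mod 3 = 2" by presburger
  then show ?thesis using that by (auto simp: cong_def)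
qed

text \<open>Bookkeeping for the residue condition: \<open>s\<close> is what the new vertices
  require, \<open>t\<close> what the old ones require, \<open>k\<close> the out-arcs that old
  vertices spend on new edges, and \<open>m\<close> the size of the smaller graph.\<close>

lemma cong3_diff:
  fixes s :: int
  assumes "[s = a] (mod 3)" "[s + t = n] (mod 3)" "3 dvd n - a - k - m"
  shows "[t - k = m] (mod 3)"
proof -
  have "[s + t - s - k = n - a - k] (mod 3)"
    by (intro cong_diff assms cong_refl)
  moreover have "[n - a - k = m] (mod 3)"
    using assms(3) by (simp add: cong_iff_dvd_diff)
  ultimately show ?thesis by (simp add: cong_trans)
qed

text \<open>The residue condition for the smaller graph is automatic, since out-degrees sum to the
  number of edges. The vertices \<open>a\<close>, \<open>b\<close>, \<open>x\<close>,
  \<open>y\<close> may coincide, so even a loop can be subdivided.\<close>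

lemma S3_add_vertex4:
  assumes S: "S3 V (add_mset {a, b} E)" and fin: "finite V" and E: "\<Union>(set_mset E) \<subseteq> V"
    and V: "a \<in> V" "b \<in> V" "x \<in> V" "y \<in> V" "v \<notin> V"
  shows "S3 (insert v V) (add_mset {a, v} (add_mset {b, v} (add_mset {x, v} (add_mset {y, v} E))))"
    (is "S3 _ ?E")
  unfolding S3_def
proof (intro allI impI)
  fix r assume r: "[(\<Sum>v\<in>insert v V. r v) = int (size ?E)] (mod 3)"
  define s where "s = r v"
  have r1: "[s + sum r V = int (size E) + 4] (mod 3)"
    using r V(5) fin by (simp add: s_def add.commute)
  \<comment> \<open>Here \<open>B\<close> directs the two free edges. Old vertices are asked only
    for what remains after their arcs in \<open>B\<close>, and the summand 1 at \<open>v\<close>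
    comes from the path.\<close>
  have *: "orientable (insert v V) ?E r"
    if B: "image_mset uedge B = {#{x, v}, {y, v}#}" "[s = 1 + int (outdeg B v)] (mod 3)"
      and "[sum r V - (\<Sum>w\<in>V. int (outdeg B w)) = int (size E) + 1] (mod 3)" for B
  proof -
    let ?r = "\<lambda>w. r w - int (outdeg B w)"
    have "orientable V (add_mset {a, b} E) ?r"
      using S that(3) by (simp add: S3_def sum_subtractf add.commute)
    from orientable_add_arcs[OF orientable_subdivide_new[OF this V(1,2,5) E], of B]
    have "orientable (insert v V) ?E (\<lambda>w. (?r(v := 1)) w + int (outdeg B w))"
      using B(1) by (simp add: add_mset_commute)
    then show ?thesis
      using B(2) by (elim orientable_cong) (auto simp: s_def intro: cong_sym)
  qed
  have xy: "x \<noteq> v" "y \<noteq> v" using V by auto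
  show "orientable (insert v V) ?E r"
  proof (cases s rule: mod3_cases)
    case 1
    let ?B = "{#(v, x), (v, y)#}"
    have o: "(\<Sum>w\<in>V. int (outdeg ?B w)) = 0" "int (outdeg ?B v) = 2"
      using V xy unfolding sum_outdeg_add[OF fin] by (auto simp: outdeg_empty outdeg_add)
    show ?thesis
    proof (rule *)
      show "image_mset uedge ?B = {#{x, v}, {y, v}#}"
        by (simp add: uedge_def insert_commute[of v])
      show "[s = 1 + int (outdeg ?B v)] (mod 3)"
        using 1 unfolding o by (simp add: cong_def)
      show "[sum r V - (\<Sum>w\<in>V. int (outdeg ?B w)) = int (size E) + 1] (mod 3)"
        unfolding o by (rule cong3_diff[OF 1 r1]) simp
    qed
  next
    case 2
    let ?B = "{#(x, v), (y, v)#}"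
    have o: "(\<Sum>w\<in>V. int (outdeg ?B w)) = 2" "int (outdeg ?B v) = 0"
      using V xy unfolding sum_outdeg_add[OF fin] by (auto simp: outdeg_empty outdeg_add)
    show ?thesis
    proof (rule *)
      show "image_mset uedge ?B = {#{x, v}, {y, v}#}"
        by (simp add: uedge_def insert_commute[of v])
      show "[s = 1 + int (outdeg ?B v)] (mod 3)"
        using 2 unfolding o by (simp add: cong_def)
      show "[sum r V - (\<Sum>w\<in>V. int (outdeg ?B w)) = int (size E) + 1] (mod 3)"
        unfolding o by (rule cong3_diff[OF 2 r1]) simp
    qed
  next
    case 3
    let ?B = "{#(x, v), (v, y)#}"
    have o: "(\<Sum>w\<in>V. int (outdeg ?B w)) = 1" "int (outdeg ?B v) = 1"
      using V xy unfolding sum_outdeg_add[OF fin] by (auto simp: outdeg_empty outdeg_add)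
    show ?thesis
    proof (rule *)
      show "image_mset uedge ?B = {#{x, v}, {y, v}#}"
        by (simp add: uedge_def insert_commute[of v])
      show "[s = 1 + int (outdeg ?B v)] (mod 3)"
        using 3 unfolding o by (simp add: cong_def)
      show "[sum r V - (\<Sum>w\<in>V. int (outdeg ?B w)) = int (size E) + 1] (mod 3)"
        unfolding o by (rule cong3_diff[OF 3 r1]) simp
    qed
  qed
qed

text \<open>Two paths through \<open>v\<close> and one free edge give out-degree \<open>2\<close> or \<open>3\<close>, so only the residue \<open>1\<close> is missing.\<close>

lemma orientable_add_vertex5:
  assumes S: "S3 V (add_mset {a, b} (add_mset {c, d} E))" and fin: "finite V"
    and E: "\<Union>(set_mset E) \<subseteq> V"
    and V: "a \<in> V" "b \<in> V" "c \<in> V" "d \<in> V" "e \<in> V" "v \<notin> V"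
    and r: "[sum r (insert v V) = int (size E) + 5] (mod 3)" "\<not> [r v = 1] (mod 3)"
  shows "orientable (insert v V)
    (add_mset {a, v} (add_mset {b, v} (add_mset {c, v} (add_mset {d, v} (add_mset {e, v} E))))) r"
    (is "orientable _ ?E r")
proof -
  have ev: "e \<noteq> v" using V by auto
  have r1: "[r v + sum r V = int (size E) + 5] (mod 3)"
    using r V fin by (simp add: add.commute)
  have E1: "\<Union>(set_mset (add_mset {c, d} E)) \<subseteq> V" using E V by auto
  \<comment> \<open>The first subdivision creates \<open>v\<close> with out-degree 1; the second
    passes through the now present \<open>v\<close> and raises it to 2.\<close>
  have *: "orientable (insert v V) (add_mset {a, v} (add_mset {b, v} (add_mset {c, v} (add_mset {d, v} E)))) (q(v := 2))"
    if "[sum q V = int (size E) + 2] (mod 3)" for q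
  proof -
    have "orientable V (add_mset {a, b} (add_mset {c, d} E)) q"
      using S that by (simp add: S3_def add.commute)
    from orientable_subdivide_new[OF this V(1,2,6) E1]
    have "orientable (insert v V) (add_mset {c, d} (add_mset {a, v} (add_mset {b, v} E))) (q(v := 1))"
      by (simp add: add_mset_commute)
    from orientable_subdivide_old[OF this, of v] V
    show ?thesis by (simp add: add_mset_commute)
  qed
  show ?thesis
  proof (cases "r v" rule: mod3_cases)
    case 1
    have "[sum r V - 0 = int (size E) + 2] (mod 3)"
      by (rule cong3_diff[OF 1 r1]) simp
    then have "[sum r V = int (size E) + 2] (mod 3)" by simp
    from orientable_add_arc[OF *[OF this], of v e]
    have "orientable (insert v V) ?E (\<lambda>u. (r(v := 2)) u + (if u = v then 1 else 0))"
      by (simp only: insert_commute[of v e] add_mset_commute)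
    then show ?thesis
      by (rule orientable_cong) (use 1 in \<open>auto simp: cong_def\<close>)
  next
    case 3
    define q where "q u = r u + (if u = e then -1 else 0)" for u
    have "sum q V = sum r V - 1"
      unfolding q_def using fin V(5) sum_shift[of V e r "-1"] by simp
    then have "[sum q V = int (size E) + 2] (mod 3)"
      using cong_diff[OF cong_diff[OF r1 3] cong_refl[of 1]] by (simp add: add.commute)
    from orientable_add_arc[OF *[OF this], of e v] 
    have "orientable (insert v V) ?E (\<lambda>u. (q(v := 2)) u + (if u = e then 1 else 0))"
      by (simp add: add_mset_commute)
    then show ?thesis
      by (rule orientable_cong) (use 3 ev in \<open>auto simp: q_def cong_sym\<close>)
  qed (use r in auto)
qed

subsection \<open>Inserting a 4-cycle or a complete graph on four vertices\<close>

text \<open>In each quadruple, \<open>u\<close> is a new cycle vertex, \<open>{a, b}\<close> the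
  edge it subdivides and \<open>e\<close> the old end of its free edge. With the two cycle edges
  every \<open>u\<close> gets degree 5; sixteen edges replace four, a gain of three per new
  vertex.\<close>

definition cycle_edges :: "'v \<times> 'v \<times> 'v \<times> 'v \<Rightarrow> 'v \<times> 'v \<times> 'v \<times> 'v \<Rightarrow> 'v \<times> 'v \<times> 'v \<times> 'v \<Rightarrow>
    'v \<times> 'v \<times> 'v \<times> 'v \<Rightarrow> 'v set multiset" where
  "cycle_edges = (\<lambda>(a1, b1, e1, u1) (a2, b2, e2, u2) (a3, b3, e3, u3) (a4, b4, e4, u4).
     {#{a1, u1}, {b1, u1}, {e1, u1}, {a2, u2}, {b2, u2}, {e2, u2},
       {a3, u3}, {b3, u3}, {e3, u3}, {a4, u4}, {b4, u4}, {e4, u4},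
       {u1, u2}, {u2, u3}, {u3, u4}, {u4, u1}#})"

lemma cycle_edges_rotate:
  "cycle_edges p1 p2 p3 p4 = cycle_edges p2 p3 p4 p1"
  by (cases p1; cases p2; cases p3; cases p4) (simp only: cycle_edges_def prod.case add_mset_commute)

lemma orientable_cycle_not_all_one:
  assumes S: "S3 V ({#{a1, b1}, {a2, b2}, {a3, b3}, {a4, b4}#} + E)" and fin: "finite V"
    and E: "\<Union>(set_mset E) \<subseteq> V"
    and V: "{a1, b1, e1, a2, b2, e2, a3, b3, e3, a4, b4, e4} \<subseteq> V"
    and u: "distinct [u1, u2, u3, u4]" "V \<inter> {u1, u2, u3, u4} = {}"
    and r: "[sum r (V \<union> {u1, u2, u3, u4}) = int (size E) + 16] (mod 3)" "\<not> [r u1 = 1] (mod 3)"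
  shows "orientable (V \<union> {u1, u2, u3, u4})
     (cycle_edges (a1, b1, e1, u1) (a2, b2, e2, u2) (a3, b3, e3, u3) (a4, b4, e4, u4) + E) r"
proof -
  have "S3 V (add_mset {a2, b2} ({#{a1, b1}, {a3, b3}, {a4, b4}#} + E))"
    using S by (simp add: add_mset_commute)
  \<comment> \<open>The edge \<open>{e1, u2}\<close> is temporary. After \<open>u2\<close>,
    \<open>u3\<close>, \<open>u4\<close> have been inserted with degree 4 each, \<open>u1\<close>
    subdivides both \<open>{a1, b1}\<close> and this edge, which produces \<open>{e1, u1}\<close>
    and \<open>{u1, u2}\<close>; its free edge goes to \<open>u4\<close>.\<close>
  from S3_add_vertex4[OF this fin, of e1 e2 u2]
  have 2: "S3 (insert u2 V) (add_mset {a3, b3} ({#{a1, b1}, {a4, b4}, {e1, u2}, {a2, u2}, {b2, u2}, {e2, u2}#} + E))"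
    using V u E by (simp add: add_mset_commute)
  from S3_add_vertex4[OF 2, of u2 e3 u3]
  have 3: "S3 (insert u3 (insert u2 V)) (add_mset {a4, b4} ({#{a1, b1}, {e1, u2}, {a2, u2}, {b2, u2}, {e2, u2},
      {a3, u3}, {b3, u3}, {u2, u3}, {e3, u3}#} + E))"
    using V u E fin by (simp add: add_mset_commute) (auto simp: insert_commute)
  from S3_add_vertex4[OF 3, of u3 e4 u4]
  have 4: "S3 (insert u4 (insert u3 (insert u2 V))) (add_mset {a1, b1} (add_mset {e1, u2} ({#{a2, u2}, {b2, u2}, {e2, u2},
      {a3, u3}, {b3, u3}, {u2, u3}, {e3, u3}, {a4, u4}, {b4, u4}, {u3, u4}, {e4, u4}#} + E)))"
    using V u E fin by (simp add: add_mset_commute) (auto simp: insert_commute)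
  have V': "insert u1 (insert u4 (insert u3 (insert u2 V))) = V \<union> {u1, u2, u3, u4}" by auto
  have "orientable (insert u1 (insert u4 (insert u3 (insert u2 V))))
    (add_mset {a1, u1} (add_mset {b1, u1} (add_mset {e1, u1} (add_mset {u2, u1} (add_mset {u4, u1}
      ({#{a2, u2}, {b2, u2}, {e2, u2}, {a3, u3}, {b3, u3}, {u2, u3}, {e3, u3}, {a4, u4}, {b4, u4}, {u3, u4}, {e4, u4}#} + E)))))) r"
  proof (rule orientable_add_vertex5[OF 4])
    show "\<Union>(set_mset ({#{a2, u2}, {b2, u2}, {e2, u2}, {a3, u3}, {b3, u3}, {u2, u3}, {e3, u3},
        {a4, u4}, {b4, u4}, {u3, u4}, {e4, u4}#} + E)) \<subseteq> insert u4 (insert u3 (insert u2 V))"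
      using V E by auto
    show "[sum r (insert u1 (insert u4 (insert u3 (insert u2 V)))) = int (size ({#{a2, u2}, {b2, u2}, {e2, u2},
        {a3, u3}, {b3, u3}, {u2, u3}, {e3, u3}, {a4, u4}, {b4, u4}, {u3, u4}, {e4, u4}#} + E)) + 5] (mod 3)"
      using r(1) unfolding V' by (simp add: add.commute)
  qed (use V u fin r(2) in auto)
  then show ?thesis
    unfolding V' cycle_edges_def prod.case by (simp add: add_mset_commute insert_commute[of u2 u1])
qed

lemma orientable_cycle_all_one:
  assumes S: "S3 V ({#{a1, b1}, {a2, b2}, {a3, b3}, {a4, b4}#} + E)" and fin: "finite V"
    and E: "\<Union>(set_mset E) \<subseteq> V"
    and V: "{a1, b1, e1, a2, b2, e2, a3, b3, e3, a4, b4, e4} \<subseteq> V"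
    and u: "distinct [u1, u2, u3, u4]" "V \<inter> {u1, u2, u3, u4} = {}"
    and r: "[sum r (V \<union> {u1, u2, u3, u4}) = int (size E) + 16] (mod 3)"
      "\<And>u. u \<in> {u1, u2, u3, u4} \<Longrightarrow> [r u = 1] (mod 3)"
  shows "orientable (V \<union> {u1, u2, u3, u4})
     (cycle_edges (a1, b1, e1, u1) (a2, b2, e2, u2) (a3, b3, e3, u3) (a4, b4, e4, u4) + E) r"
proof -
  \<comment> \<open>Strong connectivity rests on the four subdivided edges alone, so the other eight
    can be directed freely: \<open>u2\<close> and \<open>u4\<close> are sources, \<open>u1\<close>
    and \<open>u3\<close> sinks. The paths add 1 everywhere, giving 1 or 4. The old vertices
    \<open>e1\<close> and \<open>e3\<close> pay for the two arcs that start outside the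
    cycle.\<close>
  define B where "B = {#(e1, u1), (e3, u3), (u2, e2), (u4, e4), (u2, u1), (u2, u3), (u4, u1), (u4, u3)#}"
  define q where "q w = r w - int (outdeg B w)" for w
  have u': "u1 \<notin> V" "u2 \<notin> V" "u3 \<notin> V" "u4 \<notin> V" using u by auto
  have B: "(\<Sum>w\<in>V. int (outdeg B w)) = 2" "outdeg B u1 = 0" "outdeg B u2 = 3" "outdeg B u3 = 0" "outdeg B u4 = 3"
    using u' u V unfolding B_def sum_outdeg_add[OF fin] by (auto simp: outdeg_empty outdeg_add)
  have "sum r (V \<union> {u1, u2, u3, u4}) = r u1 + r u2 + r u3 + r u4 + sum r V"
    using u u' fin by (simp add: add.assoc add.commute add.left_commute)
  then have s: "[r u1 + r u2 + r u3 + r u4 + sum r V = int (size E) + 16] (mod 3)"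
    using r by simp
  have "[r u1 + r u2 + r u3 + r u4 = 1 + 1 + 1 + 1] (mod 3)"
    by (intro cong_add r) auto
  from cong3_diff[OF this s, of 2 "int (size E) + 4"]
  have "[sum q V = int (size E) + 4] (mod 3)"
    by (simp add: q_def sum_subtractf B)
  then have 0: "orientable V (add_mset {a1, b1} ({#{a2, b2}, {a3, b3}, {a4, b4}#} + E)) q"
    using S by (simp add: S3_def add.commute)
  from orientable_subdivide_new[OF 0, of u1]
  have 1: "orientable (insert u1 V) (add_mset {a2, b2} ({#{a3, b3}, {a4, b4}, {a1, u1}, {b1, u1}#} + E)) (q(u1 := 1))"
    using V u' E by (simp add: add_mset_commute)
  from orientable_subdivide_new[OF 1, of u2]
  have 2: "orientable (insert u2 (insert u1 V)) (add_mset {a3, b3} ({#{a4, b4}, {a1, u1}, {b1, u1}, {a2, u2}, {b2, u2}#} + E))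
      (q(u1 := 1, u2 := 1))"
    using V u u' E by (simp add: add_mset_commute) (auto simp: insert_commute)
  from orientable_subdivide_new[OF 2, of u3]
  have 3: "orientable (insert u3 (insert u2 (insert u1 V))) (add_mset {a4, b4} ({#{a1, u1}, {b1, u1}, {a2, u2}, {b2, u2}, {a3, u3}, {b3, u3}#} + E))
      (q(u1 := 1, u2 := 1, u3 := 1))"
    using V u u' E by (simp add: add_mset_commute) (auto simp: insert_commute)
  have V': "insert u4 (insert u3 (insert u2 (insert u1 V))) = V \<union> {u1, u2, u3, u4}" by auto
  from orientable_subdivide_new[OF 3, of u4]
  have 4: "orientable (V \<union> {u1, u2, u3, u4}) ({#{a1, u1}, {b1, u1}, {a2, u2}, {b2, u2}, {a3, u3}, {b3, u3}, {a4, u4}, {b4, u4}#} + E)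
      (q(u1 := 1, u2 := 1, u3 := 1, u4 := 1))"
    unfolding V' using V u u' E by (simp add: add_mset_commute) (auto simp: insert_commute)
  have e: "image_mset uedge B + ({#{a1, u1}, {b1, u1}, {a2, u2}, {b2, u2}, {a3, u3}, {b3, u3}, {a4, u4}, {b4, u4}#} + E) =
      cycle_edges (a1, b1, e1, u1) (a2, b2, e2, u2) (a3, b3, e3, u3) (a4, b4, e4, u4) + E"
    unfolding B_def cycle_edges_def prod.case
    by (simp add: uedge_def insert_commute[of u2 e2] insert_commute[of u4 e4] insert_commute[of u2 u1] insert_commute[of u4 u3])
  show ?thesis
    using orientable_add_arcs[OF 4, of B] unfolding e
  proof (rule orientable_cong)
    fix w assume w: "w \<in> V \<union> {u1, u2, u3, u4}"
    show "[(q(u1 := 1, u2 := 1, u3 := 1, u4 := 1)) w + int (outdeg B w) = r w] (mod 3)"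
    proof (cases "w \<in> V")
      case True
      then show ?thesis using u' by (auto simp: q_def)
    next
      case False
      then have w: "w \<in> {u1, u2, u3, u4}" using w by auto
      then have "[1 + int (outdeg B w) = 1] (mod 3)"
        by (auto simp: B cong_def)
      moreover have "(q(u1 := 1, u2 := 1, u3 := 1, u4 := 1)) w = 1" using w by auto
      ultimately show ?thesis using r(2)[OF w] by (simp add: cong_def)
    qed
  qed
qed

text \<open>Rotating the cycle puts a vertex with residue other than 1 in first place; if there is
  none, the explicit orientation applies.\<close>

lemma S3_add_cycle:
  assumes S: "S3 V ({#{a1, b1}, {a2, b2}, {a3, b3}, {a4, b4}#} + E)" and fin: "finite V"
    and E: "\<Union>(set_mset E) \<subseteq> V"
    and V: "{a1, b1, e1, a2, b2, e2, a3, b3, e3, a4, b4, e4} \<subseteq> V"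
    and u: "distinct [u1, u2, u3, u4]" "V \<inter> {u1, u2, u3, u4} = {}"
  shows "S3 (V \<union> {u1, u2, u3, u4})
     (cycle_edges (a1, b1, e1, u1) (a2, b2, e2, u2) (a3, b3, e3, u3) (a4, b4, e4, u4) + E)"
    (is "S3 ?V (?C + E)")
  unfolding S3_def
proof (intro allI impI)
  fix r assume "[sum r ?V = int (size (?C + E))] (mod 3)"
  then have r: "[sum r ?V = int (size E) + 16] (mod 3)"
    by (simp add: cycle_edges_def add.commute)
  have V': "V \<union> {u2, u3, u4, u1} = ?V" "V \<union> {u3, u4, u1, u2} = ?V" "V \<union> {u4, u1, u2, u3} = ?V"
    by auto
  consider "\<not> [r u1 = 1] (mod 3)" | "\<not> [r u2 = 1] (mod 3)" | "\<not> [r u3 = 1] (mod 3)"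
    | "\<not> [r u4 = 1] (mod 3)" | "\<And>u. u \<in> {u1, u2, u3, u4} \<Longrightarrow> [r u = 1] (mod 3)"
    by blast
  then show "orientable ?V (?C + E) r"
  proof cases
    case 1
    show ?thesis by (rule orientable_cycle_not_all_one[OF S fin E V u r 1])
  next
    case 2
    have S': "S3 V ({#{a2, b2}, {a3, b3}, {a4, b4}, {a1, b1}#} + E)"
      using S by (simp only: add_mset_commute)
    show ?thesis
      using orientable_cycle_not_all_one[OF S' fin E, where ?e1.0 = e2 and ?e2.0 = e3 and ?e3.0 = e4 and ?e4.0 = e1
          and ?u1.0 = u2 and ?u2.0 = u3 and ?u3.0 = u4 and ?u4.0 = u1 and r = r] V u r 2
      unfolding V' cycle_edges_rotate[of "(a1, b1, e1, u1)"] by auto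
  next
    case 3
    have S': "S3 V ({#{a3, b3}, {a4, b4}, {a1, b1}, {a2, b2}#} + E)"
      using S by (simp only: add_mset_commute)
    show ?thesis
      using orientable_cycle_not_all_one[OF S' fin E, where ?e1.0 = e3 and ?e2.0 = e4 and ?e3.0 = e1 and ?e4.0 = e2
          and ?u1.0 = u3 and ?u2.0 = u4 and ?u3.0 = u1 and ?u4.0 = u2 and r = r] V u r 3
      unfolding V' cycle_edges_rotate[of "(a1, b1, e1, u1)"] cycle_edges_rotate[of "(a2, b2, e2, u2)"] by auto
  next
    case 4
    have S': "S3 V ({#{a4, b4}, {a1, b1}, {a2, b2}, {a3, b3}#} + E)"
      using S by (simp only: add_mset_commute)
    show ?thesis
      using orientable_cycle_not_all_one[OF S' fin E, where ?e1.0 = e4 and ?e2.0 = e1 and ?e3.0 = e2 and ?e4.0 = e3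
          and ?u1.0 = u4 and ?u2.0 = u1 and ?u3.0 = u2 and ?u4.0 = u3 and r = r] V u r 4
      unfolding V' cycle_edges_rotate[of "(a1, b1, e1, u1)"] cycle_edges_rotate[of "(a2, b2, e2, u2)"]
        cycle_edges_rotate[of "(a3, b3, e3, u3)"] by auto
  next
    case 5
    show ?thesis by (rule orientable_cycle_all_one[OF S fin E V u r 5])
  qed
qed

text \<open>These fourteen edges replace two parallel edges \<open>{a, b}\<close>: again a gain of
  twelve, with degree 5 at each \<open>u\<close>. As the replaced edge is doubled, this construction
  serves only the multigraphs inside the scripts for small sequences.\<close>

definition K4_edges :: "'v \<Rightarrow> 'v \<Rightarrow> 'v \<Rightarrow> 'v \<Rightarrow> 'v \<Rightarrow> 'v \<Rightarrow> 'v set multiset" where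
  "K4_edges a b u1 u2 u3 u4 = {#{a, u1}, {b, u1}, {a, u2}, {b, u2}, {a, u3}, {b, u3}, {a, u4}, {b, u4},
     {u1, u2}, {u1, u3}, {u1, u4}, {u2, u3}, {u2, u4}, {u3, u4}#}"

lemma K4_edges_swap:
  "K4_edges a b u2 u1 u3 u4 = K4_edges a b u1 u2 u3 u4"
  "K4_edges a b u3 u2 u1 u4 = K4_edges a b u1 u2 u3 u4"
  "K4_edges a b u4 u2 u3 u1 = K4_edges a b u1 u2 u3 u4"
  unfolding K4_edges_def
  by (simp_all only: insert_commute[of u2 u1] insert_commute[of u3 u1] insert_commute[of u4 u1]
    insert_commute[of u3 u2] insert_commute[of u4 u2] insert_commute[of u4 u3] add_mset_commute)

lemma orientable_K4_not_all_one:
  assumes S: "S3 V ({#{a, b}, {a, b}#} + E)" and fin: "finite V"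
    and E: "\<Union>(set_mset E) \<subseteq> V" and V: "a \<in> V" "b \<in> V"
    and u: "distinct [u1, u2, u3, u4]" "V \<inter> {u1, u2, u3, u4} = {}"
    and r: "[sum r (V \<union> {u1, u2, u3, u4}) = int (size E) + 14] (mod 3)" "\<not> [r u1 = 1] (mod 3)"
  shows "orientable (V \<union> {u1, u2, u3, u4}) (K4_edges a b u1 u2 u3 u4 + E) r"
proof -
  have "S3 V (add_mset {a, b} ({#{a, b}#} + E))"
    using S by (simp add: add_mset_commute)
  \<comment> \<open>The insertions of \<open>u3\<close> and \<open>u2\<close> deliberately double
    \<open>{a, u3}\<close>, \<open>{b, u3}\<close> and \<open>{a, u2}\<close>. One copy of the first
    is then subdivided by \<open>u4\<close>, and one copy of each of the others by
    \<open>u1\<close>, so that no parallel edges remain among the new ones.\<close>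
  from S3_add_vertex4[OF this fin, of a b u3]
  have 2: "S3 (insert u3 V) (add_mset {a, b} ({#{a, u3}, {a, u3}, {b, u3}, {b, u3}#} + E))"
    using V u E by (simp add: add_mset_commute)
  from S3_add_vertex4[OF 2, of u3 a u2]
  have 3: "S3 (insert u2 (insert u3 V)) (add_mset {a, u3} ({#{a, u2}, {a, u2}, {b, u2}, {u3, u2}, {a, u3}, {b, u3}, {b, u3}#} + E))"
    using V u E fin by (simp add: add_mset_commute) (auto simp: insert_commute)
  from S3_add_vertex4[OF 3, of b u2 u4]
  have 4: "S3 (insert u4 (insert u2 (insert u3 V))) (add_mset {a, u2} (add_mset {b, u3}
      ({#{a, u4}, {u3, u4}, {b, u4}, {u2, u4}, {a, u2}, {b, u2}, {u3, u2}, {a, u3}, {b, u3}#} + E)))"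
    using V u E fin by (simp add: add_mset_commute) (auto simp: insert_commute)
  have V': "insert u1 (insert u4 (insert u2 (insert u3 V))) = V \<union> {u1, u2, u3, u4}" by auto
  have "orientable (insert u1 (insert u4 (insert u2 (insert u3 V))))
    (add_mset {a, u1} (add_mset {u2, u1} (add_mset {b, u1} (add_mset {u3, u1} (add_mset {u4, u1}
      ({#{a, u4}, {u3, u4}, {b, u4}, {u2, u4}, {a, u2}, {b, u2}, {u3, u2}, {a, u3}, {b, u3}#} + E)))))) r"
  proof (rule orientable_add_vertex5[OF 4])
    show "\<Union>(set_mset ({#{a, u4}, {u3, u4}, {b, u4}, {u2, u4}, {a, u2}, {b, u2}, {u3, u2}, {a, u3}, {b, u3}#} + E))
        \<subseteq> insert u4 (insert u2 (insert u3 V))"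
      using V E by auto
    show "[sum r (insert u1 (insert u4 (insert u2 (insert u3 V)))) = int (size ({#{a, u4}, {u3, u4}, {b, u4},
        {u2, u4}, {a, u2}, {b, u2}, {u3, u2}, {a, u3}, {b, u3}#} + E)) + 5] (mod 3)"
      using r(1) unfolding V' by (simp add: add.commute)
  qed (use V u fin r(2) in auto)
  then show ?thesis
    unfolding V' K4_edges_def
    by (simp add: add_mset_commute insert_commute[of u2 u1] insert_commute[of u3 u1] insert_commute[of u4 u1]
      insert_commute[of u3 u2])
qed

lemma orientable_K4_all_one:
  assumes S: "S3 V ({#{a, b}, {a, b}#} + E)" and fin: "finite V"
    and E: "\<Union>(set_mset E) \<subseteq> V" and V: "a \<in> V" "b \<in> V"
    and u: "distinct [u1, u2, u3, u4]" "V \<inter> {u1, u2, u3, u4} = {}"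
    and r: "[sum r (V \<union> {u1, u2, u3, u4}) = int (size E) + 14] (mod 3)"
      "\<And>u. u \<in> {u1, u2, u3, u4} \<Longrightarrow> [r u = 1] (mod 3)"
  shows "orientable (V \<union> {u1, u2, u3, u4}) (K4_edges a b u1 u2 u3 u4 + E) r"
proof -
  \<comment> \<open>The two copies of \<open>{a, b}\<close> become the paths
    \<open>a u1 u2 b\<close> and \<open>a u4 u3 b\<close>. The other eight edges are directed so
    that \<open>u1\<close>, \<open>u2\<close> emit nothing more and \<open>u3\<close>,
    \<open>u4\<close> emit three more: out-degrees 1, 1, 4, 4.\<close>
  define B where "B = {#(b, u1), (u3, u1), (u4, u1), (a, u2), (u3, u2), (u4, u2), (u3, a), (u4, b)#}"
  define q where "q w = r w - int (outdeg B w)" for w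
  have u': "u1 \<notin> V" "u2 \<notin> V" "u3 \<notin> V" "u4 \<notin> V" using u by auto
  have B: "(\<Sum>w\<in>V. int (outdeg B w)) = 2" "outdeg B u1 = 0" "outdeg B u2 = 0" "outdeg B u3 = 3" "outdeg B u4 = 3"
    using u' u V unfolding B_def sum_outdeg_add[OF fin] by (auto simp: outdeg_empty outdeg_add)
  have "sum r (V \<union> {u1, u2, u3, u4}) = r u1 + r u2 + r u3 + r u4 + sum r V"
    using u u' fin by (simp add: add.assoc add.commute add.left_commute)
  then have s: "[r u1 + r u2 + r u3 + r u4 + sum r V = int (size E) + 14] (mod 3)"
    using r by simp
  have "[r u1 + r u2 + r u3 + r u4 = 1 + 1 + 1 + 1] (mod 3)"
    by (intro cong_add r) auto
  from cong3_diff[OF this s, of 2 "int (size E) + 2"]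
  have "[sum q V = int (size E) + 2] (mod 3)"
    by (simp add: q_def sum_subtractf B)
  then have 0: "orientable V (add_mset {a, b} ({#{a, b}#} + E)) q"
    using S by (simp add: S3_def add.commute)
  from orientable_subdivide_new[OF 0, of u1]
  have 1: "orientable (insert u1 V) (add_mset {u1, b} ({#{a, b}, {a, u1}#} + E)) (q(u1 := 1))"
    using V u' E by (simp add: add_mset_commute insert_commute[of u1 b])
  from orientable_subdivide_new[OF 1, of u2]
  have 2: "orientable (insert u2 (insert u1 V)) (add_mset {a, b} ({#{a, u1}, {u1, u2}, {b, u2}#} + E))
      (q(u1 := 1, u2 := 1))"
    using V u u' E by (simp add: add_mset_commute) (auto simp: insert_commute)
  from orientable_subdivide_new[OF 2, of u4]
  have 3: "orientable (insert u4 (insert u2 (insert u1 V))) (add_mset {u4, b} ({#{a, u1}, {u1, u2}, {b, u2}, {a, u4}#} + E))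
      (q(u1 := 1, u2 := 1, u4 := 1))"
    using V u u' E by (simp add: add_mset_commute insert_commute[of u4 b]) (auto simp: insert_commute)
  have V': "insert u3 (insert u4 (insert u2 (insert u1 V))) = V \<union> {u1, u2, u3, u4}" by auto
  from orientable_subdivide_new[OF 3, of u3]
  have 4: "orientable (V \<union> {u1, u2, u3, u4}) ({#{a, u1}, {u1, u2}, {b, u2}, {a, u4}, {u4, u3}, {b, u3}#} + E)
      (q(u1 := 1, u2 := 1, u4 := 1, u3 := 1))"
    unfolding V' using V u u' E by (simp add: add_mset_commute) (auto simp: insert_commute)
  have e: "image_mset uedge B + ({#{a, u1}, {u1, u2}, {b, u2}, {a, u4}, {u4, u3}, {b, u3}#} + E) =
      K4_edges a b u1 u2 u3 u4 + E"
    unfolding B_def K4_edges_def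
    by (simp add: uedge_def insert_commute[of u3 u1] insert_commute[of u4 u1] insert_commute[of u3 u2]
      insert_commute[of u4 u2] insert_commute[of u3 a] insert_commute[of u4 b] insert_commute[of u4 u3])
  show ?thesis
    using orientable_add_arcs[OF 4, of B] unfolding e
  proof (rule orientable_cong)
    fix w assume w: "w \<in> V \<union> {u1, u2, u3, u4}"
    show "[(q(u1 := 1, u2 := 1, u4 := 1, u3 := 1)) w + int (outdeg B w) = r w] (mod 3)"
    proof (cases "w \<in> V")
      case True
      then show ?thesis using u' by (auto simp: q_def)
    next
      case False
      then have w: "w \<in> {u1, u2, u3, u4}" using w by auto
      then have "[1 + int (outdeg B w) = 1] (mod 3)"
        by (auto simp: B cong_def)
      moreover have "(q(u1 := 1, u2 := 1, u4 := 1, u3 := 1)) w = 1" using w by auto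
      ultimately show ?thesis using r(2)[OF w] by (simp add: cong_def)
    qed
  qed
qed

lemma S3_add_K4:
  assumes S: "S3 V ({#{a, b}, {a, b}#} + E)" and fin: "finite V"
    and E: "\<Union>(set_mset E) \<subseteq> V" and V: "a \<in> V" "b \<in> V"
    and u: "distinct [u1, u2, u3, u4]" "V \<inter> {u1, u2, u3, u4} = {}"
  shows "S3 (V \<union> {u1, u2, u3, u4}) (K4_edges a b u1 u2 u3 u4 + E)" (is "S3 ?V (?C + E)")
  unfolding S3_def
proof (intro allI impI)
  fix r assume "[sum r ?V = int (size (?C + E))] (mod 3)"
  then have r: "[sum r ?V = int (size E) + 14] (mod 3)"
    by (simp add: K4_edges_def add.commute)
  have V': "V \<union> {u2, u1, u3, u4} = ?V" "V \<union> {u3, u2, u1, u4} = ?V" "V \<union> {u4, u2, u3, u1} = ?V"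
    by auto
  consider "\<not> [r u1 = 1] (mod 3)" | "\<not> [r u2 = 1] (mod 3)" | "\<not> [r u3 = 1] (mod 3)"
    | "\<not> [r u4 = 1] (mod 3)" | "\<And>u. u \<in> {u1, u2, u3, u4} \<Longrightarrow> [r u = 1] (mod 3)"
    by blast
  then show "orientable ?V (?C + E) r"
  proof cases
    case 1
    show ?thesis by (rule orientable_K4_not_all_one[OF S fin E V u r 1])
  next
    case 2
    show ?thesis
      using orientable_K4_not_all_one[OF S fin E V, of u2 u1 u3 u4 r] u r 2
      unfolding V' K4_edges_swap(1)[where ?u1.0 = u1 and ?u2.0 = u2 and ?u3.0 = u3 and ?u4.0 = u4] by auto
  next
    case 3
    show ?thesis
      using orientable_K4_not_all_one[OF S fin E V, of u3 u2 u1 u4 r] u r 3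
      unfolding V' K4_edges_swap(2)[where ?u1.0 = u1 and ?u2.0 = u2 and ?u3.0 = u3 and ?u4.0 = u4] by auto
  next
    case 4
    show ?thesis
      using orientable_K4_not_all_one[OF S fin E V, of u4 u2 u3 u1 r] u r 4
      unfolding V' K4_edges_swap(3)[where ?u1.0 = u1 and ?u2.0 = u2 and ?u3.0 = u3 and ?u4.0 = u4] by auto
  next
    case 5
    show ?thesis by (rule orientable_K4_all_one[OF S fin E V u r 5])
  qed
qed

subsection \<open>Small degree sequences\<close>

text \<open>Each small graph is given by a script that builds it from a single vertex; new vertices are numbered
  consecutively. The scripts were found by a computer search that inverts the constructions above.\<close>

datatype build_step = Add_Edge nat nat | Add_Vertex nat nat nat nat
  | Add_Cycle "nat \<times> nat \<times> nat" "nat \<times> nat \<times> nat" "nat \<times> nat \<times> nat" "nat \<times> nat \<times> nat"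
  | Add_K4 nat nat

text \<open>A normal form with the smaller end first, so that edges can be looked up in lists. New
  vertices carry the largest numbers, hence the pairs written out in \<open>exec_step\<close> are
  already normal.\<close>

definition pr :: "nat \<Rightarrow> nat \<Rightarrow> nat \<times> nat" where
  "pr a b = (if a \<le> b then (a, b) else (b, a))"

fun delete_all :: "'a list \<Rightarrow> 'a list \<Rightarrow> 'a list option" where
  "delete_all [] es = Some es"
| "delete_all (p # ps) es = (if p \<in> set es then delete_all ps (remove1 p es) else None)"

fun exec_step :: "build_step \<Rightarrow> nat \<times> (nat \<times> nat) list \<Rightarrow> (nat \<times> (nat \<times> nat) list) option" where
  "exec_step (Add_Edge a b) (n, es) = (if a < n \<and> b < n then Some (n, pr a b # es) else None)"
| "exec_step (Add_Vertex a b x y) (n, es) =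
    (if a < n \<and> b < n \<and> x < n \<and> y < n
     then map_option (\<lambda>es'. (Suc n, [(a, n), (b, n), (x, n), (y, n)] @ es')) (delete_all [pr a b] es)
     else None)"
| "exec_step (Add_Cycle (a1, b1, e1) (a2, b2, e2) (a3, b3, e3) (a4, b4, e4)) (n, es) =
    (if list_all (\<lambda>x. x < n) [a1, b1, e1, a2, b2, e2, a3, b3, e3, a4, b4, e4]
     then map_option (\<lambda>es'. (n + 4, [(a1, n), (b1, n), (e1, n), (a2, n + 1), (b2, n + 1), (e2, n + 1),
         (a3, n + 2), (b3, n + 2), (e3, n + 2), (a4, n + 3), (b4, n + 3), (e4, n + 3),
         (n, n + 1), (n + 1, n + 2), (n + 2, n + 3), (n, n + 3)] @ es'))
       (delete_all [pr a1 b1, pr a2 b2, pr a3 b3, pr a4 b4] es)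
     else None)"
| "exec_step (Add_K4 a b) (n, es) =
    (if a < n \<and> b < n
     then map_option (\<lambda>es'. (n + 4, [(a, n), (b, n), (a, n + 1), (b, n + 1), (a, n + 2), (b, n + 2),
         (a, n + 3), (b, n + 3), (n, n + 1), (n, n + 2), (n, n + 3), (n + 1, n + 2), (n + 1, n + 3), (n + 2, n + 3)] @ es'))
       (delete_all [pr a b, pr a b] es)
     else None)"

fun exec_steps :: "build_step list \<Rightarrow> nat \<times> (nat \<times> nat) list \<Rightarrow> (nat \<times> (nat \<times> nat) list) option" where
  "exec_steps [] s = Some s"
| "exec_steps (c # cs) s = (case exec_step c s of None \<Rightarrow> None | Some s' \<Rightarrow> exec_steps cs s')"

definition invariant :: "nat \<times> (nat \<times> nat) list \<Rightarrow> bool" where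
  "invariant s \<longleftrightarrow> S3 {..<fst s} (mset (map uedge (snd s))) \<and> (\<forall>p\<in>set (snd s). fst p < fst s \<and> snd p < fst s)"

lemma uedge_pr: "uedge (pr a b) = {a, b}"
  by (auto simp: pr_def uedge_def)

lemma delete_all_Some:
  "delete_all ps es = Some es' \<Longrightarrow> mset es = mset ps + mset es'"
  by (induction ps es rule: delete_all.induct) (auto split: if_splits, metis insert_DiffM set_mset_mset)

text \<open>Soundness of scripts: every successful step is an instance of one of the preservation
  lemmas, so running a script certifies the orientation property without examining any
  orientation.\<close>

lemma invariant_step:
  assumes "exec_step c s = Some s'" "invariant s"
  shows "invariant s'"
proof (cases s)
  case (Pair n es)
  have S: "S3 {..<n} (mset (map uedge es))" and lt: "\<forall>p\<in>set es. fst p < n \<and> snd p < n"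
    using assms(2) by (auto simp: Pair invariant_def)
  have sub: "\<Union>(set_mset (mset (map uedge es'))) \<subseteq> {..<n}" "\<forall>p\<in>set es'. fst p < n \<and> snd p < n"
    "mset (map uedge es) = mset (map uedge ps) + mset (map uedge es')"
    if "delete_all ps es = Some es'" for ps es'
  proof -
    have *: "mset es = mset ps + mset es'" by (rule delete_all_Some[OF that])
    then have "set es' \<subseteq> set es" by (metis set_mset_mset set_mset_union sup_ge2)
    then show "\<forall>p\<in>set es'. fst p < n \<and> snd p < n" using lt by auto
    then show "\<Union>(set_mset (mset (map uedge es'))) \<subseteq> {..<n}" by (auto simp: uedge_def)
    show "mset (map uedge es) = mset (map uedge ps) + mset (map uedge es')"
      using * by (simp only: mset_map image_mset_union)
  qed
  have four: "{..<n + 4} = {..<n} \<union> {n, n + 1, n + 2, n + 3}" by auto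
  show ?thesis
  proof (cases c)
    case (Add_Edge a b)
    then show ?thesis
      using assms(1) lt S3_add_edge[OF S, of a b]
      by (auto simp: Pair invariant_def uedge_pr pr_def split: if_splits simp del: uedge_pr) (auto simp: uedge_def insert_commute)
  next
    case (Add_Vertex a b x y)
    then have ab: "a < n" "b < n" "x < n" "y < n"
      using assms(1) by (auto simp: Pair split: if_splits)
    then obtain es' where es': "delete_all [pr a b] es = Some es'"
        "s' = (Suc n, [(a, n), (b, n), (x, n), (y, n)] @ es')"
      using assms(1) Add_Vertex by (auto simp: Pair simp del: delete_all.simps)
    have "S3 {..<n} (add_mset {a, b} (mset (map uedge es')))"
      using S sub(3)[OF es'(1)] by (simp add: uedge_pr)
    from S3_add_vertex4[OF this _ sub(1)[OF es'(1)], of x y n] ab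
    have "S3 {..<Suc n} (mset (map uedge (snd s')))"
      by (simp add: es'(2) uedge_def lessThan_Suc)
    then show ?thesis using sub(2)[OF es'(1)] ab by (auto simp: invariant_def es'(2))
  next
    case (Add_Cycle p1 p2 p3 p4)
    obtain a1 b1 e1 a2 b2 e2 a3 b3 e3 a4 b4 e4 where p: "p1 = (a1, b1, e1)" "p2 = (a2, b2, e2)"
        "p3 = (a3, b3, e3)" "p4 = (a4, b4, e4)"
      by (metis prod_cases3)
    have lts: "{a1, b1, e1, a2, b2, e2, a3, b3, e3, a4, b4, e4} \<subseteq> {..<n}"
      using assms(1) by (auto simp: Pair Add_Cycle p split: if_splits)
    then obtain es' where es': "delete_all [pr a1 b1, pr a2 b2, pr a3 b3, pr a4 b4] es = Some es'"
        "s' = (n + 4, [(a1, n), (b1, n), (e1, n), (a2, n + 1), (b2, n + 1), (e2, n + 1),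
         (a3, n + 2), (b3, n + 2), (e3, n + 2), (a4, n + 3), (b4, n + 3), (e4, n + 3),
         (n, n + 1), (n + 1, n + 2), (n + 2, n + 3), (n, n + 3)] @ es')"
      using assms(1) by (auto simp: Pair Add_Cycle p simp del: delete_all.simps)
    have "S3 {..<n} ({#{a1, b1}, {a2, b2}, {a3, b3}, {a4, b4}#} + mset (map uedge es'))"
      using S sub(3)[OF es'(1)] by (simp add: uedge_pr)
    from S3_add_cycle[OF this _ sub(1)[OF es'(1)] lts, of n "n + 1" "n + 2" "n + 3"]
    have "S3 {..<n + 4} (mset (map uedge (snd s')))"
      unfolding four by (simp add: es'(2) uedge_def cycle_edges_def insert_commute[of "n + 3" n])
    then show ?thesis using sub(2)[OF es'(1)] lts by (auto simp: invariant_def es'(2))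
  next
    case (Add_K4 a b)
    then have ab: "a < n" "b < n"
      using assms(1) by (auto simp: Pair split: if_splits)
    then obtain es' where es': "delete_all [pr a b, pr a b] es = Some es'"
        "s' = (n + 4, [(a, n), (b, n), (a, n + 1), (b, n + 1), (a, n + 2), (b, n + 2),
         (a, n + 3), (b, n + 3), (n, n + 1), (n, n + 2), (n, n + 3), (n + 1, n + 2), (n + 1, n + 3), (n + 2, n + 3)] @ es')"
      using assms(1) by (auto simp: Pair Add_K4 simp del: delete_all.simps)
    have "S3 {..<n} ({#{a, b}, {a, b}#} + mset (map uedge es'))"
      using S sub(3)[OF es'(1)] by (simp add: uedge_pr)
    from S3_add_K4[OF this _ sub(1)[OF es'(1)], of n "n + 1" "n + 2" "n + 3"] ab
    have "S3 {..<n + 4} (mset (map uedge (snd s')))"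
      unfolding four by (simp add: es'(2) uedge_def K4_edges_def)
    then show ?thesis using sub(2)[OF es'(1)] ab by (auto simp: invariant_def es'(2))
  qed
qed

lemma invariant_steps: "exec_steps cs s = Some s' \<Longrightarrow> invariant s \<Longrightarrow> invariant s'"
  by (induction cs s rule: exec_steps.induct) (auto split: option.splits intro: invariant_step)

text \<open>The fixed prefix puts a loop on vertex 0 and subdivides it, leaving four parallel edges
  between two vertices, the tight multigraph for \<open>n = 2\<close>. Only the final graph is
  required to be simple.\<close>

definition realizes :: "build_step list \<Rightarrow> nat list \<Rightarrow> bool" where
  "realizes cs ds \<longleftrightarrow> (case exec_steps (Add_Edge 0 0 # Add_Vertex 0 0 0 0 # cs) (1, []) of None \<Rightarrow> False
     | Some (n, es) \<Rightarrow> n = length ds \<and> distinct es \<and> list_all (\<lambda>p. fst p < snd p) es \<and>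
         rev (sort (map (\<lambda>v. length (filter (\<lambda>p. fst p = v \<or> snd p = v) es)) [0..<n])) = ds)"

text \<open>Lists come out nonincreasing and in lexicographically decreasing order; this order
  matches each list with its script in the tables. The filter discards first entries after which the
  remaining sum is out of reach.\<close>

fun seqs :: "nat \<Rightarrow> nat \<Rightarrow> nat \<Rightarrow> nat \<Rightarrow> nat list list" where
  "seqs 0 hi lo s = (if s = 0 then [[]] else [])"
| "seqs (Suc n) hi lo s = concat (map (\<lambda>h. map (\<lambda>t. h # t) (seqs n h lo (s - h)))
     (filter (\<lambda>h. h \<le> s \<and> lo * n \<le> s - h \<and> s - h \<le> h * n) (rev [lo..<Suc hi])))"

lemma seqs_complete:
  "sorted_wrt (\<ge>) ds \<Longrightarrow> \<forall>x\<in>set ds. lo \<le> x \<and> x \<le> hi \<Longrightarrow> ds \<in> set (seqs (length ds) hi lo (sum_list ds))"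
proof (induction ds arbitrary: hi)
  case (Cons h t)
  have "t \<in> set (seqs (length t) h lo (sum_list t))"
    using Cons by auto
  moreover have "lo * length t \<le> sum_list t" "sum_list t \<le> h * length t"
    using Cons.prems by (induction t) auto
  ultimately show ?case using Cons.prems by (auto simp: image_iff simp del: upt_Suc)
qed auto

section \<open>Scripts, named by number of vertices and, for seven vertices, by degree sum\<close>

definition steps7_38_min4 :: "build_step list list" where
  "steps7_38_min4 = [[Add_K4 0 1, Add_Vertex 0 1 2 3]]"

definition steps7_38 :: "build_step list list" where
  "steps7_38 = [[Add_Vertex 0 1 0 1, Add_Cycle (1, 0, 2) (1, 0, 2) (2, 0, 1) (2, 1, 0)]]"

definition steps7_40 :: "build_step list list" where
  "steps7_40 = [[Add_Vertex 0 1 0 1, Add_Cycle (1, 0, 2) (1, 0, 2) (2, 0, 1) (2, 1, 0), Add_Edge 3 5]]"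

definition steps7_42 :: "build_step list list" where
  "steps7_42 = [[Add_Vertex 0 1 0 1, Add_Cycle (1, 0, 2) (1, 0, 2) (2, 0, 1) (2, 1, 0), Add_Edge 3 5, Add_Edge 4 6]]"

definition steps8 :: "build_step list list" where
  "steps8 = [
     [Add_Vertex 0 1 0 1, Add_Vertex 0 1 1 2, Add_Vertex 0 1 3 2, Add_Vertex 3 1 0 2, Add_Vertex 0 2 1 3,
      Add_Vertex 1 2 3 0],
     [Add_Vertex 0 1 1 0, Add_Vertex 0 1 0 2, Add_Vertex 0 1 2 3, Add_Vertex 2 1 0 4, Add_Vertex 0 3 4 2,
      Add_Vertex 0 2 4 3],
     [Add_Vertex 0 1 0 0, Add_Vertex 0 1 2 1, Add_Vertex 2 0 3 1, Add_Vertex 0 1 2 4, Add_Vertex 1 3 0 2,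
      Add_Vertex 2 0 1 5],
     [Add_Vertex 0 1 0 0, Add_Vertex 0 1 2 1, Add_Vertex 0 2 3 1, Add_Vertex 0 1 3 4, Add_Vertex 0 2 3 4,
      Add_Vertex 3 1 2 0],
     [Add_K4 0 1, Add_Vertex 0 1 2 3, Add_Vertex 1 6 0 2],
     [Add_Vertex 0 1 1 1, Add_Vertex 0 1 1 2, Add_Vertex 0 1 2 3, Add_Vertex 1 2 0 4, Add_Vertex 1 2 0 5,
      Add_Vertex 1 3 0 6],
     [Add_Vertex 0 1 0 1, Add_Vertex 0 1 2 0, Add_Cycle (1, 2, 0) (0, 2, 3) (0, 3, 2) (0, 1, 2)],
     [Add_K4 0 1, Add_Vertex 1 5 2 3, Add_Vertex 0 1 2 4],
     [Add_Vertex 0 1 0 1, Add_Vertex 2 0 2 1, Add_Vertex 0 1 3 2, Add_Vertex 2 1 4 3, Add_Vertex 2 3 0 5,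
      Add_Vertex 0 1 2 6],
     [Add_Vertex 0 1 0 1, Add_Vertex 2 1 0 2, Add_Cycle (0, 1, 2) (0, 1, 2) (2, 3, 1) (2, 0, 3)],
     [Add_K4 0 1, Add_Vertex 0 1 2 4, Add_Vertex 2 4 3 5],
     [Add_K4 0 1, Add_Vertex 0 1 3 4, Add_Vertex 0 4 2 6],
     [Add_Vertex 0 1 0 0, Add_Vertex 2 0 1 1, Add_Cycle (0, 2, 3) (1, 0, 2) (0, 1, 3) (3, 1, 2)]]"

definition steps9 :: "build_step list list" where
  "steps9 = [
     [Add_Vertex 0 1 0 1, Add_Vertex 0 2 0 2, Add_Vertex 0 1 3 2, Add_Cycle (1, 0, 4) (1, 2, 0) (0, 3, 2)
      (3, 2, 0)],
     [Add_Vertex 0 1 0 1, Add_Vertex 2 1 0 0, Add_Vertex 0 1 3 2, Add_Cycle (0, 2, 4) (3, 0, 4) (2, 4, 0)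
      (1, 0, 2)],
     [Add_Vertex 0 1 1 0, Add_Vertex 0 1 0 2, Add_Vertex 0 2 3 3, Add_Cycle (0, 3, 4) (3, 4, 0) (1, 2, 3)
      (1, 0, 2)],
     [Add_Vertex 0 1 0 1, Add_Vertex 0 2 0 2, Add_Vertex 0 1 2 3, Add_Cycle (1, 0, 4) (2, 3, 0) (2, 1, 4)
      (0, 3, 1)],
     [Add_Vertex 0 1 1 1, Add_Vertex 2 1 0 2, Add_Vertex 0 1 0 3, Add_Cycle (2, 3, 4) (0, 1, 2) (0, 4, 3)
      (1, 2, 4)]]"

text \<open>Sequences with three vertices of degree \<open>n - 1\<close>. Inserting a vertex of
  degree 4 by subdivision raises only two degrees, so one of the three would still have degree
  \<open>n - 1\<close> in a graph on \<open>n - 1\<close> vertices; these sequences escape that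
  reduction.\<close>

definition hub_steps9 :: "build_step list list" where
  "hub_steps9 = [
     [Add_Vertex 0 1 0 1, Add_Vertex 2 1 2 0, Add_Vertex 0 1 3 2, Add_Vertex 2 0 1 3, Add_Vertex 2 3 3 0,
      Add_Vertex 3 6 2 0, Add_Vertex 0 1 2 3],
     [Add_Vertex 0 1 0 1, Add_Vertex 1 2 0 2, Add_Vertex 0 1 1 3, Add_Vertex 0 1 4 3, Add_Vertex 0 2 3 1,
      Add_Vertex 1 4 3 0, Add_Vertex 3 2 0 1]]"

definition steps10 :: "build_step list list" where
  "steps10 = [
     [Add_Vertex 0 1 0 0, Add_Vertex 2 0 2 2, Add_Vertex 2 3 0 1, Add_Vertex 2 3 2 4, Add_Cycle (5, 2, 3)
      (0, 1, 2) (1, 0, 2) (0, 2, 5)],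
     [Add_Vertex 0 1 1 0, Add_Vertex 0 1 0 0, Add_Vertex 0 2 0 1, Add_Vertex 0 1 3 4, Add_Cycle (0, 4, 2)
      (3, 0, 4) (3, 0, 5) (1, 2, 0)],
     [Add_Vertex 0 1 0 1, Add_Vertex 0 2 2 2, Add_Vertex 2 3 0 3, Add_Vertex 4 3 2 0, Add_Cycle (1, 2, 0)
      (0, 1, 5) (3, 2, 4) (1, 0, 2)],
     [Add_Vertex 0 1 1 1, Add_Vertex 0 1 2 0, Add_Vertex 2 1 0 3, Add_Vertex 0 1 2 2, Add_Cycle (1, 2, 5)
      (2, 5, 0) (0, 3, 4) (1, 5, 0)],
     [Add_Vertex 0 1 1 0, Add_Vertex 0 1 0 0, Add_Vertex 0 1 3 3, Add_Vertex 0 3 4 2, Add_Cycle (3, 0, 5)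
      (1, 2, 0) (2, 0, 1) (4, 3, 5)],
     [Add_Vertex 0 1 0 1, Add_Vertex 0 1 0 2, Add_Vertex 1 2 3 3, Add_Vertex 0 3 4 3, Add_Cycle (4, 3, 0)
      (0, 2, 1) (5, 3, 1) (1, 0, 5)],
     [Add_Vertex 0 1 0 1, Add_Vertex 0 2 1 2, Add_Vertex 0 1 2 3, Add_Vertex 2 3 4 0, Add_Cycle (1, 0, 4)
      (4, 1, 5) (2, 1, 4) (3, 2, 0)],
     [Add_Vertex 0 1 0 1, Add_Vertex 2 1 0 2, Add_Vertex 2 1 3 0, Add_Vertex 0 1 4 2, Add_Cycle (0, 1, 4)
      (0, 4, 3) (2, 0, 5) (2, 3, 5)],
     [Add_Vertex 0 1 1 0, Add_Vertex 0 2 0 2, Add_Vertex 0 1 3 2, Add_Vertex 0 1 3 4, Add_Cycle (3, 2, 1)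
      (3, 0, 5) (2, 4, 5) (1, 2, 4)]]"

definition hub_steps10 :: "build_step list list" where
  "hub_steps10 = [
     [Add_Vertex 0 1 1 1, Add_Vertex 1 2 0 1, Add_Vertex 1 2 3 0, Add_Vertex 0 1 3 1, Add_Vertex 0 1 3 3,
      Add_Vertex 1 5 3 0, Add_Vertex 3 6 0 1, Add_Vertex 3 1 0 4]]"

definition steps11 :: "build_step list list" where
  "steps11 = [
     [Add_Vertex 0 1 1 0, Add_Vertex 0 1 0 0, Add_Vertex 0 2 2 1, Add_Vertex 1 4 0 3, Add_Vertex 0 3 5 1,
      Add_Cycle (0, 1, 4) (0, 3, 6) (4, 2, 0) (1, 2, 0)],
     [Add_Vertex 0 1 0 0, Add_Vertex 0 2 0 0, Add_Vertex 0 2 2 1, Add_Vertex 2 4 0 1, Add_Vertex 0 1 3 2,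
      Add_Cycle (0, 3, 6) (1, 0, 4) (5, 4, 0) (3, 0, 5)],
     [Add_Vertex 0 1 0 1, Add_Vertex 2 0 2 2, Add_Vertex 0 1 2 3, Add_Vertex 2 3 2 0, Add_Vertex 2 3 5 4,
      Add_Cycle (1, 0, 2) (1, 2, 0) (5, 2, 0) (0, 5, 6)],
     [Add_Vertex 0 1 0 1, Add_Vertex 0 1 2 2, Add_Vertex 2 3 0 2, Add_Vertex 2 3 0 4, Add_Vertex 2 4 0 3,
      Add_Cycle (0, 2, 5) (1, 0, 6) (2, 4, 6) (2, 1, 0)],
     [Add_Vertex 0 1 0 0, Add_Vertex 0 1 1 2, Add_Vertex 1 3 2 3, Add_Vertex 3 4 0 0, Add_Vertex 0 2 0 3,
      Add_Cycle (0, 6, 5) (2, 0, 1) (0, 1, 6) (0, 5, 4)],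
     [Add_Vertex 0 1 0 1, Add_Vertex 1 2 1 2, Add_Vertex 0 1 3 1, Add_Vertex 1 4 4 0, Add_Vertex 5 4 0 1,
      Add_Cycle (2, 0, 3) (2, 3, 0) (3, 1, 5) (0, 1, 6)],
     [Add_Vertex 0 1 0 1, Add_Vertex 2 1 0 2, Add_Vertex 0 1 2 3, Add_Vertex 0 1 4 3, Add_Vertex 3 2 3 5,
      Add_Cycle (3, 6, 0) (4, 3, 2) (3, 1, 0) (2, 0, 6)],
     [Add_Vertex 0 1 0 0, Add_Vertex 0 1 2 1, Add_Vertex 3 1 2 3, Add_Vertex 0 1 0 4, Add_Vertex 2 0 5 1,
      Add_Cycle (0, 1, 2) (0, 5, 3) (4, 3, 2) (2, 0, 6)],
     [Add_Vertex 0 1 0 0, Add_Vertex 0 2 1 2, Add_Vertex 0 2 3 1, Add_Vertex 0 1 3 4, Add_Vertex 0 4 0 5,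
      Add_Cycle (1, 0, 5) (6, 4, 0) (0, 6, 2) (2, 3, 6)],
     [Add_Vertex 0 1 1 0, Add_Vertex 0 2 0 0, Add_Vertex 0 1 2 3, Add_Vertex 0 3 4 4, Add_Vertex 0 1 4 5,
      Add_Cycle (1, 2, 6) (0, 1, 2) (3, 0, 2) (4, 5, 3)],
     [Add_Vertex 0 1 1 0, Add_Vertex 2 0 2 1, Add_Vertex 2 1 0 3, Add_Vertex 0 3 4 4, Add_Vertex 0 1 2 5,
      Add_Cycle (3, 1, 2) (0, 1, 4) (5, 4, 3) (2, 3, 6)],
     [Add_Vertex 0 1 0 0, Add_Vertex 0 1 1 2, Add_Vertex 3 0 2 3, Add_Vertex 0 2 4 3, Add_Vertex 0 2 4 5,
      Add_Cycle (1, 0, 5) (2, 3, 5) (3, 4, 6) (3, 1, 6)],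
     [Add_K4 0 1, Add_Vertex 1 3 2 5, Add_Cycle (3, 0, 6) (5, 0, 6) (0, 1, 4) (4, 0, 3)]]"

definition hub_steps11 :: "build_step list list" where
  "hub_steps11 = [
     [Add_Vertex 0 1 0 1, Add_Vertex 0 1 2 2, Add_Vertex 0 2 1 1, Add_Vertex 0 1 0 2, Add_Vertex 1 4 0 2,
      Add_Vertex 2 3 0 1, Add_Vertex 2 1 2 0, Add_Vertex 0 5 1 2, Add_Vertex 2 8 0 1]]"

section \<open>Execution of the scripts\<close>

lemma realizes_steps7_38_min4: "list_all2 realizes steps7_38_min4 [[6, 6, 6, 6, 5, 5, 4]]"
  by code_simp

text \<open>The first list will be excluded as not graphic, the second has its own script, and the
  third is the only one with minimum 5. So on seven vertices graphicality is not implied by the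
  bounds on the degrees.\<close>

lemma seqs_7_38: "seqs 7 6 4 38 = [[6, 6, 6, 6, 6, 4, 4], [6, 6, 6, 6, 5, 5, 4], [6, 6, 6, 5, 5, 5, 5]]"
  by code_simp

lemma realizes_steps7_38: "list_all2 realizes steps7_38 (seqs 7 6 5 38)"
  by code_simp

lemma realizes_steps7_40: "list_all2 realizes steps7_40 (seqs 7 6 5 40)"
  by code_simp

lemma realizes_steps7_42: "list_all2 realizes steps7_42 (seqs 7 6 5 42)"
  by code_simp

lemma realizes_steps8: "list_all2 realizes steps8 (seqs 8 7 4 44)"
  by code_simp

lemma realizes_steps9: "list_all2 realizes steps9 (seqs 9 8 5 50)"
  by code_simp

lemma realizes_steps10: "list_all2 realizes steps10 (seqs 10 9 5 56)"
  by code_simp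

lemma realizes_steps11: "list_all2 realizes steps11 (seqs 11 10 5 62)"
  by code_simp

text \<open>Without the three hubs the tight sum leaves
  \<open>6 n - 4 - 3 (n - 1) = 3 n - 1\<close>, which is 26, 29 and 32 for \<open>n\<close> equal to
  9, 10 and 11.\<close>

lemma realizes_hub_steps9: "list_all2 realizes hub_steps9 (map (\<lambda>t. 8 # 8 # 8 # t) (seqs 6 8 4 26))"
  by code_simp

lemma realizes_hub_steps10: "list_all2 realizes hub_steps10 (map (\<lambda>t. 9 # 9 # 9 # t) (seqs 7 9 4 29))"
  by code_simp

lemma realizes_hub_steps11: "list_all2 realizes hub_steps11 (map (\<lambda>t. 10 # 10 # 10 # t) (seqs 8 10 4 32))"
  by code_simp

subsection \<open>Degree functions with an \<open>S\<^sub>3\<close>-connected realization\<close>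

definition simple_on :: "'v set \<Rightarrow> 'v set set \<Rightarrow> bool" where
  "simple_on V F \<longleftrightarrow> (\<forall>e\<in>F. e \<subseteq> V \<and> card e = 2)"

definition dg :: "'v set set \<Rightarrow> 'v \<Rightarrow> nat" where
  "dg F v = card {e \<in> F. v \<in> e}"

definition S3_graphic :: "'v set \<Rightarrow> ('v \<Rightarrow> nat) \<Rightarrow> bool" where
  "S3_graphic V d \<longleftrightarrow> (\<exists>F. simple_on V F \<and> S3 V (mset_set F) \<and> (\<forall>v\<in>V. dg F v = d v))"

definition star :: "'v \<Rightarrow> 'v set \<Rightarrow> 'v set set" where
  "star v D = (\<lambda>x. {x, v}) ` D"

lemma simple_on_finite: "simple_on V F \<Longrightarrow> finite V \<Longrightarrow> finite F"
  unfolding simple_on_def by (meson PowI finite_Pow_iff rev_finite_subset subsetI)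

lemma simple_on_Un: "simple_on V (F \<union> G) \<longleftrightarrow> simple_on V F \<and> simple_on V G"
  by (auto simp: simple_on_def)

lemma simple_on_mono: "simple_on V F \<Longrightarrow> V \<subseteq> W \<Longrightarrow> G \<subseteq> F \<Longrightarrow> simple_on W G"
  unfolding simple_on_def by blast

lemma simple_on_edges: "simple_on V F \<Longrightarrow> \<Union>F \<subseteq> V"
  by (auto simp: simple_on_def)

lemma dg_Un: "finite F \<Longrightarrow> finite G \<Longrightarrow> F \<inter> G = {} \<Longrightarrow> dg (F \<union> G) v = dg F v + dg G v"
proof -
  assume "finite F" "finite G" "F \<inter> G = {}"
  moreover have "{e \<in> F \<union> G. v \<in> e} = {e \<in> F. v \<in> e} \<union> {e \<in> G. v \<in> e}" by auto
  ultimately show ?thesis unfolding dg_def by (simp add: card_Un_disjoint disjoint_iff)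
qed

lemma dg_insert: "finite F \<Longrightarrow> e \<notin> F \<Longrightarrow> dg (insert e F) v = dg F v + (if v \<in> e then 1 else 0)"
  using dg_Un[of F "{e}" v] by (auto simp: dg_def conj_commute Collect_conv_if)

lemma dg_remove: "finite F \<Longrightarrow> e \<in> F \<Longrightarrow> dg F v = dg (F - {e}) v + (if v \<in> e then 1 else 0)"
  using dg_insert[of "F - {e}" e v] by (simp add: insert_absorb)

lemma dg_outside: "simple_on V F \<Longrightarrow> v \<notin> V \<Longrightarrow> dg F v = 0"
proof -
  assume "simple_on V F" "v \<notin> V"
  then have "{e \<in> F. v \<in> e} = {}" unfolding simple_on_def by blast
  then show ?thesis by (simp only: dg_def card.empty)
qed

lemma handshake:
  assumes "simple_on V F" "finite V"
  shows "(\<Sum>v\<in>V. dg F v) = 2 * card F"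
proof -
  have "card {v \<in> V. v \<in> e} = 2" if "e \<in> F" for e
  proof -
    have "{v \<in> V. v \<in> e} = e" using that assms by (auto simp: simple_on_def)
    then show ?thesis using that assms by (simp add: simple_on_def)
  qed
  then show ?thesis
    unfolding dg_def using assms simple_on_finite[OF assms]
    by (subst sum_multicount_gen[where k = "\<lambda>_. 2"]) auto
qed

section \<open>Attaching stars, 4-cycles and adjacent pairs to simple graphs\<close>

lemma star_props:
  assumes "finite D" "v \<notin> D"
  shows "finite (star v D)" "card (star v D) = card D" "simple_on (insert v D) (star v D)"
    "dg (star v D) v = card D" "w \<noteq> v \<Longrightarrow> dg (star v D) w = (if w \<in> D then 1 else 0)"
proof -
  have inj: "inj_on (\<lambda>x. {x, v}) D" by (auto simp: inj_on_def doubleton_eq_iff)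
  show "finite (star v D)" "card (star v D) = card D"
    using assms by (simp_all add: star_def card_image[OF inj])
  show "simple_on (insert v D) (star v D)"
    using assms by (auto simp: simple_on_def star_def card_insert_if)
  have "{e \<in> star v D. v \<in> e} = star v D" by (auto simp: star_def)
  then show "dg (star v D) v = card D" by (simp add: dg_def star_def card_image[OF inj])
  show "dg (star v D) w = (if w \<in> D then 1 else 0)" if "w \<noteq> v"
  proof -
    have "{e \<in> star v D. w \<in> e} = (if w \<in> D then {{w, v}} else {})"
      using that by (auto simp: star_def)
    then show ?thesis by (simp add: dg_def)
  qed
qed

lemma star_fresh: "simple_on V F \<Longrightarrow> v \<notin> V \<Longrightarrow> F \<inter> star v D = {}"
  by (auto simp: star_def simple_on_def)

lemma star_insert_mset:
  assumes "finite D" "a \<notin> D" "v \<noteq> a" "v \<notin> D"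
  shows "mset_set (star v (insert a D)) = add_mset {a, v} (mset_set (star v D))"
proof -
  have "{a, v} \<notin> star v D" using assms by (auto simp: star_def doubleton_eq_iff)
  then show ?thesis using star_props(1)[OF assms(1,4)] by (simp add: star_def)
qed

lemma S3_add_star_edges:
  assumes "finite D" "S3 V E" "finite V" "v \<in> V" "v \<notin> D" "D \<subseteq> V"
  shows "S3 V (mset_set (star v D) + E)"
  using assms(1,5,6)
proof (induction D rule: finite_induct)
  case empty
  then show ?case using assms(2) by (simp add: star_def)
next
  case (insert x D)
  then have "S3 V (add_mset {x, v} (mset_set (star v D) + E))"
    by (intro S3_add_edge assms(3)) auto
  then show ?case using insert by (simp add: star_insert_mset)
qed

lemma S3_add_star_lifted:
  assumes "S3 V (add_mset {a, b} E)" "finite V" "\<Union>(set_mset E) \<subseteq> V"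
    and "a \<in> V" "b \<in> V" "a \<noteq> b" "D \<subseteq> V - {a, b}" "card D \<ge> 2" "v \<notin> V"
  shows "S3 (insert v V) (mset_set (star v (insert a (insert b D))) + E)"
proof -
  obtain x D1 where x: "D = insert x D1" "x \<notin> D1" "card D1 \<ge> 1"
    using assms(8) by (metis card_le_Suc_iff numeral_2_eq_2 Suc_le_mono One_nat_def)
  obtain y D2 where y: "D1 = insert y D2" "y \<notin> D2"
    using x(3) by (metis card_le_Suc_iff One_nat_def)
  have fin: "finite D2" using assms(2,7) x y by (metis finite_subset finite_Diff finite_insert)
  have xy: "x \<in> V" "y \<in> V" "x \<noteq> y" "x \<notin> {a, b}" "y \<notin> {a, b}" "D2 \<subseteq> V - {a, b, x, y}"
    using assms(7) x y by auto
  have "S3 (insert v V) (add_mset {a, v} (add_mset {b, v} (add_mset {x, v} (add_mset {y, v} E))))"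
    using S3_add_vertex4[OF assms(1-5) xy(1,2) assms(9)] .
  from S3_add_star_edges[OF fin this, of v]
  have "S3 (insert v V) (mset_set (star v D2) + (add_mset {a, v} (add_mset {b, v} (add_mset {x, v} (add_mset {y, v} E)))))"
    using assms(2,9) xy(6) by auto
  moreover have "mset_set (star v (insert a (insert b D))) =
      add_mset {a, v} (add_mset {b, v} (add_mset {x, v} (add_mset {y, v} (mset_set (star v D2)))))"
  proof -
    have "v \<notin> D2" "v \<noteq> a" "v \<noteq> b" "v \<noteq> x" "v \<noteq> y" "a \<notin> D2" "b \<notin> D2"
      "a \<noteq> x" "a \<noteq> y" "b \<noteq> x" "b \<noteq> y" using assms xy by auto
    then show ?thesis unfolding x y
      using fin xy assms(6) y(2) x(2) by (auto simp: star_insert_mset y(1))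
  qed
  ultimately show ?thesis by simp
qed

text \<open>An auxiliary edge between two of the future neighbours is added and then subdivided by
  \<open>v\<close>, so no edge of \<open>E\<close> is lost.\<close>

lemma S3_add_star:
  assumes "S3 V E" "finite V" "\<Union>(set_mset E) \<subseteq> V" "D \<subseteq> V" "card D \<ge> 4" "v \<notin> V"
  shows "S3 (insert v V) (mset_set (star v D) + E)"
proof -
  obtain a D1 where a: "D = insert a D1" "a \<notin> D1" "card D1 \<ge> 3"
    using assms(5) by (metis card_le_Suc_iff eval_nat_numeral(2,3) Suc_le_mono numeral_eq_Suc pred_numeral_simps(2) semiring_norm(26,27))
  obtain b D2 where b: "D1 = insert b D2" "b \<notin> D2" "card D2 \<ge> 2"
    using a(3) by (metis card_le_Suc_iff numeral_3_eq_3 numeral_2_eq_2 Suc_le_mono)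
  have "S3 V (add_mset {a, b} E)"
    using assms a by (intro S3_add_edge) auto
  from S3_add_star_lifted[OF this assms(2,3), of D2 v] show ?thesis
    using assms a b by auto
qed

lemma S3_graphicI:
  assumes "simple_on V F" "S3 V (mset_set F)" "\<And>v. v \<in> V \<Longrightarrow> dg F v = d v"
  shows "S3_graphic V d"
  using assms unfolding S3_graphic_def by blast

lemma S3_graphic_add_vertex:
  assumes "S3_graphic V d'" "finite V" "v \<notin> V" "D \<subseteq> V" "card D \<ge> 4"
    and "d v = card D" "\<And>x. x \<in> V \<Longrightarrow> d x = d' x + (if x \<in> D then 1 else 0)"
  shows "S3_graphic (insert v V) d"
proof -
  obtain F where F: "simple_on V F" "S3 V (mset_set F)" "\<forall>v\<in>V. dg F v = d' v"
    using assms(1) by (auto simp: S3_graphic_def)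
  have fin: "finite F" "finite D" "v \<notin> D"
    using simple_on_finite[OF F(1) assms(2)] assms(2-4) by (auto intro: finite_subset)
  note sp = star_props[OF fin(2,3)]
  have dis: "star v D \<inter> F = {}" using star_fresh[OF F(1) assms(3)] by auto
  show ?thesis
  proof (rule S3_graphicI)
    show "simple_on (insert v V) (star v D \<union> F)"
      unfolding simple_on_Un
      using simple_on_mono[OF sp(3), of "insert v V"] simple_on_mono[OF F(1), of "insert v V"] assms(4) by auto
    show "S3 (insert v V) (mset_set (star v D \<union> F))"
      using S3_add_star[OF F(2) assms(2) _ assms(4,5,3)] simple_on_edges[OF F(1)] fin
      by (simp add: mset_set_Union[OF sp(1) fin(1) dis])
    show "dg (star v D \<union> F) w = d w" if "w \<in> insert v V" for w
      using that F(3) assms(3,6,7) dg_outside[OF F(1) assms(3)]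
      by (cases "w = v") (auto simp: dg_Un[OF sp(1) fin(1) dis] sp)
  qed
qed

text \<open>The subdivided edge \<open>{a, b}\<close> must avoid \<open>D\<close> to keep the graph
  simple. It exists because a vertex outside \<open>D\<close> has more than \<open>card D\<close>
  neighbours, hence one outside \<open>D\<close>. Subdivision does not change the degrees of
  \<open>a\<close> and \<open>b\<close>, so only \<open>D\<close> is affected.\<close>

lemma S3_graphic_subdivide:
  assumes "S3_graphic V d'" "finite V" "v \<notin> V" "D \<subset> V" "card D \<ge> 2"
    and "\<And>x. x \<in> V - D \<Longrightarrow> card D < d' x"
    and "d v = card D + 2" "\<And>x. x \<in> V \<Longrightarrow> d x = d' x + (if x \<in> D then 1 else 0)"
  shows "S3_graphic (insert v V) d"
proof -
  obtain F where F: "simple_on V F" "S3 V (mset_set F)" "\<forall>v\<in>V. dg F v = d' v"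
    using assms(1) by (auto simp: S3_graphic_def)
  have fin: "finite F" "finite D" "v \<notin> D"
    using simple_on_finite[OF F(1) assms(2)] assms(2-4) by (auto intro: finite_subset)
  obtain a where a: "a \<in> V - D" using assms(4) by auto
  have "\<exists>b. b \<in> V - D \<and> {a, b} \<in> F \<and> b \<noteq> a"
  proof (rule ccontr)
    assume neg: "\<not> ?thesis"
    have "{e \<in> F. a \<in> e} \<subseteq> star a D"
    proof
      fix e assume e: "e \<in> {e \<in> F. a \<in> e}"
      then have "card e = 2" "e \<subseteq> V" using F(1) by (auto simp: simple_on_def)
      then obtain b where b: "e = {a, b}" "a \<noteq> b" using e by (auto simp: card_2_iff doubleton_eq_iff)
      then have "b \<in> D" using neg e \<open>e \<subseteq> V\<close> by auto
      then show "e \<in> star a D" using b by (auto simp: star_def insert_commute)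
    qed
    then have "dg F a \<le> card D"
      unfolding dg_def using card_mono[OF star_props(1)[OF fin(2), of a]] star_props(2)[OF fin(2), of a] a by auto
    then show False using assms(6)[OF a] F(3) a by auto
  qed
  then obtain b where b: "b \<in> V - D" "{a, b} \<in> F" "b \<noteq> a" by blast
  let ?D = "insert a (insert b D)" and ?F = "F - {{a, b}}"
  have fin': "finite ?D" "v \<notin> ?D" "finite ?F" using fin a b assms(3) by auto
  note sp = star_props[OF fin'(1,2)]
  have F': "simple_on V ?F" using simple_on_mono[OF F(1)] by auto
  have dis: "star v ?D \<inter> ?F = {}" using star_fresh[OF F' assms(3)] by blast
  have cD: "card ?D = card D + 2" using fin a b by auto
  have "mset_set F = add_mset {a, b} (mset_set ?F)"
    using b(2) fin(1) by (simp add: mset_set.remove)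
  then have S: "S3 V (add_mset {a, b} (mset_set ?F))" using F(2) by simp
  show ?thesis
  proof (rule S3_graphicI)
    show "simple_on (insert v V) (star v ?D \<union> ?F)"
      unfolding simple_on_Un
      using simple_on_mono[OF sp(3), of "insert v V"] simple_on_mono[OF F', of "insert v V"] assms(4) a b by auto
    show "S3 (insert v V) (mset_set (star v ?D \<union> ?F))"
      unfolding mset_set_Union[OF sp(1) fin'(3) dis]
      by (rule S3_add_star_lifted[OF S assms(2)])
        (use simple_on_edges[OF F'] fin' a b assms in auto)
    show "dg (star v ?D \<union> ?F) w = d w" if "w \<in> insert v V" for w
    proof (cases "w = v")
      case True
      then show ?thesis
        using dg_outside[OF F' assms(3)] assms(7) cD by (simp add: dg_Un[OF sp(1) fin'(3) dis] sp)
    next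
      case False
      then have w: "w \<in> V" using that by simp
      have "dg F w = dg ?F w + (if w \<in> {a, b} then 1 else 0)"
        by (rule dg_remove[OF fin(1) b(2)])
      then show ?thesis
        using False w F(3) assms(8)[OF w] a b by (auto simp: dg_Un[OF sp(1) fin'(3) dis] sp split: if_splits)
    qed
  qed
qed

lemma dg_mset: "finite F \<Longrightarrow> dg F v = size {#e \<in># mset_set F. v \<in> e#}"
  by (simp add: dg_def filter_mset_mset_set)

lemma mset_set_remove4:
  assumes "finite F" "f1 \<in> F" "f2 \<in> F - {f1}" "f3 \<in> F - {f1, f2}" "f4 \<in> F - {f1, f2, f3}"
  shows "mset_set F = {#f1, f2, f3, f4#} + mset_set (F - {f1, f2, f3, f4})"
proof -
  define E where "E = F - {f1, f2, f3, f4}"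
  have F: "F = insert f1 (insert f2 (insert f3 (insert f4 E)))"
    using assms by (auto simp: E_def)
  have "f1 \<notin> insert f2 (insert f3 (insert f4 E))" "f2 \<notin> insert f3 (insert f4 E)" "f3 \<notin> insert f4 E"
      "f4 \<notin> E" "finite E"
    using assms by (auto simp: E_def)
  then have "mset_set F = {#f1, f2, f3, f4#} + mset_set E" by (subst F) simp
  then show ?thesis by (simp add: E_def)
qed

text \<open>Serves to pick an edge for subdivision: \<open>P\<close> holds the edges already taken,
  and \<open>e\<close> is the end of the free edge, which would be doubled if \<open>e\<close> were
  also an end of the subdivided edge.\<close>

lemma edge_avoiding:
  assumes "simple_on V F" "finite V" "finite P" "card P + dg F e < card F"
  shows "\<exists>a b. {a, b} \<in> F - P \<and> a \<noteq> b \<and> e \<notin> {a, b} \<and> {a, b} \<subseteq> V"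
proof -
  have fin: "finite F" using simple_on_finite assms by blast
  have "card (P \<union> {f \<in> F. e \<in> f}) < card F"
    using assms(4) card_Un_le[of P "{f \<in> F. e \<in> f}"] by (simp add: dg_def)
  then have "\<not> F \<subseteq> P \<union> {f \<in> F. e \<in> f}"
    using card_mono[of "P \<union> {f \<in> F. e \<in> f}" F] fin assms(3) by auto
  then obtain f where f: "f \<in> F" "f \<notin> P" "e \<notin> f" by blast
  then have "card f = 2" "f \<subseteq> V" using assms(1) by (auto simp: simple_on_def)
  then obtain a b where "f = {a, b}" "a \<noteq> b" "f \<subseteq> V"
    unfolding card_2_iff by blast
  then show ?thesis using f by blast
qed

text \<open>Old degrees rise only at the ends of the free edges; a vertex may serve several of the
  four, hence \<open>count_list\<close>. The bound on \<open>d' e\<close> says that enough edges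
  miss \<open>e\<close> even after other edges have been taken.\<close>

lemma S3_graphic_add_cycle:
  assumes "S3_graphic V d'" "finite V"
    and u: "distinct [u1, u2, u3, u4]" "V \<inter> {u1, u2, u3, u4} = {}"
    and e: "{e1, e2, e3, e4} \<subseteq> V" "\<And>e. e \<in> {e1, e2, e3, e4} \<Longrightarrow> 2 * (d' e + 4) \<le> sum d' V"
    and d: "\<And>u. u \<in> {u1, u2, u3, u4} \<Longrightarrow> d u = 5"
      "\<And>x. x \<in> V \<Longrightarrow> d x = d' x + count_list [e1, e2, e3, e4] x"
  shows "S3_graphic (V \<union> {u1, u2, u3, u4}) d"
proof -
  obtain F where F: "simple_on V F" "S3 V (mset_set F)" "\<forall>v\<in>V. dg F v = d' v"
    using assms(1) by (auto simp: S3_graphic_def)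
  have finF: "finite F" using simple_on_finite[OF F(1) assms(2)] .
  have "sum d' V = 2 * card F"
    using handshake[OF F(1) assms(2)] F(3) by simp
  then have avoid: "dg F e + 4 \<le> card F" if "e \<in> {e1, e2, e3, e4}" for e
    using e(1) e(2)[OF that] F(3) that by auto
  note av = edge_avoiding[OF F(1) assms(2)]
  obtain a1 b1 where 1: "{a1, b1} \<in> F" "a1 \<noteq> b1" "e1 \<notin> {a1, b1}" "{a1, b1} \<subseteq> V"
    using av[of "{}" e1] avoid[of e1] by auto
  obtain a2 b2 where 2: "{a2, b2} \<in> F - {{a1, b1}}" "a2 \<noteq> b2" "e2 \<notin> {a2, b2}" "{a2, b2} \<subseteq> V"
    using av[of "{{a1, b1}}" e2] avoid[of e2] by auto
  have "card {{a1, b1}, {a2, b2}} \<le> 2" by (simp add: card_insert_if)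
  then obtain a3 b3 where 3: "{a3, b3} \<in> F - {{a1, b1}, {a2, b2}}" "a3 \<noteq> b3" "e3 \<notin> {a3, b3}" "{a3, b3} \<subseteq> V"
    using av[of "{{a1, b1}, {a2, b2}}" e3] avoid[of e3] by auto
  have "card {{a1, b1}, {a2, b2}, {a3, b3}} \<le> 3" by (simp add: card_insert_if)
  then obtain a4 b4 where 4: "{a4, b4} \<in> F - {{a1, b1}, {a2, b2}, {a3, b3}}" "a4 \<noteq> b4" "e4 \<notin> {a4, b4}" "{a4, b4} \<subseteq> V"
    using av[of "{{a1, b1}, {a2, b2}, {a3, b3}}" e4] avoid[of e4] by auto
  define E where "E = F - {{a1, b1}, {a2, b2}, {a3, b3}, {a4, b4}}"
  have E: "simple_on V E" "finite E" using simple_on_mono[OF F(1)] finF by (auto simp: E_def)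
  have mF: "mset_set F = {#{a1, b1}, {a2, b2}, {a3, b3}, {a4, b4}#} + mset_set E"
    unfolding E_def by (rule mset_set_remove4) (use finF 1 2 3 4 in blast)+
  let ?V = "V \<union> {u1, u2, u3, u4}"
  define G where "G = {{a1, u1}, {b1, u1}, {e1, u1}, {a2, u2}, {b2, u2}, {e2, u2},
       {a3, u3}, {b3, u3}, {e3, u3}, {a4, u4}, {b4, u4}, {e4, u4},
       {u1, u2}, {u2, u3}, {u3, u4}, {u4, u1}}"
  let ?C = "cycle_edges (a1, b1, e1, u1) (a2, b2, e2, u2) (a3, b3, e3, u3) (a4, b4, e4, u4)"
  have V: "{a1, b1, e1, a2, b2, e2, a3, b3, e3, a4, b4, e4} \<subseteq> V"
    using 1 2 3 4 e(1) by auto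
  have uV: "u1 \<notin> V" "u2 \<notin> V" "u3 \<notin> V" "u4 \<notin> V" using u by auto
  have ne: "x \<noteq> u1" "x \<noteq> u2" "x \<noteq> u3" "x \<noteq> u4" if "x \<in> V" for x using that uV by auto
  have nes: "a1 \<noteq> b1" "a1 \<noteq> e1" "b1 \<noteq> e1" "a2 \<noteq> b2" "a2 \<noteq> e2" "b2 \<noteq> e2"
    "a3 \<noteq> b3" "a3 \<noteq> e3" "b3 \<noteq> e3" "a4 \<noteq> b4" "a4 \<noteq> e4" "b4 \<noteq> e4"
    using 1 2 3 4 by auto
  have us: "u2 \<noteq> u1" "u3 \<noteq> u1" "u4 \<noteq> u1" "u3 \<noteq> u2" "u4 \<noteq> u2" "u4 \<noteq> u3" using u(1) by auto
  have mG: "mset_set G = ?C"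
    unfolding G_def cycle_edges_def prod.case
    using u(1) us ne V nes by (simp add: doubleton_eq_iff)
  have finG: "finite G" by (simp add: G_def)
  have sG: "simple_on ?V G"
    unfolding G_def simple_on_def using u(1) us ne V by (simp add: card_insert_if)
  have dis: "G \<inter> E = {}"
    using uV simple_on_edges[OF E(1)] by (auto simp: G_def)
  have m: "mset_set (G \<union> E) = ?C + mset_set E"
    using mset_set_Union[OF finG E(2) dis] mG by simp
  show ?thesis
  proof (rule S3_graphicI)
    show "simple_on ?V (G \<union> E)"
      unfolding simple_on_Un using sG simple_on_mono[OF E(1), of ?V] by auto
    show "S3 ?V (mset_set (G \<union> E))"
      unfolding m using S3_add_cycle[OF F(2)[unfolded mF] assms(2) _ V u] simple_on_edges[OF E(1)] E(2) by auto
    show "dg (G \<union> E) w = d w" if w: "w \<in> ?V" for w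
    proof -
      \<comment> \<open>Indicators of \<open>w\<close> turn the degree count over the sixteen edges
        into linear arithmetic that does not depend on coincidences among the old vertices.\<close>
      define i where "i x = (if w = x then 1 else 0 :: nat)" for x
      have lift: "size {#e \<in># add_mset {a, b} M. w \<in> e#} = i a + i b + size {#e \<in># M. w \<in> e#}"
        if "a \<noteq> b" for a b M using that by (auto simp: i_def)
      have new: "size {#e \<in># add_mset {a, b} M. w \<in> e#} = i a + size {#e \<in># M. w \<in> e#}"
        if "w \<noteq> b" for a b M using that by (auto simp: i_def)
      have dgG: "dg (G \<union> E) w = size {#e \<in># ?C. w \<in> e#} + dg E w"
        using finG E(2) by (simp add: dg_mset m)
      show ?thesis
      proof (cases "w \<in> V")
        case True
        have F': "dg F w = i a1 + i b1 + (i a2 + i b2 + (i a3 + i b3 + (i a4 + i b4 + dg E w)))"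
          unfolding dg_mset[OF finF] dg_mset[OF E(2)] mF
          by (simp only: union_mset_add_mset_left add_0 lift[OF nes(1)] lift[OF nes(4)] lift[OF nes(7)] lift[OF nes(10)])
        have "i u1 = 0" "i u2 = 0" "i u3 = 0" "i u4 = 0" using ne[OF True] by (auto simp: i_def)
        then have "size {#e \<in># ?C. w \<in> e#} = i a1 + i b1 + (i a2 + i b2) + (i a3 + i b3) + (i a4 + i b4)
            + (i e1 + i e2 + i e3 + i e4)"
          unfolding cycle_edges_def prod.case
          by (simp only: new[OF ne(1)[OF True]] new[OF ne(2)[OF True]] new[OF ne(3)[OF True]] new[OF ne(4)[OF True]]
            filter_empty_mset size_empty add_0_right ac_simps)
        also have "i e1 + i e2 + i e3 + i e4 = count_list [e1, e2, e3, e4] w"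
          by (simp add: i_def)
        finally show ?thesis using dgG F' F(3) d(2)[OF True] True by (simp del: count_list.simps)
      next
        case False
        then have wu: "w \<in> {u1, u2, u3, u4}" using w by auto
        have old: "size {#e \<in># add_mset {a, b} M. w \<in> e#} = i b + size {#e \<in># M. w \<in> e#}"
          if "a \<in> V" for a b M using that False by (auto simp: i_def)
        have "i u1 + i u2 + i u3 + i u4 = 1"
          using wu us by (auto simp: i_def)
        moreover have "size {#e \<in># ?C. w \<in> e#} = 5 * (i u1 + i u2 + i u3 + i u4)"
          unfolding cycle_edges_def prod.case using V
          by (simp only: old lift[OF us(1)[symmetric]] lift[OF us(4)[symmetric]] lift[OF us(6)[symmetric]] lift[OF us(3)]
            insert_subset simp_thms filter_empty_mset size_empty) simp
        ultimately have "size {#e \<in># ?C. w \<in> e#} = 5" by simp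
        then show ?thesis using dgG dg_outside[OF E(1) False] d(1)[OF wu] by simp
      qed
    qed
  qed
qed

text \<open>The new vertices are adjacent and both joined to all three hubs. A temporary edge
  \<open>{h1, h2}\<close> is subdivided by \<open>y\<close>, whose edge to \<open>h1\<close> is
  doubled by a free edge; \<open>x\<close> then subdivides one of the two copies, which creates the
  edge between \<open>x\<close> and \<open>y\<close>.\<close>

lemma S3_graphic_add_pair:
  assumes "S3_graphic V d'" "finite V" "distinct [h1, h2, h3]" "{h1, h2, h3} \<subseteq> V"
    and xy: "x \<noteq> y" "x \<notin> V" "y \<notin> V" and "d x = 4" "d y = 4"
    and d: "\<And>w. w \<in> V \<Longrightarrow> d w = d' w + (if w \<in> {h1, h2, h3} then 2 else 0)"
  shows "S3_graphic (insert x (insert y V)) d"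
proof -
  obtain F where F: "simple_on V F" "S3 V (mset_set F)" "\<forall>v\<in>V. dg F v = d' v"
    using assms(1) by (auto simp: S3_graphic_def)
  have finF: "finite F" using simple_on_finite[OF F(1) assms(2)] .
  have FV: "\<Union>(set_mset (mset_set F)) \<subseteq> V" using simple_on_edges[OF F(1)] finF by simp
  have S1: "S3 V (add_mset {h1, h2} (mset_set F))"
    using assms by (intro S3_add_edge[OF F(2)]) auto
  have S2: "S3 (insert y V) (add_mset {h1, y} (add_mset {h1, y} (add_mset {h2, y} (add_mset {h3, y} (mset_set F)))))"
    using S3_add_vertex4[OF S1 assms(2) FV, of h1 h3 y] assms(4) xy(3) by (simp add: add_mset_commute)
  let ?H = "{h1, h2, h3}"
  have H: "finite ?H" "card ?H = 3" "y \<notin> ?H" "x \<notin> insert y ?H" using assms(3,4) xy by auto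
  let ?G = "star x (insert y ?H) \<union> (star y ?H \<union> F)"
  note sy = star_props[OF H(1) H(3)] and sx = star_props[OF finite.insertI[OF H(1), of y] H(4)]
  have d1: "star y ?H \<inter> F = {}" using star_fresh[OF F(1) xy(3)] by auto
  have s1: "simple_on (insert y V) (star y ?H \<union> F)"
    unfolding simple_on_Un using simple_on_mono[OF sy(3), of "insert y V"] simple_on_mono[OF F(1), of "insert y V"] assms(4) by auto
  have d2: "star x (insert y ?H) \<inter> (star y ?H \<union> F) = {}" using star_fresh[OF s1, of x] xy by auto
  have f1: "finite (star y ?H \<union> F)" using sy(1) finF by simp
  have my: "mset_set (star y ?H \<union> F) = add_mset {h1, y} (add_mset {h2, y} (add_mset {h3, y} (mset_set F)))"
    unfolding mset_set_Union[OF sy(1) finF d1]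
    using assms(3) H by (simp add: star_def doubleton_eq_iff)
  have mx: "mset_set (star x (insert y ?H)) = {#{y, x}, {h1, x}, {h2, x}, {h3, x}#}"
    using assms(3) H by (simp add: star_def doubleton_eq_iff)
  show ?thesis
  proof (rule S3_graphicI)
    show "simple_on (insert x (insert y V)) ?G"
      using simple_on_mono[OF sx(3), of "insert x (insert y V)"] simple_on_mono[OF s1, of "insert x (insert y V)"] assms(4)
      by (auto simp: simple_on_Un)
    show "S3 (insert x (insert y V)) (mset_set ?G)"
      unfolding mset_set_Union[OF sx(1) f1 d2] mx my
      using S3_add_vertex4[OF S2, of h2 h3 x] assms(2,4) xy subset_insertI2[OF FV, of y] by (simp add: add_mset_commute)
    show "dg ?G w = d w" if w: "w \<in> insert x (insert y V)" for w
    proof -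
      have "dg ?G w = dg (star x (insert y ?H)) w + (dg (star y ?H) w + dg F w)"
        using dg_Un[OF sx(1) f1 d2] dg_Un[OF sy(1) finF d1] by simp
      then show ?thesis
        using w xy d[of w] F(3) dg_outside[OF F(1)] H assms(8,9) sx(4) sx(5)[of w] sy(4) sy(5)[of w]
        by (cases "w = x"; cases "w = y") auto
    qed
  qed
qed

section \<open>Transport along bijections\<close>

lemma orientable_rename:
  assumes "orientable W E (\<lambda>w. r (f w))" "inj_on f W" "\<Union>(set_mset E) \<subseteq> W"
  shows "orientable (f ` W) (image_mset ((`) f) E) r"
proof -
  obtain A where A: "image_mset uedge A = E" "\<forall>w\<in>W. [int (outdeg A w) = r (f w)] (mod 3)" "strong_on W A"
    using assms(1) by (auto simp: orientable_def)
  let ?A = "image_mset (map_prod f f) A"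
  have AW: "fst p \<in> W" "snd p \<in> W" if "p \<in># A" for p
  proof -
    have "uedge p \<in># E" using A(1) that by auto
    then have "uedge p \<subseteq> W" using assms(3) by auto
    then show "fst p \<in> W" "snd p \<in> W" by (auto simp: uedge_def)
  qed
  have "outdeg ?A (f w) = outdeg A w" if "w \<in> W" for w
  proof -
    have "filter_mset (\<lambda>p. fst (map_prod f f p) = f w) A = filter_mset (\<lambda>p. fst p = w) A"
      using AW assms(2) that by (intro filter_mset_cong) (auto simp: inj_on_def)
    then show ?thesis by (simp add: outdeg_def filter_mset_image_mset)
  qed
  moreover have "image_mset uedge ?A = image_mset ((`) f) E"
    unfolding A(1)[symmetric] by (simp add: uedge_def multiset.map_comp comp_def)
  moreover have "strong_on (f ` W) ?A"
  proof -
    have "(f x, f y) \<in> (set_mset ?A)\<^sup>*" if "(x, y) \<in> (set_mset A)\<^sup>*" for x y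
      using that
    proof (induction rule: rtrancl_induct)
      case (step y z)
      have "(f y, f z) \<in> set_mset ?A" using step(2) by force
      then show ?case using step(3) by (rule rtrancl_into_rtrancl[rotated])
    qed simp
    then show ?thesis using A(3) by (auto simp: strong_on_def)
  qed
  ultimately show ?thesis using A(2) unfolding orientable_def by (intro exI[of _ ?A]) auto
qed

lemma S3_rename:
  assumes "S3 W E" "inj_on f W" "\<Union>(set_mset E) \<subseteq> W"
  shows "S3 (f ` W) (image_mset ((`) f) E)"
  unfolding S3_def
proof (intro allI impI)
  fix r assume "[(\<Sum>v\<in>f ` W. r v) = int (size (image_mset ((`) f) E))] (mod 3)"
  then have "orientable W E (\<lambda>w. r (f w))"
    using assms(1,2) by (simp add: S3_def sum.reindex)
  then show "orientable (f ` W) (image_mset ((`) f) E) r"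
    using assms by (intro orientable_rename)
qed

lemma S3_graphic_rename:
  assumes "S3_graphic W e" "finite W" "bij_betw f W V" "\<And>w. w \<in> W \<Longrightarrow> d (f w) = e w"
  shows "S3_graphic V d"
proof -
  obtain F where F: "simple_on W F" "S3 W (mset_set F)" "\<forall>w\<in>W. dg F w = e w"
    using assms(1) by (auto simp: S3_graphic_def)
  have inj: "inj_on f W" and V: "V = f ` W" using assms(3) by (auto simp: bij_betw_def)
  have sub: "F \<subseteq> Pow W" using F(1) by (auto simp: simple_on_def)
  then have injF: "inj_on ((`) f) F"
    using inj_on_image_Pow[OF inj] by (rule inj_on_subset[rotated])
  have fin: "finite F" using simple_on_finite[OF F(1) assms(2)] .
  show ?thesis
  proof (rule S3_graphicI)
    show "simple_on V ((`) f ` F)"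
      using F(1) sub inj unfolding V simple_on_def by (auto simp: card_image inj_on_subset)
    show "S3 V (mset_set ((`) f ` F))"
      using S3_rename[OF F(2) inj] sub fin unfolding V
      by (simp add: image_mset_mset_set[OF injF, symmetric]) blast
    show "dg ((`) f ` F) v = d v" if "v \<in> V" for v
    proof -
      obtain w where w: "w \<in> W" "v = f w" using \<open>v \<in> V\<close> V by auto
      have "v \<in> f ` e \<longleftrightarrow> w \<in> e" if "e \<in> F" for e
        unfolding w(2) using inj_on_image_mem_iff[OF inj w(1), of e] that sub by auto
      then have "{e \<in> (`) f ` F. v \<in> e} = (`) f ` {e \<in> F. w \<in> e}"
        by blast
      moreover have "inj_on ((`) f) {e \<in> F. w \<in> e}" using injF by (rule inj_on_subset) auto
      ultimately have "dg ((`) f ` F) v = dg F w" by (simp add: dg_def card_image)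
      then show ?thesis using F(3) w assms(4) by simp
    qed
  qed
qed

text \<open>Since the property is invariant under relabelling, a script has to match only the
  multiset of degrees.\<close>

lemma image_mset_eq_bij:
  assumes "finite W" "finite V" "image_mset e (mset_set W) = image_mset d (mset_set V)"
  shows "\<exists>f. bij_betw f W V \<and> (\<forall>w\<in>W. d (f w) = e w)"
  using assms
proof (induction W arbitrary: V rule: finite_induct)
  case empty
  then have "mset_set V = {#}" by simp
  then have "V = {}" using empty by (simp add: mset_set_empty_iff)
  then show ?case by (auto simp: bij_betw_def)
next
  case (insert w W)
  have "e w \<in># image_mset d (mset_set V)" using insert by (metis image_mset_add_mset mset_set.insert union_single_eq_member)
  then obtain v where v: "v \<in> V" "d v = e w" using insert.prems by auto
  have "image_mset d (mset_set V) = add_mset (e w) (image_mset d (mset_set (V - {v})))"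
    using v insert.prems(1) by (simp add: mset_set.remove)
  then have "image_mset e (mset_set W) = image_mset d (mset_set (V - {v}))"
    using insert by simp
  then obtain f where f: "bij_betw f W (V - {v})" "\<forall>w\<in>W. d (f w) = e w"
    using insert.IH[of "V - {v}"] insert.prems by auto
  have "bij_betw (f(w := v)) (insert w W) (insert v (V - {v}))"
  proof -
    have "inj_on f W" "f ` W = V - {v}" using f(1) by (auto simp: bij_betw_def)
    moreover have "(f(w := v)) ` W = f ` W" "inj_on (f(w := v)) W \<longleftrightarrow> inj_on f W"
      using insert.hyps(2) by (auto intro!: inj_on_cong)
    ultimately show ?thesis using insert.hyps(2) by (auto simp: bij_betw_def)
  qed
  then have "bij_betw (f(w := v)) (insert w W) V" using v by (simp only: insert_Diff)
  moreover have "\<forall>x\<in>insert w W. d ((f(w := v)) x) = e x"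
    using f(2) v insert.hyps(2) by auto
  ultimately show ?case by blast
qed

lemma S3_graphic_realizes:
  assumes "realizes cs ds" "finite V" "image_mset d (mset_set V) = mset ds"
  shows "S3_graphic V d"
proof -
  let ?deg = "\<lambda>es v. length (filter (\<lambda>p. fst p = v \<or> snd p = (v :: nat)) es)"
  obtain n es where run: "exec_steps (Add_Edge 0 0 # Add_Vertex 0 0 0 0 # cs) (1, []) = Some (n, es)"
    and n: "n = length ds" and dist: "distinct es" and lt: "list_all (\<lambda>p. fst p < snd p) es"
    and deg: "rev (sort (map (?deg es) [0..<n])) = ds"
    using assms(1) by (auto simp: realizes_def split: option.splits simp del: exec_steps.simps)
  have "{..<1 :: nat} = {0}" by auto
  then have "invariant (1, [])" using S3_singleton[of "0 :: nat"] by (simp add: invariant_def)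
  from invariant_steps[OF run this] have inv: "S3 {..<n} (mset (map uedge es))"
      and es: "\<forall>p\<in>set es. fst p < n \<and> snd p < n"
    by (auto simp: invariant_def)
  have inj: "inj_on uedge (set es)"
  proof (rule inj_onI)
    fix p q assume pq: "p \<in> set es" "q \<in> set es" "uedge p = uedge q"
    then have "fst p < snd p" "fst q < snd q" using lt by (auto simp: list_all_iff)
    then show "p = q" using pq(3)
      by (cases p; cases q) (auto simp: uedge_def doubleton_eq_iff)
  qed
  let ?F = "uedge ` set es"
  have "mset (map uedge es) = mset_set ?F"
    using dist by (simp add: image_mset_mset_set[OF inj, symmetric] mset_set_set)
  then have S: "S3 {..<n} (mset_set ?F)" using inv by simp
  have "S3_graphic {..<n} (?deg es)"
  proof (rule S3_graphicI)
    show "simple_on {..<n} ?F"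
      using es lt by (auto simp: simple_on_def uedge_def list_all_iff card_insert_if dest!: bspec)
    show "dg ?F v = ?deg es v" for v
    proof -
      have "{e \<in> ?F. v \<in> e} = uedge ` set (filter (\<lambda>p. fst p = v \<or> snd p = v) es)"
        by (auto simp: uedge_def)
      moreover have "inj_on uedge (set (filter (\<lambda>p. fst p = v \<or> snd p = v) es))"
        using inj by (rule inj_on_subset) auto
      ultimately show ?thesis
        using distinct_card[of "filter (\<lambda>p. fst p = v \<or> snd p = v) es"] dist
        by (simp add: dg_def card_image)
    qed
  qed (rule S)
  moreover
  have "image_mset (?deg es) (mset_set {..<n}) = image_mset d (mset_set V)"
  proof -
    have "mset ds = mset (map (?deg es) [0..<n])" by (simp flip: deg)
    also have "\<dots> = image_mset (?deg es) (mset_set {..<n})" by (simp add: atLeast0LessThan)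
    finally show ?thesis using assms(3) by simp
  qed
  then obtain f where "bij_betw f {..<n} V" "\<forall>v\<in>{..<n}. d (f v) = ?deg es v"
    using image_mset_eq_bij[OF _ assms(2), of "{..<n}"] by blast
  ultimately show ?thesis
    by (intro S3_graphic_rename[of "{..<n}" "?deg es" f]) auto
qed

subsection \<open>Tight degree functions\<close>

lemma top_subset:
  fixes d :: "'v \<Rightarrow> nat"
  assumes "finite V" "k \<le> card V"
  shows "\<exists>D\<subseteq>V. card D = k \<and> (\<forall>x\<in>D. \<forall>y\<in>V - D. d y \<le> d x)"
  using assms(2)
proof (induction k)
  case (Suc k)
  then obtain D where D: "D \<subseteq> V" "card D = k" "\<forall>x\<in>D. \<forall>y\<in>V - D. d y \<le> d x" by auto
  have "V - D \<noteq> {}" using D Suc.prems assms(1) by (metis Diff_eq_empty_iff card_mono finite_subset not_less_eq_eq)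
  have fin: "finite (d ` (V - D))" using assms(1) by simp
  have "Max (d ` (V - D)) \<in> d ` (V - D)" using fin \<open>V - D \<noteq> {}\<close> by (intro Max_in) auto
  then obtain z where z: "z \<in> V - D" "d z = Max (d ` (V - D))" by auto
  then have "d y \<le> d z" if "y \<in> V - D" for y using fin that by simp
  then have "\<forall>x\<in>insert z D. \<forall>y\<in>V - insert z D. d y \<le> d x"
    using D(3) by blast
  moreover have "card (insert z D) = Suc k"
    using D(1,2) z(1) assms(1) finite_subset[of D V] by simp
  moreover have "insert z D \<subseteq> V" using D(1) z(1) by blast
  ultimately show ?case by blast
qed (simp add: exI[of _ "{}"])

lemma sorted_degrees:
  fixes d :: "'v \<Rightarrow> nat"
  assumes "finite V"
  obtains ds where "mset ds = image_mset d (mset_set V)" "sorted_wrt (\<ge>) ds" "length ds = card V"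
    "sum_list ds = sum d V" "set ds = d ` V"
proof -
  define ds where "ds = rev (sorted_list_of_multiset (image_mset d (mset_set V)))"
  have m: "mset ds = image_mset d (mset_set V)" by (simp add: ds_def)
  have "sorted (rev ds)" by (simp add: ds_def)
  then have "sorted_wrt (\<ge>) ds" by (simp add: sorted_wrt_rev)
  moreover have "length ds = card V" using arg_cong[OF m, of size] assms by simp
  moreover have "sum_list ds = sum d V"
    using arg_cong[OF m, of sum_mset] by (simp add: sum_mset_sum_list sum_unfold_sum_mset)
  moreover have "set ds = d ` V" using arg_cong[OF m, of set_mset] assms by simp
  ultimately show ?thesis using that m by blast
qed

lemma S3_graphic_table:
  assumes "list_all2 realizes css dss" "ds \<in> set dss" "finite V" "image_mset d (mset_set V) = mset ds"
  shows "S3_graphic V d"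
proof -
  obtain i where "i < length dss" "dss ! i = ds" using assms(2) by (auto simp: in_set_conv_nth)
  then have "realizes (css ! i) ds" using assms(1) by (auto simp: list_all2_conv_all_nth)
  then show ?thesis by (rule S3_graphic_realizes[OF _ assms(3,4)])
qed

lemma S3_graphic_seqs:
  assumes "list_all2 realizes css (seqs n hi lo s)" "finite V" "card V = n" "sum d V = s"
    "\<And>v. v \<in> V \<Longrightarrow> lo \<le> d v \<and> d v \<le> hi"
  shows "S3_graphic V d"
proof -
  obtain ds where ds: "mset ds = image_mset d (mset_set V)" "sorted_wrt (\<ge>) ds" "length ds = card V"
    "sum_list ds = sum d V" "set ds = d ` V"
    using sorted_degrees[OF assms(2)] .
  have "ds \<in> set (seqs (length ds) hi lo (sum_list ds))"
    using assms(5) ds(5) by (intro seqs_complete ds(2)) auto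
  then show ?thesis
    using S3_graphic_table[OF assms(1) _ assms(2)] ds assms(3,4) by metis
qed

lemma S3_graphic_hub_seqs:
  assumes "list_all2 realizes css (map (\<lambda>t. hi # hi # hi # t) (seqs n hi lo s))" "finite V"
    and T: "T \<subseteq> V" "card T = 3" "\<And>v. v \<in> T \<Longrightarrow> d v = hi"
    and "card (V - T) = n" "sum d (V - T) = s" "\<And>v. v \<in> V \<Longrightarrow> lo \<le> d v \<and> d v \<le> hi"
  shows "S3_graphic V d"
proof -
  have fin: "finite (V - T)" "finite T" using assms(2) T(1) by (auto intro: finite_subset)
  obtain t where t: "mset t = image_mset d (mset_set (V - T))" "sorted_wrt (\<ge>) t" "length t = card (V - T)"
    "sum_list t = sum d (V - T)" "set t = d ` (V - T)"
    using sorted_degrees[OF fin(1)] .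
  have "t \<in> set (seqs (length t) hi lo (sum_list t))"
    using assms(8) t(5) by (intro seqs_complete t(2)) auto
  then have "hi # hi # hi # t \<in> set (map (\<lambda>t. hi # hi # hi # t) (seqs n hi lo s))"
    using t assms(6,7) by auto
  moreover have "image_mset d (mset_set V) = mset (hi # hi # hi # t)"
  proof -
    have "mset_set V = mset_set T + mset_set (V - T)"
      using mset_set_Union[OF fin(2,1)] T(1) by (simp add: Un_absorb1)
    moreover have "image_mset d (mset_set T) = replicate_mset 3 hi"
    proof -
      have "image_mset d (mset_set T) = image_mset (\<lambda>_. hi) (mset_set T)"
        using T(3) fin(2) by (intro image_mset_cong) auto
      then show ?thesis using T(2) by (simp add: image_mset_const_eq)
    qed
    ultimately show ?thesis using t(1) by (simp add: numeral_3_eq_3)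
  qed
  ultimately show ?thesis using S3_graphic_table[OF assms(1) _ assms(2)] by blast
qed

section \<open>Reductions of tight degree functions\<close>

lemma list_with_counts_between:
  fixes l u :: "'v \<Rightarrow> nat"
  assumes "finite W" "sum l W \<le> k" "k \<le> sum u W" "\<And>x. x \<in> W \<Longrightarrow> l x \<le> u x"
  shows "\<exists>es. length es = k \<and> set es \<subseteq> W \<and> (\<forall>x\<in>W. l x \<le> count_list es x \<and> count_list es x \<le> u x)"
  using assms(2-4)
proof (induction k arbitrary: l u)
  case 0
  then have "\<forall>x\<in>W. l x = 0" using assms(1) by auto
  then show ?case by (intro exI[of _ "[]"]) auto
next
  case (Suc k)
  \<comment> \<open>Greedy choice: outstanding lower bounds are served first, and an arbitrary
    element with capacity is taken only when none remains.\<close>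
  have "\<exists>x\<in>W. 0 < u x \<and> (0 < l x \<or> sum l W = 0)"
  proof (cases "sum l W = 0")
    case True
    have "sum u W \<noteq> 0" using Suc.prems by auto
    then show ?thesis using True by (metis gr0I sum.neutral)
  next
    case False
    then obtain x where "x \<in> W" "0 < l x" by (metis gr0I sum.neutral)
    then show ?thesis using Suc.prems(3) by (metis less_le_trans)
  qed
  then obtain x where x: "x \<in> W" "0 < u x" "0 < l x \<or> sum l W = 0" by blast
  let ?l = "l(x := l x - 1)" and ?u = "u(x := u x - 1)"
  have "sum ?l W + (if 0 < l x then 1 else 0) = sum l W" "sum ?u W + 1 = sum u W"
    using x assms(1) by (auto simp: sum.remove)
  then have "sum ?l W \<le> k" "k \<le> sum ?u W" using Suc.prems x(3) by (auto split: if_splits)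
  moreover have "?l y \<le> ?u y" if "y \<in> W" for y using Suc.prems(3)[OF that] by auto
  ultimately obtain es where "length es = k" "set es \<subseteq> W"
      "\<forall>y\<in>W. ?l y \<le> count_list es y \<and> count_list es y \<le> ?u y"
    using Suc.IH by blast
  then show ?case using x by (intro exI[of _ "x # es"]) (auto split: if_splits)
qed

text \<open>Deleting \<open>v\<close> lowers the two largest other degrees by one; re-inserting it
  subdivides an edge. The sum drops by 6, so tightness persists. The limit of two vertices of degree
  \<open>n - 1\<close> guarantees that all of them are lowered.\<close>

lemma tight_min4_step:
  assumes "finite V" "card V = n" "9 \<le> n" "\<And>x. x \<in> V \<Longrightarrow> 4 \<le> d x \<and> d x \<le> n - 1"
    and "sum d V = 6 * n - 4" "v \<in> V" "d v = 4" "card {x \<in> V. d x = n - 1} \<le> 2"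
    and IH: "\<And>d'. (\<And>x. x \<in> V - {v} \<Longrightarrow> 4 \<le> d' x \<and> d' x \<le> n - 2) \<Longrightarrow>
      sum d' (V - {v}) = 6 * (n - 1) - 4 \<Longrightarrow> S3_graphic (V - {v}) d'"
  shows "S3_graphic V d"
proof -
  let ?V = "V - {v}"
  have fin: "finite ?V" "card ?V = n - 1" using assms(1,2,6) by auto
  then have "2 \<le> card ?V" using assms(3) by simp
  from top_subset[OF fin(1) this, of d]
  obtain D where D: "D \<subseteq> ?V" "card D = 2" "\<forall>x\<in>D. \<forall>y\<in>?V - D. d y \<le> d x"
    by blast
  have finD: "finite D" using D(1) fin(1) finite_subset by blast
  have sumV: "sum d V = 4 + sum d ?V" using assms(1,6,7) by (simp add: sum.remove)
  have sumD: "sum d ?V = sum d D + sum d (?V - D)"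
    using sum.subset_diff[OF D(1) fin(1), of d] by simp
  have cD: "card (?V - D) = n - 3" using card_Diff_subset[OF finD D(1)] fin(2) D(2) by simp
  \<comment> \<open>If \<open>D\<close> contained a vertex of degree 4, all degrees outside
    \<open>D\<close> would be 4, and the total at most
    \<open>4 + 4 + (n - 1) + 4 (n - 3) = 5 n - 5\<close>, which is too small.\<close>
  have D5: "5 \<le> d x" if x: "x \<in> D" for x
  proof (rule ccontr)
    assume "\<not> 5 \<le> d x"
    then have dx: "d x = 4" using assms(4)[of x] D(1) x by auto
    obtain y where y: "D = {x, y}" "x \<noteq> y" using D(2) x by (auto simp: card_2_iff)
    then have "sum d D \<le> 4 + (n - 1)" using dx assms(4)[of y] D(1) by auto
    moreover have "sum d (?V - D) \<le> 4 * card (?V - D)"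
      using D(3) x dx sum_bounded_above[of "?V - D" d 4] by (auto simp: mult.commute)
    ultimately show False using assms(3,5) sumV sumD cD by simp
  qed
  define d' where "d' x = d x - (if x \<in> D then 1 else 0)" for x
  have "S3_graphic ?V d'"
  proof (rule IH)
    show "4 \<le> d' x \<and> d' x \<le> n - 2" if x: "x \<in> ?V" for x
    proof (cases "x \<in> D")
      case True
      then show ?thesis using D5[OF True] assms(4)[of x] x by (auto simp: d'_def)
    next
      case False
      have "d x \<noteq> n - 1"
      proof
        assume *: "d x = n - 1"
        have "insert x D \<subseteq> {x \<in> V. d x = n - 1}"
        proof
          fix z assume z: "z \<in> insert x D"
          then have "z \<in> V" using D(1) x by auto
          moreover have "d x \<le> d z" using z D(3) False x by auto
          ultimately show "z \<in> {x \<in> V. d x = n - 1}" using * assms(4)[of z] by auto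
        qed
        then have "card (insert x D) \<le> 2"
          using card_mono[of "{x \<in> V. d x = n - 1}" "insert x D"] assms(1,8) by auto
        then show False using False finD D(2) by simp
      qed
      then show ?thesis using False assms(4)[of x] x by (auto simp: d'_def)
    qed
    have "sum d D = sum d' D + 2"
    proof -
      have "sum d D = (\<Sum>x\<in>D. d' x + 1)"
        using D5 by (intro sum.cong) (fastforce simp: d'_def)+
      then show ?thesis using D(2) sum.distrib[of d' "\<lambda>_. 1" D] by simp
    qed
    moreover have "sum d (?V - D) = sum d' (?V - D)"
      by (rule sum.cong) (auto simp: d'_def)
    moreover have "sum d' ?V = sum d' D + sum d' (?V - D)"
      using sum.subset_diff[OF D(1) fin(1), of d'] by simp
    ultimately show "sum d' ?V = 6 * (n - 1) - 4" using assms(3,5) sumV sumD by simp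
  qed
  have "S3_graphic (insert v ?V) d"
  proof -
    have "D \<noteq> ?V" using D(2) fin(2) assms(3) by auto
    moreover have "card D < d' x" if "x \<in> ?V - D" for x
      using that assms(4)[of x] D(2) by (auto simp: d'_def)
    moreover have "d x = d' x + (if x \<in> D then 1 else 0)" if "x \<in> ?V" for x
      using that D5[of x] by (auto simp: d'_def)
    ultimately show ?thesis
      using S3_graphic_subdivide[OF \<open>S3_graphic ?V d'\<close> fin(1), of v D d] D assms(7) by auto
  qed
  then show ?thesis using assms(6) by (simp add: insert_absorb)
qed

text \<open>Removing four vertices of degree 5 costs 20 and the target drops by 24, so exactly four
  units must be taken from the remaining degrees: these are the ends of the free edges. The work
  lies in placing them so that all degrees end between 4 and \<open>n - 5\<close>.\<close>

lemma tight_min5_step: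
  fixes V :: "'v set"
  assumes "finite V" "card V = n" "12 \<le> n" "\<And>x. x \<in> V \<Longrightarrow> 5 \<le> d x \<and> d x \<le> n - 1"
    and "sum d V = 6 * n - 4"
    and IH: "\<And>(W :: 'v set) d'. finite W \<Longrightarrow> card W = n - 4 \<Longrightarrow> (\<And>x. x \<in> W \<Longrightarrow> 4 \<le> d' x \<and> d' x \<le> n - 5) \<Longrightarrow>
      sum d' W = 6 * (n - 4) - 4 \<Longrightarrow> S3_graphic W d'"
  shows "S3_graphic V d"
proof -
  let ?F = "{x \<in> V. d x = 5}"
  \<comment> \<open>Measured against 6, only degree 5 falls short, by one each; the total is 4 below
    \<open>6 n\<close>, so there are at least four such vertices.\<close>
  have "6 * n \<le> sum d V + card ?F"
  proof -
    have "(\<Sum>x\<in>V. 6) \<le> (\<Sum>x\<in>V. d x + (if x \<in> ?F then 1 else 0))"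
      using assms(4) by (intro sum_mono) fastforce
    also have "\<dots> = sum d V + card ?F"
      using assms(1) by (simp add: sum.distrib sum.If_cases Int_def)
    finally show ?thesis using assms(2) by simp
  qed
  then have "4 \<le> card ?F" using assms(3,5) by simp
  then obtain U where U: "U \<subseteq> ?F" "card U = 4" by (meson obtain_subset_with_card_n)
  have finU: "finite U" using U(2) card.infinite by fastforce
  obtain us where us: "set us = U" "distinct us" using finU finite_distinct_list by blast
  then have "length us = 4" using U(2) distinct_card by fastforce
  then obtain u1 u2 u3 u4 where u: "us = [u1, u2, u3, u4]"
    by (auto simp: numeral_eq_Suc length_Suc_conv)
  define W where "W = V - U"
  have UV: "U \<subseteq> V" using U(1) by auto
  have W: "finite W" "card W = n - 4"
    using assms(1,2) UV U(2) finU by (auto simp: W_def card_Diff_subset)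
  have dU: "d x = 5" if "x \<in> U" for x using that U(1) by auto
  have dW: "5 \<le> d x \<and> d x \<le> n - 1" if "x \<in> W" for x using that assms(4) by (auto simp: W_def)
  have sumW: "sum d W = 6 * n - 24"
  proof -
    have "sum d V = sum d U + sum d W" using sum.subset_diff[OF UV assms(1), of d] by (simp add: W_def)
    moreover have "sum d U = 20" using dU U(2) by simp
    ultimately show ?thesis using assms(5) by simp
  qed
  \<comment> \<open>The least number of units that \<open>x\<close> must give up to fit into a graph
    on \<open>n - 4\<close> vertices; truncated subtraction makes it 0 when \<open>x\<close> already
    fits.\<close>
  define l where "l x = d x - (n - 5)" for x
  define P where "P = {x \<in> W. n - 5 < d x}"
  have finP: "finite P" "P \<subseteq> W" using W(1) by (auto simp: P_def)
  have excess: "(\<Sum>x\<in>W. d x - 5) = n - 4"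
  proof -
    have "sum d W = (\<Sum>x\<in>W. (d x - 5) + 5)" by (rule sum.cong) (use dW in force)+
    then show ?thesis using sumW W(2) assms(3) by (simp add: sum.distrib)
  qed
  have excessP: "(\<Sum>x\<in>P. d x - 5) \<le> n - 4"
    unfolding excess[symmetric] using W(1) finP by (intro sum_mono2) auto
  have lP: "(\<Sum>x\<in>P. d x - 5) = sum l P + card P * (n - 10)"
  proof -
    have "(\<Sum>x\<in>P. d x - 5) = (\<Sum>x\<in>P. l x + (n - 10))"
      using assms(3) by (intro sum.cong) (auto simp: P_def l_def)
    then show ?thesis by (simp add: sum.distrib)
  qed
  have "sum l W = sum l P"
    using W(1) by (intro sum.mono_neutral_right) (auto simp: P_def l_def)
  \<comment> \<open>The excess over 5 totals \<open>n - 4\<close>, and a vertex of \<open>P\<close>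
    uses \<open>n - 10\<close> of it beyond \<open>l x\<close>. One vertex needs at most 4, two
    together at most \<open>16 - n\<close>, and three do not fit: this is where \<open>n\<close> at
    least 12 enters.\<close>
  moreover have "sum l P \<le> 4"
  proof -
    have l4: "l x \<le> 4" if "x \<in> P" for x using that dW[of x] by (auto simp: P_def l_def)
    have l1: "1 \<le> l x" if "x \<in> P" for x using that by (auto simp: P_def l_def)
    have "card P \<le> sum l P" using sum_mono[of P "\<lambda>_. 1" l] l1 by simp
    have "sum l P \<le> card P * 4" using sum_bounded_above[of P l 4] l4 by simp
    show ?thesis
    proof (cases "card P \<le> 1")
      case True
      then have "card P * 4 \<le> 4" by simp
      then show ?thesis using \<open>sum l P \<le> card P * 4\<close> by linarith
    next
      case False
      show ?thesis
      proof (cases "card P = 2")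
        case True
        then show ?thesis using excessP lP assms(3) by simp
      next
        case False
        then have "3 \<le> card P" using \<open>\<not> card P \<le> 1\<close> by simp
        then have "3 * (n - 10) \<le> card P * (n - 10)" by (rule mult_right_mono) simp
        then show ?thesis using excessP lP assms(3) \<open>card P \<le> sum l P\<close> \<open>3 \<le> card P\<close> by linarith
      qed
    qed
  qed
  moreover have "4 \<le> (\<Sum>x\<in>W. d x - 4)"
  proof -
    have "card W \<le> (\<Sum>x\<in>W. d x - 4)"
      using sum_mono[of W "\<lambda>_. 1" "\<lambda>x. d x - 4"] dW by fastforce
    then show ?thesis using W(2) assms(3) by simp
  qed
  moreover have "l x \<le> d x - 4" for x using assms(3) by (simp add: l_def)
  ultimately obtain es where es: "length es = 4" "set es \<subseteq> W"
      "\<forall>x\<in>W. l x \<le> count_list es x \<and> count_list es x \<le> d x - 4"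
    using list_with_counts_between[OF W(1), of l 4 "\<lambda>x. d x - 4"] by auto
  then obtain e1 e2 e3 e4 where e: "es = [e1, e2, e3, e4]"
    by (auto simp: numeral_eq_Suc length_Suc_conv)
  define d' where "d' x = d x - count_list es x" for x
  have d': "4 \<le> d' x \<and> d' x \<le> n - 5 \<and> d x = d' x + count_list es x" if "x \<in> W" for x
    using es(3) dW[OF that] that by (auto simp: d'_def l_def)
  have "sum d W = (\<Sum>x\<in>W. d' x + count_list es x)"
    by (rule sum.cong) (use d' in auto)
  moreover have "(\<Sum>x\<in>W. count_list es x) = 4"
    using sum_count_set[OF es(2) W(1)] es(1) by simp
  ultimately have sum': "sum d' W = 6 * (n - 4) - 4" using sumW assms(3) by (simp add: sum.distrib)
  have "S3_graphic W d'" using IH[OF W] d' sum' by blast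
  have "S3_graphic (W \<union> {u1, u2, u3, u4}) d"
  proof -
    have UU: "{u1, u2, u3, u4} = U" using us u by simp
    have "distinct [u1, u2, u3, u4]" using us u by simp
    moreover have "W \<inter> {u1, u2, u3, u4} = {}" unfolding UU by (auto simp: W_def)
    moreover have eW: "{e1, e2, e3, e4} \<subseteq> W" using es(2) e by simp
    moreover have "2 * (d' z + 4) \<le> sum d' W" if "z \<in> {e1, e2, e3, e4}" for z
    proof -
      have "d' z \<le> n - 5" using d' eW that by blast
      then show ?thesis using sum' assms(3) by simp
    qed
    moreover have "d x = d' x + count_list [e1, e2, e3, e4] x" if "x \<in> W" for x
      using d'[OF that] e by simp
    ultimately show ?thesis
      using S3_graphic_add_cycle[OF \<open>S3_graphic W d'\<close> W(1), of u1 u2 u3 u4 e1 e2 e3 e4 d] dU UU by blast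
  qed
  moreover have "W \<union> {u1, u2, u3, u4} = V" using us u UV by (auto simp: W_def)
  ultimately show ?thesis by simp
qed

lemma S3_graphic_tight:
  assumes "finite V" "card V = n" "8 \<le> n" "\<And>x. x \<in> V \<Longrightarrow> 4 \<le> d x \<and> d x \<le> n - 1"
    and "sum d V = 6 * n - 4"
  shows "S3_graphic V d"
  using assms
proof (induction n arbitrary: V d rule: less_induct)
  case (less n)
  show ?case
  proof (cases "n = 8")
    case True
    then show ?thesis
      using S3_graphic_seqs[OF realizes_steps8 less.prems(1)] less.prems by simp
  next
    case False
    then have n9: "9 \<le> n" using less.prems by simp
    show ?thesis
    proof (cases "\<exists>v\<in>V. d v = 4")
      case True
      then obtain v where v: "v \<in> V" "d v = 4" by blast
      show ?thesis
      proof (cases "card {x \<in> V. d x = n - 1} \<le> 2")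
        case True
        show ?thesis
        proof (rule tight_min4_step[OF less.prems(1,2) n9 less.prems(4,5) v True])
          show "S3_graphic (V - {v}) d'" if "\<And>x. x \<in> V - {v} \<Longrightarrow> 4 \<le> d' x \<and> d' x \<le> n - 2"
            "sum d' (V - {v}) = 6 * (n - 1) - 4" for d'
            using less.IH[of "n - 1" "V - {v}" d'] that less.prems(1,2) v n9 by (simp add: numeral_2_eq_2)
        qed
      next
        case False
        then have "3 \<le> card {x \<in> V. d x = n - 1}" by simp
        then obtain T where T: "T \<subseteq> {x \<in> V. d x = n - 1}" "card T = 3"
          by (meson obtain_subset_with_card_n)
        have TV: "T \<subseteq> V" "finite T" using T less.prems(1) by (auto intro: finite_subset)
        have c: "card (V - T) = n - 3" using card_Diff_subset[OF TV(2,1)] T(2) less.prems(2) by simp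
        have "sum d T = 3 * (n - 1)"
        proof -
          have "sum d T = (\<Sum>x\<in>T. n - 1)" using T(1) by (intro sum.cong) auto
          then show ?thesis using T(2) by simp
        qed
        then have s: "sum d (V - T) = 3 * n - 1"
          using sum.subset_diff[OF TV(1) less.prems(1), of d] less.prems(5) n9 by simp
        \<comment> \<open>The other degrees sum to \<open>3 n - 1\<close> but are at least 4 each,
          so \<open>4 (n - 3)\<close> is at most \<open>3 n - 1\<close>: three hubs with a tight sum
          stop at \<open>n = 11\<close>.\<close>
        have "4 * card (V - T) \<le> sum d (V - T)"
          using sum_bounded_below[of "V - T" 4 d] less.prems(4) by (simp add: mult.commute)
        then have "n \<le> 11" using s c by simp
        then consider "n = 9" | "n = 10" | "n = 11" using n9 by linarith
        then show ?thesis
        proof cases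
          case 1
          show ?thesis
            by (rule S3_graphic_hub_seqs[OF realizes_hub_steps9 less.prems(1) TV(1) T(2)])
              (use T c s less.prems(4) 1 in auto)
        next
          case 2
          show ?thesis
            by (rule S3_graphic_hub_seqs[OF realizes_hub_steps10 less.prems(1) TV(1) T(2)])
              (use T c s less.prems(4) 2 in auto)
        next
          case 3
          show ?thesis
            by (rule S3_graphic_hub_seqs[OF realizes_hub_steps11 less.prems(1) TV(1) T(2)])
              (use T c s less.prems(4) 3 in auto)
        qed
      qed
    next
      case False
      then have d5: "5 \<le> d x \<and> d x \<le> n - 1" if "x \<in> V" for x
        using less.prems(4)[OF that] that by (metis Suc_leI eval_nat_numeral(3) le_neq_implies_less)
      show ?thesis
      proof (cases "12 \<le> n")
        case True
        show ?thesis
        proof (rule tight_min5_step[OF less.prems(1,2) True d5 less.prems(5)])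
          show "S3_graphic W d'" if "finite W" "card W = n - 4" "\<And>x. x \<in> W \<Longrightarrow> 4 \<le> d' x \<and> d' x \<le> n - 5"
            "sum d' W = 6 * (n - 4) - 4" for W :: "'a set" and d'
            by (rule less.IH[of "n - 4"]) (use that True in auto)
        qed
      next
        case False
        \<comment> \<open>Removing four vertices here would leave fewer than eight, below the range
          of the induction.\<close>
        then consider "n = 9" | "n = 10" | "n = 11" using n9 by linarith
        then show ?thesis
        proof cases
          case 1
          show ?thesis
            by (rule S3_graphic_seqs[OF realizes_steps9 less.prems(1)]) (use less.prems d5 1 in auto)
        next
          case 2
          show ?thesis
            by (rule S3_graphic_seqs[OF realizes_steps10 less.prems(1)]) (use less.prems d5 2 in auto)
        next
          case 3
          show ?thesis
            by (rule S3_graphic_seqs[OF realizes_steps11 less.prems(1)]) (use less.prems d5 3 in auto)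
        qed
      qed
    qed
  qed
qed

subsection \<open>Arbitrary graphic degree functions\<close>

definition graphic_on :: "'v set \<Rightarrow> ('v \<Rightarrow> nat) \<Rightarrow> bool" where
  "graphic_on V d \<longleftrightarrow> (\<exists>F. simple_on V F \<and> (\<forall>v\<in>V. dg F v = d v))"

section \<open>Neighbourhoods and edge switches\<close>

definition nbs :: "'v set set \<Rightarrow> 'v \<Rightarrow> 'v set" where
  "nbs F v = {x. {x, v} \<in> F}"

lemma nbs_sym: "x \<in> nbs F y \<longleftrightarrow> y \<in> nbs F x"
  by (simp add: nbs_def insert_commute)

lemma nbs_subset: "simple_on V F \<Longrightarrow> nbs F v \<subseteq> V - {v}"
  by (force simp: nbs_def simple_on_def)

lemma edges_at:
  assumes "simple_on V F"
  shows "{e \<in> F. v \<in> e} = star v (nbs F v)"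
proof (intro equalityI subsetI)
  fix e assume e: "e \<in> {e \<in> F. v \<in> e}"
  then have "card e = 2" using assms by (auto simp: simple_on_def)
  then obtain x y where xy: "e = {x, y}" "x \<noteq> y" by (auto simp: card_2_iff)
  then show "e \<in> star v (nbs F v)" using e by (auto simp: star_def nbs_def insert_commute)
qed (auto simp: star_def nbs_def)

lemma card_nbs:
  assumes "simple_on V F" "finite V"
  shows "finite (nbs F v)" "card (nbs F v) = dg F v"
proof -
  show fin: "finite (nbs F v)" using nbs_subset[OF assms(1)] assms(2) by (meson finite_Diff finite_subset)
  have "v \<notin> nbs F v" using nbs_subset[OF assms(1)] by auto
  then show "card (nbs F v) = dg F v"
    using star_props(2)[OF fin] by (simp add: dg_def edges_at[OF assms(1)])
qed

lemma simple_on_delete: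
  assumes "simple_on V F" "finite V"
  shows "simple_on (V - {v}) {e \<in> F. v \<notin> e}"
    "x \<noteq> v \<Longrightarrow> dg F x = dg {e \<in> F. v \<notin> e} x + (if x \<in> nbs F v then 1 else 0)"
proof -
  show "simple_on (V - {v}) {e \<in> F. v \<notin> e}" using assms(1) by (auto simp: simple_on_def)
  assume x: "x \<noteq> v"
  have fin: "finite (nbs F v)" and v: "v \<notin> nbs F v"
    using card_nbs[OF assms] nbs_subset[OF assms(1)] by auto
  have "F = {e \<in> F. v \<notin> e} \<union> {e \<in> F. v \<in> e}" by auto
  then have F: "F = {e \<in> F. v \<notin> e} \<union> star v (nbs F v)" by (simp only: edges_at[OF assms(1)])
  have "dg ({e \<in> F. v \<notin> e} \<union> star v (nbs F v)) x = dg {e \<in> F. v \<notin> e} x + dg (star v (nbs F v)) x"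
    using simple_on_finite[OF assms] star_props(1)[OF fin v] by (intro dg_Un) (auto simp: star_def)
  then show "dg F x = dg {e \<in> F. v \<notin> e} x + (if x \<in> nbs F v then 1 else 0)"
    using F star_props(5)[OF fin v x] by simp
qed

text \<open>As \<open>w\<close> has the larger degree, it has a neighbour \<open>z\<close> not
  adjacent to \<open>x\<close>. Replacing the edges \<open>{z, w}\<close> and \<open>{x, v}\<close>
  by \<open>{z, x}\<close> and \<open>{w, v}\<close> preserves all degrees and exchanges
  \<open>x\<close> for \<open>w\<close> at \<open>v\<close>.\<close>

lemma switch:
  assumes F: "simple_on V F" "finite V" and x: "x \<in> nbs F v" and w: "w \<in> V" "w \<notin> nbs F v" "w \<noteq> v"
    and deg: "dg F x < dg F w"
  shows "\<exists>F'. simple_on V F' \<and> (\<forall>u. dg F' u = dg F u) \<and> nbs F' v = insert w (nbs F v - {x})"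
proof -
  note sub = nbs_subset[OF F(1)] and fin = card_nbs[OF F]
  have xw: "x \<noteq> w" using deg by auto
  \<comment> \<open>If \<open>x\<close> and \<open>w\<close> are adjacent, each occurs in the
    neighbourhood of the other; dropping both keeps the strict inequality and makes the resulting
    \<open>z\<close> different from \<open>x\<close>.\<close>
  have "card (nbs F x - {w}) < card (nbs F w - {x})"
  proof (cases "w \<in> nbs F x")
    case True
    then show ?thesis using deg fin nbs_sym[of w F x] card_gt_0_iff[of "nbs F x"]
      by (auto simp: card_Diff_singleton_if)
  next
    case False
    then show ?thesis using deg fin nbs_sym[of w F x] by (auto simp: card_Diff_singleton_if)
  qed
  then have "\<not> nbs F w - {x} \<subseteq> nbs F x - {w}"
    using fin(1) by (meson card_mono finite_Diff not_le)
  then obtain z where z: "z \<in> nbs F w" "z \<noteq> x" "z \<notin> nbs F x \<or> z = w" by auto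
  then have zw: "z \<noteq> w" "z \<notin> nbs F x" "z \<in> V" using sub[of w] by auto
  have zv: "z \<noteq> v" using z(1) w(2) nbs_sym[of v F w] by auto
  have xv: "x \<noteq> v" "x \<in> V" "v \<in> V" using x sub[of v] sub[of x] nbs_sym[of x F v] by auto
  define F1 where "F1 = F - {{z, w}} - {{x, v}}"
  define F2 where "F2 = insert {w, v} (insert {z, x} F1)"
  have finF: "finite F" using simple_on_finite[OF F] .
  have in1: "{z, w} \<in> F" "{x, v} \<in> F - {{z, w}}"
    using z(1) x zv xv zw xw w(3) by (auto simp: nbs_def doubleton_eq_iff)
  have notin: "{z, x} \<notin> F1" "{w, v} \<notin> insert {z, x} F1"
    using zw w xv xw z(2) zv by (auto simp: nbs_def F1_def doubleton_eq_iff)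
  have deg2: "dg F2 u = dg F u" for u
  proof -
    have "dg F u = dg F1 u + (if u \<in> {x, v} then 1 else 0) + (if u \<in> {z, w} then 1 else 0)"
      unfolding F1_def using dg_remove[OF finF in1(1), of u] dg_remove[OF _ in1(2), of u] finF by simp
    moreover have "dg F2 u = dg F1 u + (if u \<in> {z, x} then 1 else 0) + (if u \<in> {w, v} then 1 else 0)"
      unfolding F2_def using dg_insert[OF _ notin(1), of u] dg_insert[OF _ notin(2), of u] finF by (simp add: F1_def)
    ultimately show ?thesis using xw zw(1) zv xv(1) w(3) z(2) by auto
  qed
  have "simple_on V F2"
    using simple_on_mono[OF F(1), of V F1] zw w xv z(2)
    by (auto simp: F2_def F1_def simple_on_def card_insert_if)
  moreover have "nbs F2 v = insert w (nbs F v - {x})"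
    using xw zw(1) zv xv(1) w(3) z(2) by (auto simp: nbs_def F2_def F1_def doubleton_eq_iff)
  ultimately show ?thesis using deg2 by blast
qed

text \<open>Take a realization maximizing the number of neighbours of \<open>v\<close> in
  \<open>B\<close>. A neighbour of degree 4 would leave some vertex of \<open>B\<close> non-adjacent
  to \<open>v\<close>, and a switch would increase the count. Afterwards deleting \<open>v\<close>
  leaves minimum degree 4.\<close>

lemma realization_with_large_neighbours:
  assumes "graphic_on V d" "finite V" "v \<in> V" "d v = 4" "4 \<le> card {x \<in> V. 5 \<le> d x}"
    and "\<And>x. x \<in> V \<Longrightarrow> 4 \<le> d x"
  shows "\<exists>F. simple_on V F \<and> (\<forall>x\<in>V. dg F x = d x) \<and> (\<forall>x\<in>nbs F v. 5 \<le> d x)"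
proof -
  define B where "B = {x \<in> V. 5 \<le> d x}"
  let ?P = "\<lambda>F. simple_on V F \<and> (\<forall>x\<in>V. dg F x = d x)"
  obtain F0 where "?P F0" using assms(1) by (auto simp: graphic_on_def)
  moreover have "\<forall>F. ?P F \<longrightarrow> card (nbs F v \<inter> B) < Suc (card B)"
    using assms(2) by (auto simp: B_def intro!: card_mono le_imp_less_Suc)
  ultimately obtain F where F: "?P F" and max: "\<forall>F'. ?P F' \<longrightarrow> card (nbs F' v \<inter> B) \<le> card (nbs F v \<inter> B)"
    using ex_has_greatest_nat[of ?P F0 "\<lambda>F. card (nbs F v \<inter> B)" "Suc (card B)"] by blast
  have sF: "simple_on V F" using F by simp
  note sub = nbs_subset[OF sF] and fin = card_nbs[OF sF assms(2)]
  have "nbs F v \<subseteq> B"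
  proof (rule ccontr)
    assume "\<not> nbs F v \<subseteq> B"
    then obtain x where x: "x \<in> nbs F v" "x \<notin> B" by blast
    have xV: "x \<in> V" using x sub by auto
    then have dx: "d x = 4" using x(2) assms(6)[of x] by (auto simp: B_def)
    have "card (nbs F v) = 4" using fin F assms(3,4) by auto
    then have "card (nbs F v \<inter> B) < 4"
      using x fin(1) by (metis psubset_card_mono Int_iff Int_lower1 psubsetI)
    then have "\<not> B \<subseteq> nbs F v" using assms(5) by (auto simp: B_def[symmetric] Int_absorb1)
    then obtain w where w: "w \<in> B" "w \<notin> nbs F v" by blast
    have "w \<noteq> v" "w \<in> V" using w assms(4) by (auto simp: B_def)
    moreover have "dg F x < dg F w" using F xV dx w(1) by (auto simp: B_def)
    ultimately obtain F' where F': "simple_on V F'" "\<forall>u. dg F' u = dg F u"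
        "nbs F' v = insert w (nbs F v - {x})"
      using switch[OF sF assms(2) x(1), of w] w(2) by blast
    then have "?P F'" using F by simp
    moreover have "nbs F' v \<inter> B = insert w (nbs F v \<inter> B)" using F'(3) w(1) x(2) by auto
    then have "card (nbs F' v \<inter> B) = Suc (card (nbs F v \<inter> B))"
      using w(2) fin(1) by simp
    ultimately show False using max by fastforce
  qed
  then show ?thesis using F by (auto simp: B_def)
qed

text \<open>Here deleting a vertex of degree \<open>4\<close> could lower the degree of another one to \<open>3\<close>, so two vertices
  adjacent to each other and to all hubs are removed at once.\<close>

lemma S3_graphic_three_hubs:
  assumes "finite V" "card V = n" "H \<subseteq> V" "card H = 3"
    and "\<And>x. x \<in> H \<Longrightarrow> d x \<le> n - 1" "\<And>x. x \<in> V - H \<Longrightarrow> d x = 4"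
    and "6 * n - 4 \<le> sum d V" "even (sum d V)"
  shows "S3_graphic V d"
  using assms
proof (induction n arbitrary: V d rule: less_induct)
  case (less n)
  have finH: "finite H" using less.prems(1,3) finite_subset by blast
  have n3: "3 \<le> n" using card_mono[OF less.prems(1,3)] less.prems(2,4) by simp
  have cH: "card (V - H) = n - 3" using card_Diff_subset[OF finH less.prems(3)] less.prems(2,4) by simp
  have sums: "sum d V = sum d H + 4 * (n - 3)"
    using sum.subset_diff[OF less.prems(3,1), of d] less.prems(6) cH by simp
  have big: "2 * n + 8 \<le> sum d H" using sums less.prems(7) n3 by simp
  \<comment> \<open>The hubs sum to at least \<open>2 n + 8\<close>, of which the other two supply
    at most \<open>2 (n - 1)\<close>.\<close>
  have hub: "10 \<le> d h" if h: "h \<in> H" for h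
  proof -
    have "sum d (H - {h}) \<le> card (H - {h}) * (n - 1)"
      using sum_bounded_above[of "H - {h}" d "n - 1"] less.prems(5) by auto
    moreover have "card (H - {h}) = 2" using h less.prems(4) finH by simp
    moreover have "sum d H = d h + sum d (H - {h})" using h finH by (simp add: sum.remove)
    ultimately show ?thesis using big n3 by simp
  qed
  obtain h where h: "h \<in> H" using less.prems(4) by (metis card.empty ex_in_conv zero_neq_numeral)
  have n11: "11 \<le> n" using hub[OF h] less.prems(5)[OF h] by simp
  show ?case
  proof (cases "sum d V = 6 * n - 4")
    case True
    show ?thesis
    proof (rule S3_graphic_tight[OF less.prems(1,2) _ _ True])
      show "4 \<le> d x \<and> d x \<le> n - 1" if "x \<in> V" for x
        using that hub[of x] less.prems(5)[of x] less.prems(6)[of x] n11 by (cases "x \<in> H") auto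
    qed (use n11 in simp)
  next
    case False
    \<comment> \<open>Parity excludes \<open>6 n - 3\<close>. Removing the pair lowers the sum by
      \<open>8 + 6 = 14\<close> and the bound by only 12, so precisely this slack of 2 is
      required.\<close>
    then have s: "6 * n - 2 \<le> sum d V" using less.prems(7,8) n11
      by (cases "sum d V = 6 * n - 3") (auto simp: even_diff_nat)
    have "2 \<le> card (V - H)" using cH n11 by simp
    then obtain P where P: "P \<subseteq> V - H" "card P = 2" by (meson obtain_subset_with_card_n)
    then obtain x y where xy: "P = {x, y}" "x \<noteq> y" by (auto simp: card_2_iff)
    let ?V = "V - {x, y}"
    have fin: "finite ?V" "card ?V = n - 2" using less.prems(1,2) P xy by auto
    define d' where "d' w = (if w \<in> H then d w - 2 else d w)" for w
    have HV: "H \<subseteq> ?V" using less.prems(3) P xy by auto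
    have "card (?V - H) = n - 5" using card_Diff_subset[OF finH HV] fin(2) less.prems(4) by simp
    moreover have "sum d H = sum d' H + 6"
    proof -
      have "sum d H = (\<Sum>w\<in>H. d' w + 2)" by (rule sum.cong) (use hub in \<open>force simp: d'_def\<close>)+
      then show ?thesis using less.prems(4) sum.distrib[of d' "\<lambda>_. 2" H] by simp
    qed
    moreover have "sum d' ?V = sum d' (?V - H) + sum d' H"
      using sum.subset_diff[OF HV fin(1), of d'] .
    moreover have "sum d' (?V - H) = 4 * card (?V - H)"
      using less.prems(6) by (simp add: d'_def)
    ultimately have s': "sum d V = sum d' ?V + 14" using sums n11 by simp
    have "S3_graphic ?V d'"
    proof (rule less.IH[of "n - 2", OF _ fin HV less.prems(4)])
      show "even (sum d' ?V)" using s' less.prems(8) by simp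
      show "d' w \<le> n - 2 - 1" if "w \<in> H" for w
        using that less.prems(5)[OF that] by (simp add: d'_def)
    qed (use s s' n11 less.prems(6) in \<open>auto simp: d'_def\<close>)
    obtain h1 h2 h3 where H: "H = {h1, h2, h3}" "distinct [h1, h2, h3]"
      using less.prems(4) by (auto simp: card_3_iff)
    have dd: "d w = d' w + (if w \<in> {h1, h2, h3} then 2 else 0)" for w
      using hub[of w] H(1) by (auto simp: d'_def)
    have xyV: "x \<in> V" "y \<in> V" "d x = 4" "d y = 4" using P xy less.prems(6) by auto
    have "S3_graphic (insert x (insert y ?V)) d"
      by (rule S3_graphic_add_pair[OF \<open>S3_graphic ?V d'\<close> fin(1) H(2) _ xy(2) _ _ xyV(3,4) dd])
        (use HV H(1) in auto)
    moreover have "insert x (insert y ?V) = V" using P xy by auto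
    ultimately show ?thesis by simp
  qed
qed

section \<open>Seven vertices, nearly tight sums and the general induction\<close>

lemma graphic_on_bound:
  assumes "graphic_on V d" "finite V" "v \<in> V"
  shows "d v \<le> card V - 1" "even (sum d V)"
proof -
  obtain F where F: "simple_on V F" "\<forall>v\<in>V. dg F v = d v" using assms(1) by (auto simp: graphic_on_def)
  have "card (nbs F v) \<le> card (V - {v})"
    using nbs_subset[OF F(1), of v] assms(2) by (intro card_mono) auto
  then show "d v \<le> card V - 1" using card_nbs(2)[OF F(1) assms(2)] F(2) assms(2,3) by simp
  show "even (sum d V)" using handshake[OF F(1) assms(2)] F(2) by simp
qed

text \<open>Around a vertex of degree 4, the two non-neighbours have degree at most 5, so the sum is
  at most \<open>4 + 24 + 10 = 38\<close>. Hence degree 4 occurs only in the tight case, and the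
  larger sums need tables with minimum 5 only.\<close>

lemma S3_graphic_seven:
  assumes "graphic_on V d" "finite V" "card V = 7" "\<And>x. x \<in> V \<Longrightarrow> 4 \<le> d x" "38 \<le> sum d V"
  shows "S3_graphic V d"
proof -
  have up: "d x \<le> 6" if "x \<in> V" for x using graphic_on_bound(1)[OF assms(1,2) that] assms(3) by simp
  have "V \<noteq> {}" using assms(3) by auto
  then have ev: "even (sum d V)" using graphic_on_bound(2)[OF assms(1,2)] by blast
  have "sum d V \<le> 42" using sum_bounded_above[of V d 6] up assms(3) by simp
  moreover have "s = 38 \<or> s = 40 \<or> s = 42" if "even s" "38 \<le> s" "s \<le> 42" for s :: nat
    using that by presburger
  ultimately consider "sum d V = 38" | "sum d V = 40" | "sum d V = 42"
    using assms(5) ev by blast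
  note sum_cases = this
  show ?thesis
  proof (cases "\<exists>v\<in>V. d v = 4")
    case False
    then have b: "5 \<le> d x \<and> d x \<le> 6" if "x \<in> V" for x
      using that up assms(4)[OF that] by (cases "d x = 4") auto
    show ?thesis using sum_cases
    proof cases
      case 1 then show ?thesis using S3_graphic_seqs[OF realizes_steps7_38 assms(2,3)] b by blast
    next
      case 2 then show ?thesis using S3_graphic_seqs[OF realizes_steps7_40 assms(2,3)] b by blast
    next
      case 3 then show ?thesis using S3_graphic_seqs[OF realizes_steps7_42 assms(2,3)] b by blast
    qed
  next
    case True
    then obtain v where v: "v \<in> V" "d v = 4" by blast
    obtain F where F: "simple_on V F" "\<forall>v\<in>V. dg F v = d v" using assms(1) by (auto simp: graphic_on_def)
    note fin = card_nbs[OF F(1) assms(2)]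
    define N where "N = nbs F v"
    have N: "N \<subseteq> V - {v}" "card N = 4" "finite N" using nbs_subset[OF F(1)] fin F(2) v by (auto simp: N_def)
    define R where "R = V - {v} - N"
    have R: "card R = 2" "finite R" using N v assms(2,3) by (auto simp: R_def card_Diff_subset)
    have R5: "d x \<le> 5" if "x \<in> R" for x
    proof -
      have "v \<notin> nbs F x" using that nbs_sym[of x F v] by (auto simp: R_def N_def)
      then have "nbs F x \<subseteq> V - {x} - {v}" using nbs_subset[OF F(1), of x] by auto
      then have "card (nbs F x) \<le> card (V - {x} - {v})" using assms(2) by (intro card_mono) auto
      moreover have "card (V - {x} - {v}) = 5" using that v assms(2,3) by (auto simp: R_def)
      ultimately show ?thesis using fin(2) F(2) that by (auto simp: R_def)
    qed
    have "sum d V = 4 + (sum d N + sum d R)"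
      using v assms(2) N sum.subset_diff[of N "V - {v}" d] by (simp add: sum.remove R_def)
    moreover have "sum d N \<le> 24" using sum_bounded_above[of N d 6] up N by fastforce
    moreover have "sum d R \<le> 10" using sum_bounded_above[of R d 5] R5 R by fastforce
    ultimately have s: "sum d V = 38" using assms(5) by simp
    obtain ds where ds: "mset ds = image_mset d (mset_set V)" "sorted_wrt (\<ge>) ds" "length ds = card V"
      "sum_list ds = sum d V" "set ds = d ` V"
      using sorted_degrees[OF assms(2)] .
    have "ds \<in> set (seqs (length ds) 6 4 (sum_list ds))"
      using assms(4) up ds(5) by (intro seqs_complete ds(2)) auto
    then have "ds \<in> set (seqs 7 6 4 38)" using ds(3,4) s assms(3) by simp
    moreover have "4 \<in> set ds" using ds(5) v by force
    ultimately consider "ds = [6, 6, 6, 6, 6, 4, 4]" | "ds = [6, 6, 6, 6, 5, 5, 4]"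
      unfolding seqs_7_38 by auto
    then show ?thesis
    proof cases
      case 1
      \<comment> \<open>All five vertices of degree 6 would have to be neighbours of
        \<open>v\<close>, which has only four.\<close>
      have "count (image_mset d (mset_set V)) 6 = card {x \<in> V. d x = 6}"
        using assms(2) by (simp add: count_image_mset' filter_mset_mset_set conj_commute eq_commute)
      moreover have "count (mset ds) 6 = 5" using 1 by simp
      ultimately have "card {x \<in> V. d x = 6} = 5" using ds(1) by metis
      moreover have "{x \<in> V. d x = 6} \<subseteq> N" using R5 v by (fastforce simp: R_def)
      ultimately show ?thesis using card_mono[OF N(3), of "{x \<in> V. d x = 6}"] N(2) by simp
    next
      case 2
      then show ?thesis
        using S3_graphic_table[OF realizes_steps7_38_min4 _ assms(2)] ds(1) by simp
    qed
  qed
qed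

text \<open>Plain deletion of \<open>v\<close> would leave a sum 2 below the bound. Giving one edge
  back, that is, letting \<open>v\<close> subdivide an edge and have only \<open>k - 2\<close>
  further neighbours, makes the remainder exactly tight. For \<open>k = 6\<close> the sum is
  \<open>6 n\<close>, so all degrees equal 6.\<close>

lemma S3_graphic_near_tight:
  assumes "finite V" "card V = n" "8 \<le> n" "k = 5 \<or> k = 6"
    and "\<And>x. x \<in> V \<Longrightarrow> k \<le> d x \<and> d x \<le> n - 1" "v \<in> V" "d v = k"
    and "sum d V = 6 * n + 2 * k - 12"
  shows "S3_graphic V d"
proof -
  let ?V = "V - {v}"
  have fin: "finite ?V" "card ?V = n - 1" using assms(1,2,6) by auto
  then have "k - 2 \<le> card ?V" using assms(3,4) by auto
  from top_subset[OF fin(1) this, of d]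
  obtain D where D: "D \<subseteq> ?V" "card D = k - 2" "\<forall>x\<in>D. \<forall>y\<in>?V - D. d y \<le> d x"
    by blast
  have finD: "finite D" using D(1) fin(1) finite_subset by blast
  have sumV: "sum d V = k + sum d ?V" using assms(1,6,7) by (simp add: sum.remove)
  have cR: "card (?V - D) = n + 1 - k"
    using card_Diff_subset[OF finD D(1)] fin(2) D(2) assms(3,4) by auto
  have sumD: "sum d ?V = sum d D + sum d (?V - D)"
    using sum.subset_diff[OF D(1) fin(1), of d] by simp
  have six: "d x = 6" if "k = 6" "x \<in> V" for x
  proof (rule ccontr)
    assume "d x \<noteq> 6"
    then have "7 \<le> d x" using assms(5)[OF that(2)] that(1) by simp
    moreover have "sum d V = d x + sum d (V - {x})" using assms(1) that(2) by (simp add: sum.remove)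
    moreover have "6 * card (V - {x}) \<le> sum d (V - {x})"
      using sum_bounded_below[of "V - {x}" 6 d] assms(5) that(1) by (simp add: mult.commute)
    moreover have "card (V - {x}) = n - 1" using assms(1,2) that(2) by simp
    ultimately show False using assms(3,8) that(1) by simp
  qed
  define d' where "d' x = d x - (if x \<in> D then 1 else 0)" for x
  have dd: "d x = d' x + (if x \<in> D then 1 else 0)" if "x \<in> V" for x
    using assms(4) assms(5)[OF that] by (auto simp: d'_def)
  have up: "d' x \<le> n - 2" if x: "x \<in> ?V" for x
  proof (cases "x \<in> D")
    case True
    then show ?thesis using assms(5)[of x] x by (auto simp: d'_def)
  next
    case False
    have "d x \<noteq> n - 1"
    proof
      assume *: "d x = n - 1"
      show False
      proof (cases "k = 6")
        case True
        then show False using six[of x] x * assms(3) by auto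
      next
        case False
        then have k: "k = 5" using assms(4) by simp
        \<comment> \<open>A vertex of degree \<open>n - 1\<close> outside \<open>D\<close> would
          force three more inside; the sum would be at least
          \<open>5 + 4 (n - 1) + 5 (n - 5) = 9 n - 24\<close>, more than \<open>6 n - 2\<close> for
          \<open>n\<close> at least 8.\<close>
        have top: "n - 1 \<le> d i" if "i \<in> D" for i
          using D(3) that * x \<open>x \<notin> D\<close> by (metis DiffI)
        have "3 * (n - 1) \<le> sum d D"
          using sum_bounded_below[of D "n - 1" d] top D(2) k by simp
        moreover have "sum d (?V - D) = d x + sum d (?V - D - {x})"
          using x \<open>x \<notin> D\<close> fin(1) by (simp add: sum.remove)
        moreover have "5 * card (?V - D - {x}) \<le> sum d (?V - D - {x})"
          using sum_bounded_below[of "?V - D - {x}" 5 d] assms(5) k by (simp add: mult.commute)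
        moreover have "card (?V - D - {x}) = n - 5" using x \<open>x \<notin> D\<close> fin(1) cR k by simp
        ultimately have "5 + 3 * (n - 1) + (n - 1) + 5 * (n - 5) \<le> 6 * n - 2"
          using sumV sumD * k assms(8) by linarith
        then show False using assms(3) by simp
      qed
    qed
    then show ?thesis using False assms(5)[of x] x by (auto simp: d'_def)
  qed
  have "sum d ?V = (\<Sum>x\<in>?V. d' x + (if x \<in> D then 1 else 0))"
    by (rule sum.cong) (use dd in auto)
  also have "\<dots> = sum d' ?V + card D"
    using D(1) fin(1) by (simp add: sum.distrib sum.If_cases Int_absorb1)
  finally have sum': "sum d' ?V = 6 * (n - 1) - 4"
    using sumV assms(3,4,8) D(2) by auto
  have "S3_graphic ?V d'"
  proof (cases "n = 8")
    case True
    have "5 \<le> d' x \<and> d' x \<le> 6" if x: "x \<in> ?V" for x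
    proof -
      \<comment> \<open>The seven-vertex table used below requires minimum 5. A vertex of degree 5
        in \<open>D\<close> bounds all degrees outside by 5, so the sum is at most
        \<open>5 + 5 + 14 + 20 = 44\<close> instead of 46.\<close>
      have "6 \<le> d x" if "x \<in> D"
      proof (rule ccontr)
        assume "\<not> 6 \<le> d x"
        then have k: "k = 5" and dx: "d x = 5" using assms(4) assms(5)[of x] x by auto
        have "sum d D = d x + sum d (D - {x})" using finD \<open>x \<in> D\<close> by (simp add: sum.remove)
        moreover have "sum d (D - {x}) \<le> card (D - {x}) * 7"
          using sum_bounded_above[of "D - {x}" d 7] assms(5) D(1) True by auto
        moreover have "card (D - {x}) = 2" using D(2) finD k \<open>x \<in> D\<close> by simp
        moreover have "sum d (?V - D) \<le> card (?V - D) * 5"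
          using sum_bounded_above[of "?V - D" d 5] D(3) \<open>x \<in> D\<close> dx by auto
        ultimately show False using sumV sumD cR k dx True assms(8) by simp
      qed
      then show ?thesis using up[OF x] assms(4) assms(5)[of x] x True by (auto simp: d'_def)
    qed
    then show ?thesis
      using S3_graphic_seqs[OF realizes_steps7_38 fin(1)] fin(2) sum' True by simp
  next
    case False
    show ?thesis
    proof (rule S3_graphic_tight[OF fin _ _ sum'])
      show "4 \<le> d' x \<and> d' x \<le> n - 1 - 1" if "x \<in> ?V" for x
        using up[OF that] assms(4) assms(5)[of x] that by (auto simp: d'_def)
    qed (use False assms(3) in simp)
  qed
  moreover have "D \<noteq> ?V" using D(2) fin(2) assms(3,4) by auto
  then have "D \<subset> ?V" using D(1) by blast
  moreover have "card D < d' x" if "x \<in> ?V - D" for x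
    using that assms(4) assms(5)[of x] D(2) by (auto simp: d'_def)
  ultimately have "S3_graphic (insert v ?V) d"
    using S3_graphic_subdivide[OF _ fin(1), of d' v D d] D(2) assms(4,7) dd by auto
  then show ?thesis using assms(6) by (simp add: insert_absorb)
qed

lemma S3_graphic_graphic_on:
  assumes "finite V" "V \<noteq> {}" "graphic_on V d" "\<And>x. x \<in> V \<Longrightarrow> 4 \<le> d x" "6 * card V \<le> sum d V + 4"
  shows "S3_graphic V d"
  using assms
proof (induction "card V" arbitrary: V d rule: less_induct)
  case less
  define n where "n = card V"
  have up: "d x \<le> n - 1" if "x \<in> V" for x
    using graphic_on_bound(1)[OF less.prems(3,1) that] by (simp add: n_def)
  have ev: "even (sum d V)" using less.prems(2) graphic_on_bound(2)[OF less.prems(3,1)] by blast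
  \<comment> \<open>A simple graph on 5 or 6 vertices has degree sum at most 20 or 30, short of the
    required 26 or 32.\<close>
  have n7: "7 \<le> n"
  proof -
    obtain x where x: "x \<in> V" using less.prems(2) by blast
    have "5 \<le> n" using less.prems(4)[OF x] up[OF x] by simp
    moreover have "sum d V \<le> n * (n - 1)" using sum_bounded_above[of V d "n - 1"] up by (simp add: n_def)
    then have "6 * n \<le> n * (n - 1) + 4" using less.prems(5) by (simp add: n_def)
    then have "n \<noteq> 5" "n \<noteq> 6" by auto
    ultimately show ?thesis by simp
  qed
  consider "n = 7" | "8 \<le> n" "sum d V = 6 * n - 4" | "8 \<le> n" "6 * n - 2 \<le> sum d V"
  proof -
    have "s = 6 * n - 4 \<or> 6 * n - 2 \<le> s" if "even s" "6 * n \<le> s + 4" for s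
      using that n7 by presburger
    then show ?thesis using that ev less.prems(5) n7 unfolding n_def[symmetric] by fastforce
  qed
  then show ?case
  proof cases
    case 1
    then show ?thesis using S3_graphic_seven[OF less.prems(3,1) _ less.prems(4)] less.prems(5) by (simp add: n_def)
  next
    case 2
    show ?thesis
      by (rule S3_graphic_tight[OF less.prems(1) n_def[symmetric] 2(1) _ 2(2)]) (use less.prems(4) up in blast)
  next
    case 3
    obtain v where v: "v \<in> V" "\<forall>x\<in>V. d v \<le> d x"
      using less.prems(1,2) by (metis arg_min_if_finite(1) arg_min_least)
    define k where "k = d v"
    have cV: "card (V - {v}) = n - 1" using v(1) less.prems(1) by (simp add: n_def)
    \<comment> \<open>Deleting \<open>v\<close> lowers the sum by \<open>2 k\<close> and the bound
      by 6, which is the condition \<open>s\<close>; neighbours of degree at least 5 keep the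
      minimum at 4.\<close>
    have delete: "S3_graphic V d" if F: "simple_on V F" "\<forall>x\<in>V. dg F x = d x"
      and N: "\<forall>x\<in>nbs F v. 5 \<le> d x" and s: "6 * n + 2 * k \<le> sum d V + 10" for F
    proof -
      let ?V = "V - {v}" and ?F = "{e \<in> F. v \<notin> e}"
      note fin = card_nbs[OF F(1) less.prems(1)] and del = simple_on_delete[OF F(1) less.prems(1)]
      have cN: "card (nbs F v) = k" using fin(2) F(2) v(1) by (simp add: k_def)
      have sub: "nbs F v \<subseteq> ?V" using nbs_subset[OF F(1)] .
      have dd: "d x = dg ?F x + (if x \<in> nbs F v then 1 else 0)" if "x \<in> ?V" for x
        using del(2)[of x v] that F(2) by auto
      have "sum d ?V = (\<Sum>x\<in>?V. dg ?F x + (if x \<in> nbs F v then 1 else 0))"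
        by (rule sum.cong) (use dd in auto)
      also have "\<dots> = sum (dg ?F) ?V + k"
        using sub less.prems(1) cN by (simp add: sum.distrib sum.If_cases Int_absorb1)
      finally have "sum d V = sum (dg ?F) ?V + 2 * k"
        using v(1) less.prems(1) by (simp add: sum.remove k_def)
      then have s': "6 * card ?V \<le> sum (dg ?F) ?V + 4" using s cV n7 by simp
      have "S3_graphic ?V (dg ?F)"
      proof (rule less.hyps[OF _ _ _ _ _ s'])
        show "card ?V < card V" using cV n7 by (simp add: n_def)
        have "card ?V \<noteq> 0" using cV n7 by simp
        then show "?V \<noteq> {}" by (metis card.empty)
        show "graphic_on ?V (dg ?F)" using del(1)[of v] by (auto simp: graphic_on_def)
        show "4 \<le> dg ?F x" if "x \<in> ?V" for x
          using dd[OF that] N less.prems(4)[of x] that by (auto split: if_splits)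
      qed (use less.prems(1) in simp)
      then have "S3_graphic (insert v ?V) d"
        by (rule S3_graphic_add_vertex[OF _ _ _ sub])
          (use less.prems(1,4) v(1) cN dd in \<open>auto simp: k_def\<close>)
      then show ?thesis using v(1) by (simp add: insert_absorb)
    qed
    obtain F where F: "simple_on V F" "\<forall>x\<in>V. dg F x = d x" using less.prems(3) by (auto simp: graphic_on_def)
    have kn: "k * n \<le> sum d V"
      using sum_bounded_below[of V k d] v(2) by (simp add: n_def k_def mult.commute)
    show ?thesis
    proof (cases "k = 4")
      case True
      show ?thesis
      proof (cases "4 \<le> card {x \<in> V. 5 \<le> d x}")
        case big: True
        show ?thesis
          using realization_with_large_neighbours[OF less.prems(3,1) v(1) _ big less.prems(4)] delete 3 True
          by (auto simp: k_def)
      next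
        case False
        define H where "H = {x \<in> V. 5 \<le> d x}"
        have HV: "H \<subseteq> V" "finite H" using less.prems(1) by (auto simp: H_def)
        have four: "d x = 4" if "x \<in> V - H" for x
          using that less.prems(4)[of x] by (auto simp: H_def)
        have "card (V - H) = n - card H" "card H \<le> n"
          using card_Diff_subset[OF HV(2,1)] card_mono[OF less.prems(1) HV(1)] by (auto simp: n_def)
        moreover have "sum d (V - H) = 4 * card (V - H)" using four by simp
        moreover have "sum d V = sum d (V - H) + sum d H" using sum.subset_diff[OF HV(1) less.prems(1)] .
        moreover have "sum d H \<le> card H * (n - 1)" using sum_bounded_above[of H d "n - 1"] up HV(1) by auto
        ultimately have *: "6 * n - 2 \<le> 4 * (n - card H) + card H * (n - 1)" "card H \<le> n" using 3(2) by linarith+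
        \<comment> \<open>Two vertices of degree above 4 reach a total of at most
          \<open>4 (n - 2) + 2 (n - 1) = 6 n - 10\<close>, and fewer reach even less.\<close>
        have "3 \<le> c" if "6 * n - 2 \<le> 4 * (n - c) + c * (n - 1)" for c
        proof (rule ccontr)
          assume "\<not> 3 \<le> c"
          then consider "c = 0" | "c = 1" | "c = 2" by linarith
          then show False
          proof cases
            case 1 then show False using that n7 by simp
          next
            case 2 then show False using that n7 by simp
          next
            case 3 then show False using that n7 by simp
          qed
        qed
        then have "card H = 3" using *(1) False unfolding H_def[symmetric] by fastforce
        then show ?thesis
          by (rule S3_graphic_three_hubs[OF less.prems(1) n_def[symmetric] HV(1) _ _ four _ ev])
            (use up HV(1) 3 in auto)
      qed
    next
      case False
      then have k5: "5 \<le> k" using less.prems(4)[OF v(1)] by (simp add: k_def)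
      then have five: "5 \<le> d x" if "x \<in> V" for x using v(2) that by (auto simp: k_def)
      show ?thesis
      proof (cases "6 * n + 2 * k \<le> sum d V + 10")
        case True
        then show ?thesis using delete[OF F] nbs_subset[OF F(1), of v] five by blast
      next
        case small: False
        have kle: "k \<le> n - 1" using up[OF v(1)] by (simp add: k_def)
        \<comment> \<open>From \<open>k n\<close> at most the sum, which is below
          \<open>6 n + 2 k - 10\<close>, one gets \<open>(k - 6) n < 2 k - 10\<close>; this
          contradicts \<open>n\<close> exceeding \<open>k\<close> once \<open>k\<close> is at least
          7.\<close>
        have "k \<le> 6"
        proof (rule ccontr)
          assume "\<not> k \<le> 6"
          then obtain j where j: "k = 7 + j" using le_Suc_ex[of 7 k] by auto
          have "8 + j \<le> n" using kle j n7 by linarith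
          then obtain i where i: "n = 8 + j + i" using le_Suc_ex by blast
          show False using kn small by (simp add: i j algebra_simps)
        qed
        then consider "k = 5" | "k = 6" using k5 by linarith
        then have s: "sum d V = 6 * n + 2 * k - 12"
        proof cases
          case 1
          have "s = 6 * n - 2" if "even s" "6 * n - 2 \<le> s" "\<not> 6 * n \<le> s" for s
            using that n7 by presburger
          then show ?thesis using 1 3(2) small ev by simp
        next
          case 2
          have "s = 6 * n" if "even s" "6 * n \<le> s" "\<not> 6 * n + 2 \<le> s" for s
            using that n7 by presburger
          then show ?thesis using 2 kn small ev by simp
        qed
        show ?thesis
          by (rule S3_graphic_near_tight[OF less.prems(1) n_def[symmetric] 3(1), of k d v])
            (use s v up k5 \<open>k \<le> 6\<close> in \<open>auto simp: k_def\<close>)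
      qed
    qed
  qed
qed

subsection \<open>Multigraphs\<close>

lemma out_in_degree:
  assumes "loopless_multigraph G" "orientation G D" "v \<in> vertices G"
  shows "out_degree D v + in_degree D v = degree G v"
proof -
  have ends: "{tail D e, head D e} = ends G e" "tail D e \<noteq> head D e" if "e \<in> edges G" for e
  proof -
    show *: "{tail D e, head D e} = ends G e" using assms(2) that by (simp add: orientation_def)
    have "card (ends G e) = 2" using assms(1) that by (simp add: loopless_multigraph_def)
    then show "tail D e \<noteq> head D e" by (auto simp flip: *)
  qed
  have A: "arcs D = edges G" "finite (edges G)"
    using assms(1,2) by (auto simp: orientation_def loopless_multigraph_def)
  have "{e \<in> edges G. v \<in> ends G e} = out_arcs D v \<union> in_arcs D v"
    using ends(1) A(1) by (auto simp: out_arcs_def in_arcs_def simp flip: ends(1))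
  moreover have "out_arcs D v \<inter> in_arcs D v = {}"
    using ends(2) A(1) unfolding out_arcs_def in_arcs_def by fastforce
  moreover have "finite (out_arcs D v)" "finite (in_arcs D v)"
    using A by (auto simp: out_arcs_def in_arcs_def)
  ultimately show ?thesis
    by (simp add: degree_def out_degree_def in_degree_def card_Un_disjoint)
qed

lemma sum_out_degree:
  assumes "loopless_multigraph G" "orientation G D"
  shows "(\<Sum>v\<in>vertices G. out_degree D v) = card (edges G)"
proof -
  have V: "finite (vertices G)" "finite (edges G)" "arcs D = edges G"
    using assms by (auto simp: loopless_multigraph_def orientation_def)
  have "tail D e \<in> vertices G" if "e \<in> edges G" for e
    using assms that by (auto simp: loopless_multigraph_def orientation_def) (metis insertI1 subsetD)
  then have "{v \<in> vertices G. tail D e = v} = {tail D e}" if "e \<in> edges G" for e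
    using that by blast
  then have "card {v \<in> vertices G. tail D e = v} = 1" if "e \<in> edges G" for e
    using that by simp
  then show ?thesis
    unfolding out_degree_def out_arcs_def V(3)
    using V(1,2) by (subst sum_multicount_gen[where k = "\<lambda>_. 1"]) auto
qed

lemma strongly_connected_degrees_pos:
  assumes "orientation G D" "strongly_connected D" "finite (edges G)" "v \<in> vertices G" "u \<in> vertices G" "u \<noteq> v"
  shows "1 \<le> out_degree D v" "1 \<le> in_degree D v"
proof -
  have vu: "v \<rightarrow>\<^sup>*\<^bsub>D\<^esub> u" "u \<rightarrow>\<^sup>*\<^bsub>D\<^esub> v"
    using assms by (auto simp: strongly_connected_def orientation_def)
  have fin: "finite (arcs D)" using assms by (simp add: orientation_def)
  have "(v, u) \<in> (arcs_ends D)\<^sup>*" "(u, v) \<in> (arcs_ends D)\<^sup>*"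
    using vu unfolding reachable_def by (auto dest: rtrancl_on_rtranclI)
  then obtain x y where "(v, x) \<in> arcs_ends D" "(y, v) \<in> arcs_ends D"
    using assms(6) by (metis converse_rtranclE rtranclE)
  then have "out_arcs D v \<noteq> {}" "in_arcs D v \<noteq> {}"
    by (auto simp: arcs_ends_conv out_arcs_def in_arcs_def)
  moreover have "finite (out_arcs D v)" "finite (in_arcs D v)"
    using fin by (auto simp: out_arcs_def in_arcs_def)
  ultimately show "1 \<le> out_degree D v" "1 \<le> in_degree D v"
    by (simp_all add: out_degree_def in_degree_def Suc_le_eq card_gt_0_iff)
qed

lemma sum_degree:
  assumes "loopless_multigraph G"
  shows "(\<Sum>v\<in>vertices G. degree G v) = 2 * card (edges G)"
proof -
  have V: "finite (vertices G)" "finite (edges G)"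
    using assms by (auto simp: loopless_multigraph_def)
  have "card {v \<in> vertices G. v \<in> ends G e} = 2" if "e \<in> edges G" for e
  proof -
    have "{v \<in> vertices G. v \<in> ends G e} = ends G e" "card (ends G e) = 2"
      using assms that by (auto simp: loopless_multigraph_def)
    then show ?thesis by simp
  qed
  then show ?thesis
    unfolding degree_def using V by (subst sum_multicount_gen[where k = "\<lambda>_. 2"]) auto
qed

text \<open>Since out-degree minus in-degree is \<open>2 * out_degree - degree\<close> and \<open>2\<close> is invertible modulo
  \<open>3\<close>, prescribing a boundary amounts to prescribing the out-degrees modulo \<open>3\<close>.\<close>

lemma S3_connected_out_degree:
  assumes "loopless_multigraph G" "S3_connected G"
    and "[(\<Sum>v\<in>vertices G. \<rho> v) = int (card (edges G))] (mod 3)"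
  shows "\<exists>D. orientation G D \<and> strongly_connected D \<and>
    (\<forall>v\<in>vertices G. [int (out_degree D v) = \<rho> v] (mod 3))"
proof -
  define \<beta> where "\<beta> v = (2 * \<rho> v - int (degree G v)) mod 3" for v
  have "[(\<Sum>v\<in>vertices G. \<beta> v) = (\<Sum>v\<in>vertices G. 2 * \<rho> v - int (degree G v))] (mod 3)"
    by (rule cong_sum) (simp add: \<beta>_def cong_def)
  also have "(\<Sum>v\<in>vertices G. 2 * \<rho> v - int (degree G v)) = 2 * (\<Sum>v\<in>vertices G. \<rho> v) - 2 * int (card (edges G))"
    using sum_degree[OF assms(1)] by (simp add: sum_subtractf flip: sum_distrib_left of_nat_sum)
  also have "[\<dots> = 2 * int (card (edges G)) - 2 * int (card (edges G))] (mod 3)"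
    by (intro cong_diff cong_scalar_left assms(3) cong_refl)
  finally have "[(\<Sum>v\<in>vertices G. \<beta> v) = 0] (mod 3)" by simp
  moreover have "\<beta> v \<in> {0, 1, 2}" for v
    unfolding \<beta>_def insert_iff empty_iff by presburger
  ultimately have "Z3_boundary G \<beta>" by (simp add: Z3_boundary_def)
  then obtain D where D: "orientation G D" "strongly_connected D"
      "\<forall>v\<in>vertices G. [int (out_degree D v) - int (in_degree D v) = \<beta> v] (mod 3)"
    using assms(2) by (auto simp: S3_connected_def)
  have "[int (out_degree D v) = \<rho> v] (mod 3)" if v: "v \<in> vertices G" for v
  proof -
    have "[a = r] (mod 3)" if "[a - b = (2 * r - (a + b)) mod 3] (mod 3)" for a b r :: int
    proof -
      have "[a - b = 2 * r - (a + b)] (mod 3)"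
        using that by (simp add: cong_def)
      then have "3 dvd 2 * (a - r)"
        by (simp add: cong_iff_dvd_diff algebra_simps)
      then show ?thesis unfolding cong_iff_dvd_diff by presburger
    qed
    then show ?thesis
      using bspec[OF D(3) v] out_in_degree[OF assms(1) D(1) v] unfolding \<beta>_def by (metis of_nat_add)
  qed
  then show ?thesis using D by blast
qed

lemma S3_connected_necessary:
  assumes "loopless_multigraph G" "S3_connected G" "2 \<le> card (vertices G)" "v \<in> vertices G"
  shows "4 \<le> degree G v" "3 * card (vertices G) \<le> card (edges G) + 2"
proof -
  have fin: "finite (vertices G)" "finite (edges G)" using assms(1) by (auto simp: loopless_multigraph_def)
  have other: "\<exists>u\<in>vertices G. u \<noteq> w" if "w \<in> vertices G" for w
  proof (rule ccontr)
    assume "\<not> ?thesis"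
    then have "vertices G = {w}" using that by blast
    then have "card (vertices G) = 1" by simp
    then show False using assms(3) by simp
  qed
  obtain u where u: "u \<in> vertices G" "u \<noteq> v" using other[OF assms(4)] by blast
  \<comment> \<open>The vertex \<open>u\<close> absorbs the whole total, so that the residue
    condition holds. Since \<open>u\<close> differs from \<open>v\<close>, one orientation yields
    both conclusions.\<close>
  define \<rho> where "\<rho> w = (if w = u then int (card (edges G)) else 0)" for w
  have "(\<Sum>w\<in>vertices G. \<rho> w) = int (card (edges G))"
    using fin u by (simp add: \<rho>_def)
  then obtain D where D: "orientation G D" "strongly_connected D"
      "\<forall>w\<in>vertices G. [int (out_degree D w) = \<rho> w] (mod 3)"
    using S3_connected_out_degree[OF assms(1,2), of \<rho>] by auto
  have pos: "1 \<le> out_degree D w" "1 \<le> in_degree D w" if "w \<in> vertices G" for w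
    using strongly_connected_degrees_pos[OF D(1,2) fin(2) that] other[OF that] by auto
  have three: "3 \<le> out_degree D w" if w: "w \<in> vertices G" "w \<noteq> u" for w
  proof -
    have "[int (out_degree D w) = 0] (mod 3)" using D(3) w by (auto simp: \<rho>_def)
    then show ?thesis using pos(1)[OF w(1)] unfolding cong_def by presburger
  qed
  show "4 \<le> degree G v"
    using out_in_degree[OF assms(1) D(1) assms(4)] three[OF assms(4)] pos(2)[OF assms(4)] u(2) by simp
  have "card (edges G) = out_degree D u + (\<Sum>w\<in>vertices G - {u}. out_degree D w)"
    using sum_out_degree[OF assms(1) D(1)] fin u(1) by (simp add: sum.remove)
  moreover have "3 * card (vertices G - {u}) \<le> (\<Sum>w\<in>vertices G - {u}. out_degree D w)"
    using sum_bounded_below[of "vertices G - {u}" 3 "out_degree D"] three by (simp add: mult.commute)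
  moreover have "card (vertices G - {u}) = card (vertices G) - 1" using u(1) fin by simp
  ultimately show "3 * card (vertices G) \<le> card (edges G) + 2"
    using pos(1)[OF u(1)] assms(3) by simp
qed

text \<open>Since \<open>F\<close> has no repeated edges, a multiset of arcs over it amounts to one
  chosen arc per edge; this turns multiset orientations into digraphs.\<close>

lemma preimages_of_edges:
  assumes "finite F" "image_mset u A = mset_set F"
  shows "\<exists>g. A = image_mset g (mset_set F) \<and> (\<forall>e\<in>F. u (g e) = e)"
  using assms
proof (induction F arbitrary: A rule: finite_induct)
  case (insert e F)
  have "image_mset u A = add_mset e (mset_set F)" using insert by simp
  then obtain p B where p: "A = add_mset p B" "u p = e" "image_mset u B = mset_set F"
    by (metis msed_map_invR)
  then obtain g where g: "B = image_mset g (mset_set F)" "\<forall>e\<in>F. u (g e) = e"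
    using insert.IH by blast
  have "image_mset (g(e := p)) (mset_set F) = image_mset g (mset_set F)"
    using insert.hyps by (intro image_mset_cong) auto
  then have "A = image_mset (g(e := p)) (mset_set (insert e F))"
    using p(1) g(1) insert.hyps by simp
  moreover have "\<forall>x\<in>insert e F. u ((g(e := p)) x) = x" using g(2) p(2) insert.hyps by auto
  ultimately show ?case by blast
qed simp

lemma S3_connected_of_simple:
  fixes f :: "'e \<Rightarrow> 'v set"
  assumes "simple_on V F" "finite V" "V \<noteq> {}" "S3 V (mset_set F)" "bij_betw f I F"
  shows "S3_connected \<lparr>vertices = V, edges = I, ends = f\<rparr>" (is "S3_connected ?G")
  unfolding S3_connected_def
proof (intro allI impI)
  fix \<beta> assume \<beta>: "Z3_boundary ?G \<beta>"
  have finF: "finite F" using simple_on_finite[OF assms(1,2)] .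
  have f: "inj_on f I" "f ` I = F" using assms(5) by (auto simp: bij_betw_def)
  have finI: "finite I" using finF f finite_image_iff by blast
  have G: "loopless_multigraph ?G"
    using assms(1,2) finI f(2) by (auto simp: loopless_multigraph_def simple_on_def)
  have cI: "card I = card F" using card_image[OF f(1)] f(2) by simp
  \<comment> \<open>Out-degree minus in-degree is \<open>\<beta> v\<close> and their sum is the
    degree, so twice the out-degree is \<open>\<beta> v\<close> plus the degree; 2 is its own
    inverse modulo 3.\<close>
  define \<rho> where "\<rho> v = 2 * (\<beta> v + int (degree ?G v))" for v
  have "(\<Sum>v\<in>V. \<rho> v) = 2 * (\<Sum>v\<in>V. \<beta> v) + 4 * int (card F)"
  proof -
    have "(\<Sum>v\<in>V. int (degree ?G v)) = 2 * int (card F)"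
      using sum_degree[OF G] cI by (simp flip: of_nat_sum)
    then show ?thesis by (simp add: \<rho>_def sum.distrib flip: sum_distrib_left)
  qed
  also have "[\<dots> = 2 * 0 + 1 * int (card F)] (mod 3)"
    using \<beta> by (intro cong_add cong_scalar_left cong_scalar_right) (auto simp: Z3_boundary_def cong_def)
  finally have "orientable V (mset_set F) \<rho>"
    using assms(4) finF by (simp add: S3_def)
  then obtain A where A: "image_mset uedge A = mset_set F" "\<forall>v\<in>V. [int (outdeg A v) = \<rho> v] (mod 3)" "strong_on V A"
    by (auto simp: orientable_def)
  obtain g where g: "A = image_mset g (mset_set F)" "\<forall>e\<in>F. uedge (g e) = e"
    using preimages_of_edges[OF finF A(1)] by blast
  define D where "D = \<lparr>verts = V, arcs = I, tail = (\<lambda>i. fst (g (f i))), head = (\<lambda>i. snd (g (f i)))\<rparr>"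
  have or: "orientation ?G D"
    using g(2) f(2) by (auto simp: orientation_def D_def uedge_def)
  have out: "out_degree D v = outdeg A v" for v
  proof -
    have "out_arcs D v = {i \<in> I. fst (g (f i)) = v}" by (simp add: out_arcs_def D_def)
    moreover have "f ` {i \<in> I. fst (g (f i)) = v} = {e \<in> F. fst (g e) = v}" using f(2) by auto
    moreover have "inj_on f {i \<in> I. fst (g (f i)) = v}" using f(1) by (rule inj_on_subset) auto
    ultimately have "out_degree D v = card {e \<in> F. fst (g e) = v}"
      using card_image by (fastforce simp: out_degree_def)
    then show ?thesis
      using finF by (simp add: outdeg_def g(1) filter_mset_image_mset filter_mset_mset_set)
  qed
  have "strongly_connected D"
  proof -
    have ends: "arcs_ends D = set_mset A"
      using f(2) finF by (auto simp: arcs_ends_conv D_def g(1) image_iff)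
    \<comment> \<open>Reachability in a digraph demands walks within its vertex set; every arc lies
      over an edge inside \<open>V\<close>, so the walks at hand stay there.\<close>
    have "(x, y) \<in> rtrancl_on V (set_mset A)" if "(x, y) \<in> (set_mset A)\<^sup>*" "x \<in> V" for x y
      using that(1)
    proof (induction rule: rtrancl_induct)
      case base
      then show ?case using that(2) by simp
    next
      case (step y z)
      then obtain e where e: "e \<in> F" "g e = (y, z)" using g(1) finF by auto
      then have "e = {y, z}" using g(2) by (auto simp: uedge_def)
      then have "z \<in> V" using e(1) assms(1) by (auto simp: simple_on_def)
      then show ?case using step by (meson rtrancl_on_into_rtrancl_on)
    qed
    then show ?thesis
      using A(3) assms(3) unfolding strongly_connected_def reachable_def ends
      by (auto simp: strong_on_def D_def)
  qed
  moreover have "[int (out_degree D v) - int (in_degree D v) = \<beta> v] (mod 3)" if v: "v \<in> V" for v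
  proof -
    have "[a - b = t] (mod 3)" if "[a = 2 * (t + (a + b))] (mod 3)" for a b t :: int
    proof -
      have "3 dvd a - 2 * (t + (a + b))" using that by (simp only: cong_iff_dvd_diff)
      then have "3 dvd - (a - 2 * (t + (a + b))) - 3 * (t + b)"
        by (intro dvd_diff) (simp_all only: dvd_minus_iff dvd_triv_left)
      moreover have "- (a - 2 * (t + (a + b))) - 3 * (t + b) = a - b - t" by simp
      ultimately show ?thesis by (simp only: cong_iff_dvd_diff)
    qed
    moreover have "[int (out_degree D v) = 2 * (\<beta> v + (int (out_degree D v) + int (in_degree D v)))] (mod 3)"
      using bspec[OF A(2) v] out_in_degree[OF G or, of v] v
      by (simp only: out \<rho>_def multigraph.select_convs flip: of_nat_add)
    ultimately show ?thesis by blast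
  qed
  ultimately show "\<exists>D. orientation ?G D \<and> strongly_connected D \<and>
      (\<forall>v\<in>vertices ?G. [int (out_degree D v) - int (in_degree D v) = \<beta> v] (mod 3))"
    using or by auto
qed

lemma simple_multigraph_edge_sets:
  assumes "simple_multigraph G"
  shows "simple_on (vertices G) (ends G ` edges G)" "dg (ends G ` edges G) v = degree G v"
proof -
  show "simple_on (vertices G) (ends G ` edges G)"
    using assms by (auto simp: simple_multigraph_def loopless_multigraph_def simple_on_def)
  have inj: "inj_on (ends G) (edges G)" using assms by (simp add: simple_multigraph_def)
  have "{e \<in> ends G ` edges G. v \<in> e} = ends G ` {e \<in> edges G. v \<in> ends G e}" by auto
  moreover have "inj_on (ends G) {e \<in> edges G. v \<in> ends G e}" using inj by (rule inj_on_subset) auto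
  ultimately show "dg (ends G ` edges G) v = degree G v"
    by (simp add: dg_def degree_def card_image)
qed

theorem theorem1p4:
  fixes n :: nat and d :: "nat \<Rightarrow> int"
  assumes "graphic n d"
    and "\<forall>i \<in> {1..n}. \<forall>j \<in> {1..n}. i \<le> j \<longrightarrow> d j \<le> d i"
    and "d n > 0"
  shows "(\<exists>G :: (nat, nat) multigraph. realization G n d \<and> S3_connected G) \<longleftrightarrow>
         (\<Sum>i = 1..n. d i) \<ge> 6 * int n - 4 \<and> d n \<ge> 4"
proof -
  have facts: "simple_multigraph G" "loopless_multigraph G" "card (vertices G) = n" "2 \<le> n"
      "(\<Sum>i = 1..n. d i) = int (\<Sum>v\<in>vertices G. degree G v)"
      "\<exists>v. bij_betw v {1..n} (vertices G) \<and> (\<forall>i\<in>{1..n}. int (degree G (v i)) = d i)"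
    if "realization G n d" for G :: "(nat, nat) multigraph"
  proof -
    show G: "simple_multigraph G" "loopless_multigraph G"
      and ex: "\<exists>v. bij_betw v {1..n} (vertices G) \<and> (\<forall>i\<in>{1..n}. int (degree G (v i)) = d i)"
      using that by (auto simp: realization_def has_degree_sequence_def simple_multigraph_def)
    then obtain v where v: "bij_betw v {1..n} (vertices G)" "\<forall>i\<in>{1..n}. int (degree G (v i)) = d i" by blast
    show c: "card (vertices G) = n" using bij_betw_same_card[OF v(1)] by simp
    show "2 \<le> n" using that c by (simp add: realization_def)
    have "(\<Sum>i = 1..n. d i) = (\<Sum>i = 1..n. int (degree G (v i)))" using v(2) by (intro sum.cong) auto
    also have "\<dots> = (\<Sum>w\<in>vertices G. int (degree G w))" by (rule sum.reindex_bij_betw[OF v(1)])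
    finally show "(\<Sum>i = 1..n. d i) = int (\<Sum>v\<in>vertices G. degree G v)" by simp
  qed
  show ?thesis
  proof
    assume "\<exists>G :: (nat, nat) multigraph. realization G n d \<and> S3_connected G"
    then obtain G :: "(nat, nat) multigraph" where G: "realization G n d" "S3_connected G" by blast
    note fG = facts[OF G(1)]
    obtain v where v: "bij_betw v {1..n} (vertices G)" "\<forall>i\<in>{1..n}. int (degree G (v i)) = d i" using fG(6) by blast
    have n: "n \<in> {1..n}" using fG(4) by simp
    then have vn: "v n \<in> vertices G" using v(1) by (auto simp: bij_betw_def)
    note nec = S3_connected_necessary[OF fG(2) G(2) _ vn]
    have "4 \<le> degree G (v n)" using nec(1) fG(3,4) by simp
    moreover have "int (degree G (v n)) = d n" using v(2) n by blast
    ultimately have "4 \<le> d n" by linarith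
    moreover have "6 * int n - 4 \<le> (\<Sum>i = 1..n. d i)"
      using nec(2) fG(3,4,5) sum_degree[OF fG(2)] by simp
    ultimately show "(\<Sum>i = 1..n. d i) \<ge> 6 * int n - 4 \<and> d n \<ge> 4" by simp
  next
    assume R: "(\<Sum>i = 1..n. d i) \<ge> 6 * int n - 4 \<and> d n \<ge> 4"
    obtain G :: "(nat, nat) multigraph" where G: "realization G n d" using assms(1) by (auto simp: graphic_def)
    note fG = facts[OF G]
    obtain v where v: "bij_betw v {1..n} (vertices G)" "\<forall>i\<in>{1..n}. int (degree G (v i)) = d i" using fG(6) by blast
    have V: "finite (vertices G)" "vertices G \<noteq> {}"
      using fG(2,3,4) by (auto simp: loopless_multigraph_def)
    have "S3_graphic (vertices G) (degree G)"
    proof (rule S3_graphic_graphic_on[OF V])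
      show "graphic_on (vertices G) (degree G)"
        using simple_multigraph_edge_sets[OF fG(1)] by (auto simp: graphic_on_def)
      show "6 * card (vertices G) \<le> sum (degree G) (vertices G) + 4"
        using R fG(3,5) by linarith
      fix x assume "x \<in> vertices G"
      then have "x \<in> v ` {1..n}" using v(1) by (simp add: bij_betw_def)
      then obtain i where i: "i \<in> {1..n}" "x = v i" by blast
      then have "d n \<le> d i" using assms(2) by auto
      then have "4 \<le> int (degree G x)" using R v(2) i by auto
      then show "4 \<le> degree G x" by simp
    qed
    then obtain F where F: "simple_on (vertices G) F" "S3 (vertices G) (mset_set F)"
        "\<forall>x\<in>vertices G. dg F x = degree G x"
      by (auto simp: S3_graphic_def)
    obtain f where f: "bij_betw f {0..<card F} F"
      using ex_bij_betw_nat_finite[OF simple_on_finite[OF F(1) V(1)]] by blast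
    \<comment> \<open>The new graph keeps the vertices of \<open>G\<close>; its edges are numbered
      so that they are natural numbers, as the statement requires.\<close>
    let ?H = "\<lparr>vertices = vertices G, edges = {0..<card F}, ends = f\<rparr> :: (nat, nat) multigraph"
    have inj: "inj_on f {0..<card F}" "f ` {0..<card F} = F" using f by (auto simp: bij_betw_def)
    have H: "simple_multigraph ?H"
      using F(1) V(1) inj by (auto simp: simple_multigraph_def loopless_multigraph_def simple_on_def)
    have "degree ?H x = degree G x" if "x \<in> vertices G" for x
      using simple_multigraph_edge_sets(2)[OF H, of x] inj(2) F(3) that by simp
    then have "\<forall>i\<in>{1..n}. int (degree ?H (v i)) = d i"
      using bij_betwE[OF v(1)] v(2) by simp
    then have "has_degree_sequence ?H n d"
      using v(1) unfolding has_degree_sequence_def by (intro exI[of _ v]) simp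
    then have "realization ?H n d" using H fG(3,4) by (simp add: realization_def)
    moreover have "S3_connected ?H" by (rule S3_connected_of_simple[OF F(1) V F(2) f])
    ultimately show "\<exists>G :: (nat, nat) multigraph. realization G n d \<and> S3_connected G" by blast
  qed
qed

end
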